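(* Let $\mu$ be a sofic random rooted simplicial complex (i.e. a sofic random rooted simplicial $\{1\}$-complex on $\mathcal{SC}_*^D(\{1\})$) and let $G$ be a finite group. For all irreducible complex representations $\rho$ of $G$ and all $n\in\mathbb{N}_0$ the following identity holds: \[ m_n^{(2)}(\rho,\mathrm{ind}_1^G(\mu)) = \frac{\dim_{\mathbb{C}}(\rho)}{|G|}\, b_n^{(2)}(\mu).\]
   Context: **Rooted $G$-complexes.** In what follows $G$ is an arbitrary finite group (including the trivial group) and $D>0$ a fixed constant. Simplicial complexes are nonempty; $K^{(0)}$ is the vertex set of $K$; the degree of a vertex is the number of $1$-simplices containing it, and the vertex degree of $K$ is the supremum of the degrees. A simplicial $G$-complex is a simplicial complex with an action of $G$ by simplicial automorphisms. For $\emptyset\neq V\subseteq K^{(0)}$ and $r>0$, $B_r(K,V)$ is the full subcomplex of $K$ on all vertices of path distance at most $r$ from some vertex of $V$. A rooted simplicial $G$-complex is a pair $(K,o)$ of a simplicial $G$-complex $K$ and a $G$-orbit $o\subseteq K^{(0)}$ meeting every connected component of $K$. An isomorphism $(K,o)\cong_G(L,o')$ is a $G$-equivariant simplicial isomorphism $K\to L$ mapping $o$ onto $o'$. $\mathcal{SC}_*^D(G)$ is the set of isomorphism classes $[K,o]$ with vertex degree at most $D$, with the (possibly infinite-valued) metric $d([K,o],[L,o'])=\inf\{2^{-r} : (B_r(K,o),o)\cong_G (B_r(L,o'),o')\}$; it is compact and totally disconnected. Similarly, $\mathcal{SC}_{**}^D(G)$ is the space of isomorphism classes $[K,o,o']$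 of simplicial $G$-complexes of vertex degree at most $D$ with two vertex orbits each meeting every connected component (isomorphisms preserve both orbits; the topology is defined in the same way using balls $B_r(K,o\cup o')$). A random rooted simplicial $G$-complex is a Borel probability measure $\mu$ on $\mathcal{SC}_*^D(G)$ that is unimodular: for all Borel $f\colon\mathcal{SC}_{**}^D(G)\to\mathbb{R}_{\ge0}$, \[\int\sum_{x\in K^{(0)}}f([K,o,Gx])\,d\mu([K,o])=\int\sum_{x\in K^{(0)}}f([K,Gx,o])\,d\mu([K,o]).\] For $G=\{1\}$ one speaks of a random rooted simplicial complex. **Sofic.** For a finite simplicial $G$-complex $K$ of vertex degree at most $D$, let $\mu_K^G=\frac{1}{|K^{(0)}|}\sum_{x\in K^{(0)}}\delta_{[K,Gx]}$, where $[K,Gx]$ denotes the class of the union of those connected components of $K$ that meet $Gx$, rooted at $Gx$. A random rooted simplicial $G$-complex is sofic if it is the weak limit of $\mu^G_{K_j}$ for some sequence $(K_j)_j$ of finite simplicial $G$-complexes of vertex degree at most $D$. **Induction.** For a subgroup $H\le G$ and an $H$-set $Y$, $G\times_H Y$ is the quotient of $G\times Y$ by $(g,y)\sim(gh,h^{-1}y)$, $h\in H$; the class of $(g,y)$ is $\lfloor g,y\rfloor$ and $g_2\lfloor g_1,y\rfloor=\lfloor g_2g_1,y\rfloor$. For a simplicial $H$-complex $K$, $G\times_HK$ is the simplicial $G$-complex with vertex set $G\times_HK^{(0)}$ and simplices $\{\lfloor g,x\rfloor: x\in\sigma\}$ for $g\in G$ and $\sigma$ a simplex of $K$. The map $\mathrm{ind}_H^G\colon\mathcal{SC}_*^D(H)\to\mathcal{SC}_*^D(G)$,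 $[K,o]\mapsto[G\times_HK,G\lfloor1,o\rfloor]$ is continuous, and for a random rooted simplicial $H$-complex $\mu$, $\mathrm{ind}_H^G(\mu)$ denotes the push-forward measure, a random rooted simplicial $G$-complex. Here $H=\{1\}$, written $\mathrm{ind}_1^G$. **$\ell^2$-chains.** Let $\mathrm{Orb}(G)$ be the finite set of isomorphism classes of transitive $G$-sets (with fixed representatives), $\mathbb{N}_G=\bigsqcup_{X\in\mathrm{Orb}(G)}\mathbb{N}_0\times X$ with $G$ acting on the second coordinate, and $\Delta^D(\mathbb{N}_G)$ the simplicial $G$-complex of all nonempty subsets of $\mathbb{N}_G$ with at most $D+1$ elements; $\Delta^D(\mathbb{N}_G)(n)$ is its set of $n$-simplices. Let $\mathrm{Sub}(\Delta^D(\mathbb{N}_G))\subseteq\{0,1\}^{\Delta^D(\mathbb{N}_G)}$ (product topology) be the space of (indicator functions of) $G$-invariant subcomplexes containing exactly one orbit of the form $\{0\}\times X$. Fix a continuous map $\Psi\colon\mathcal{SC}_*^D(G)\to\mathrm{Sub}(\Delta^D(\mathbb{N}_G))$ such that $(\Psi([K,o]),\{0\}\times X)$ represents $[K,o]$, where $X\cong o$ (such a map exists). For a simplicial complex $L$, $C_n^{(2)}(L)$ is the complex Hilbert space of square-summable oriented $n$-chains. For an oriented $n$-simplex $s$ of $\Delta^D(\mathbb{N}_G)$ put $\xi_s([K,o])=s$ if $s$ belongs to $\Psi([K,o])$ and $0$ otherwise. The $\xi_s$ form a fundamental sequence of a measurable field of Hilbert spaces $[K,o]\mapsto C_n^{(2)}(\Psi([K,o]))$;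 let $C_n^{(2)}(\mathcal{SC}_*^D(G),\mu)=\int^\oplus C_n^{(2)}(\Psi([K,o]))\,d\mu$ be the direct integral, with the fibrewise unitary $G$-action. The fibrewise boundary maps and their adjoints give bounded $G$-equivariant operators $\partial_n\colon C_n^{(2)}\to C_{n-1}^{(2)}$ and $d_n=\partial_n^*$; the Laplacian is $\Delta_n=\partial_{n+1}d_{n+1}+d_n\partial_n$, and $H_n^{(2)}(\mathcal{SC}_*^D(G),\mu)=\ker\Delta_n$. **Trace and multiplicities.** Let $\mathcal{A}_n(\mu)$ be the von Neumann algebra of bounded decomposable operators $T=\int^\oplus T_{[K,o]}d\mu$ on $C_n^{(2)}(\mathcal{SC}_*^D(G),\mu)$ which are compatible (almost everywhere) with all isomorphisms of simplicial $G$-complexes $\phi\colon\Psi([K,o])\to\Psi([K,o'])$, i.e. $\langle T_{[K,o]}\sigma,\sigma\rangle=\langle T_{[K,o']}\phi_\sharp\sigma,\phi_\sharp\sigma\rangle$, where $\phi_\sharp$ is the induced chain map. It carries the finite faithful normal trace \[\mathrm{tr}(T)=\sum_{X\in\mathrm{Orb}(G)}\sum_{x\in X}\ \sum_{s\in\Delta^D(\mathbb{N}_G)(n),\,(0,x)\in s}\frac{\langle T\xi_s,\xi_s\rangle}{|X|(n+1)}\] (each $s$ given an arbitrary orientation). For a subspace $\mathcal{K}$ whose orthogonal projection $\mathrm{pr}_{\mathcal{K}}$ lies in $\mathcal{A}_n(\mu)$, $\dim_{\mathrm{vN}}\mathcal{K}=\mathrm{tr}(\mathrm{pr}_{\mathcal{K}})$.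 For an irreducible complex representation $\rho$ of $G$ with character $\chi_\rho$, the $\ell^2$-multiplicity is $m_n^{(2)}(\rho,\mu)=\frac{1}{\chi_\rho(1)}\dim_{\mathrm{vN}}H_n^{(2)}(\mathcal{SC}_*^D(G),\mu)_\rho$, where the subscript $\rho$ denotes the $\rho$-isotypic component, i.e. the image of $P_\rho=\frac{\chi_\rho(1)}{|G|}\sum_{g\in G}\overline{\chi_\rho(g)}\,g$. For the trivial group and its unique irreducible representation $\mathbf{1}$, the $\ell^2$-Betti number is $b_n^{(2)}(\mu)=m_n^{(2)}(\mathbf{1},\mu)=\dim_{\mathrm{vN}}H_n^{(2)}(\mathcal{SC}_*^D(\{1\}),\mu)$. *)

theory Defs
  imports "HOL-Probability.Probability" "HOL-Algebra.Group_Action"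
    "HOL-Combinatorics.Permutations"
begin

section \<open>Simplicial G-complexes\<close>

text \<open>A group action is the library's \<open>group_action\<close>, so \<open>action K g\<close> is extensional on the vertex
  set for every \<open>g\<close> in the carrier.\<close>

record ('g, 'v) gcomplex =
  simplices :: "'v set set"
  action :: "'g \<Rightarrow> 'v \<Rightarrow> 'v"

definition simplicial_complex :: "'v set set \<Rightarrow> bool" where
  "simplicial_complex S \<longleftrightarrow> S \<noteq> {} \<and> (\<forall>\<sigma>\<in>S. finite \<sigma> \<and> \<sigma> \<noteq> {}) \<and>
     (\<forall>\<sigma>\<in>S. \<forall>\<tau>. \<tau> \<subseteq> \<sigma> \<and> \<tau> \<noteq> {} \<longrightarrow> \<tau> \<in> S)"

definition verts :: "('g, 'v) gcomplex \<Rightarrow> 'v set" where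
  "verts K = \<Union> (simplices K)"

definition simplicial_gcomplex :: "'g monoid \<Rightarrow> ('g, 'v) gcomplex \<Rightarrow> bool" where
  "simplicial_gcomplex G K \<longleftrightarrow> simplicial_complex (simplices K) \<and>
     group_action G (verts K) (action K) \<and>
     (\<forall>g\<in>carrier G. \<forall>\<sigma>\<in>simplices K. action K g ` \<sigma> \<in> simplices K)"

definition degree_bounded :: "nat \<Rightarrow> ('g, 'v) gcomplex \<Rightarrow> bool" where
  "degree_bounded D K \<longleftrightarrow> (\<forall>v\<in>verts K.
     finite {\<sigma>\<in>simplices K. card \<sigma> = 2 \<and> v \<in> \<sigma>} \<and>
     card {\<sigma>\<in>simplices K. card \<sigma> = 2 \<and> v \<in> \<sigma>} \<le> D)"

definition adjacent :: "('g, 'v) gcomplex \<Rightarrow> ('v \<times> 'v) set" where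
  "adjacent K = {(u, v). u \<noteq> v \<and> {u, v} \<in> simplices K}"

definition full_subcomplex :: "('g, 'v) gcomplex \<Rightarrow> 'v set \<Rightarrow> ('g, 'v) gcomplex" where
  "full_subcomplex K V =
     \<lparr>simplices = {\<sigma>\<in>simplices K. \<sigma> \<subseteq> V}, action = (\<lambda>g. restrict (action K g) V)\<rparr>"

definition cball_complex :: "real \<Rightarrow> ('g, 'v) gcomplex \<Rightarrow> 'v set \<Rightarrow> ('g, 'v) gcomplex" where
  "cball_complex r K V =
     full_subcomplex K {v\<in>verts K. \<exists>u\<in>V. \<exists>m. real m \<le> r \<and> (u, v) \<in> adjacent K ^^ m}"

definition components_meeting :: "('g, 'v) gcomplex \<Rightarrow> 'v set \<Rightarrow> ('g, 'v) gcomplex" where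
  "components_meeting K V = full_subcomplex K {v\<in>verts K. \<exists>u\<in>V. (u, v) \<in> (adjacent K)\<^sup>*}"

section \<open>The spaces of rooted G-complexes\<close>

text \<open>Complexes with one root orbit and complexes with two root orbits are treated uniformly:
  the root orbits form a list.\<close>

definition rooted_gcomplex :: "'g monoid \<Rightarrow> ('g, 'v) gcomplex \<Rightarrow> 'v set list \<Rightarrow> bool" where
  "rooted_gcomplex G K os \<longleftrightarrow> simplicial_gcomplex G K \<and>
     (\<forall>o'\<in>set os. o' \<in> orbits G (verts K) (action K) \<and>
        (\<forall>v\<in>verts K. \<exists>u\<in>o'. (u, v) \<in> (adjacent K)\<^sup>*))"

definition rooted_iso :: "'g monoid \<Rightarrow> ('g, 'v) gcomplex \<Rightarrow> 'v set list \<Rightarrow>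
    ('g, 'w) gcomplex \<Rightarrow> 'w set list \<Rightarrow> bool" where
  "rooted_iso G K os L os' \<longleftrightarrow> (\<exists>f. bij_betw f (verts K) (verts L) \<and>
     (`) f ` simplices K = simplices L \<and>
     (\<forall>g\<in>carrier G. \<forall>x\<in>verts K. f (action K g x) = action L g (f x)) \<and>
     map ((`) f) os = os')"

text \<open>With bounded degree and one root orbit meeting every component, all complexes are countable.
  The isomorphism class of a complex with arbitrary vertex type is therefore
  represented by the (nonempty) set of its isomorphic copies with vertices in \<open>nat\<close>.\<close>

type_synonym 'g rclass = "(('g, nat) gcomplex \<times> nat set list) set"

definition rooted_class :: "'g monoid \<Rightarrow> ('g, 'v) gcomplex \<Rightarrow> 'v set list \<Rightarrow> 'g rclass" where
  "rooted_class G K os = {(L, os'). simplicial_gcomplex G L \<and> rooted_iso G K os L os'}"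

definition SC :: "'g monoid \<Rightarrow> nat \<Rightarrow> nat \<Rightarrow> 'g rclass set" where
  "SC G D k = {rooted_class G K os | (K :: ('g, nat) gcomplex) os.
     rooted_gcomplex G K os \<and> length os = k \<and> degree_bounded D K}"

definition SC_dist :: "'g monoid \<Rightarrow> 'g rclass \<Rightarrow> 'g rclass \<Rightarrow> ereal" where
  "SC_dist G c c' = (INF r\<in>{r::real. r > 0 \<and> (\<exists>(K, os)\<in>c. \<exists>(L, os')\<in>c'.
     rooted_iso G (cball_complex r K (\<Union> (set os))) os (cball_complex r L (\<Union> (set os'))) os')}.
     ereal (2 powr (- r)))"

definition SC_top :: "'g monoid \<Rightarrow> nat \<Rightarrow> nat \<Rightarrow> 'g rclass topology" where
  "SC_top G D k = topology (\<lambda>U. U \<subseteq> SC G D k \<and>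
     (\<forall>c\<in>U. \<exists>e>0. \<forall>c'\<in>SC G D k. SC_dist G c c' < e \<longrightarrow> c' \<in> U))"

lemma openin_SC_top:
  "openin (SC_top G D k) U \<longleftrightarrow> U \<subseteq> SC G D k \<and>
     (\<forall>c\<in>U. \<exists>e>0. \<forall>c'\<in>SC G D k. SC_dist G c c' < e \<longrightarrow> c' \<in> U)"
proof -
  let ?P = "\<lambda>U. U \<subseteq> SC G D k \<and>
     (\<forall>c\<in>U. \<exists>e>0. \<forall>c'\<in>SC G D k. SC_dist G c c' < e \<longrightarrow> c' \<in> U)"
  have "istopology ?P"
    unfolding istopology_def
  proof (intro conjI allI impI)
    fix S T assume S: "?P S" and T: "?P T"
    show "S \<inter> T \<subseteq> SC G D k" using S by blast
    show "\<forall>c\<in>S \<inter> T. \<exists>e>0. \<forall>c'\<in>SC G D k. SC_dist G c c' < e \<longrightarrow> c' \<in> S \<inter> T"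
    proof
      fix c assume c: "c \<in> S \<inter> T"
      obtain d where d: "d > 0" "\<forall>c'\<in>SC G D k. SC_dist G c c' < d \<longrightarrow> c' \<in> S"
        using S c by blast
      obtain e where e: "e > 0" "\<forall>c'\<in>SC G D k. SC_dist G c c' < e \<longrightarrow> c' \<in> T"
        using T c by blast
      show "\<exists>e>0. \<forall>c'\<in>SC G D k. SC_dist G c c' < e \<longrightarrow> c' \<in> S \<inter> T"
        using d e by (intro exI[of _ "min d e"]) simp
    qed
  next
    fix \<K> assume K: "\<forall>K\<in>\<K>. ?P K"
    show "\<Union> \<K> \<subseteq> SC G D k" using K by blast
    show "\<forall>c\<in>\<Union> \<K>. \<exists>e>0. \<forall>c'\<in>SC G D k. SC_dist G c c' < e \<longrightarrow> c' \<in> \<Union> \<K>"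
    proof
      fix c assume "c \<in> \<Union> \<K>"
      then obtain U where U: "U \<in> \<K>" "c \<in> U" by blast
      then obtain e where "e > 0" "\<forall>c'\<in>SC G D k. SC_dist G c c' < e \<longrightarrow> c' \<in> U"
        using K by blast
      then show "\<exists>e>0. \<forall>c'\<in>SC G D k. SC_dist G c c' < e \<longrightarrow> c' \<in> \<Union> \<K>"
        using U(1) by (intro exI[of _ e]) blast
    qed
  qed
  then show ?thesis
    unfolding SC_top_def by (simp add: topology_inverse')
qed

definition SC_borel :: "'g monoid \<Rightarrow> nat \<Rightarrow> nat \<Rightarrow> 'g rclass measure" where
  "SC_borel G D k = sigma (SC G D k) {U. openin (SC_top G D k) U}"

section \<open>Random rooted G-complexes\<close>

definition rep_complex :: "'g rclass \<Rightarrow> ('g, nat) gcomplex" where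
  "rep_complex c = fst (SOME Ko. Ko \<in> c)"

definition rep_root :: "'g rclass \<Rightarrow> nat set" where
  "rep_root c = hd (snd (SOME Ko. Ko \<in> c))"

definition unimodular :: "'g monoid \<Rightarrow> nat \<Rightarrow> 'g rclass measure \<Rightarrow> bool" where
  "unimodular G D \<mu> \<longleftrightarrow>
     (\<forall>f :: 'g rclass \<Rightarrow> real. f \<in> borel_measurable (SC_borel G D 2) \<longrightarrow> (\<forall>c\<in>SC G D 2. 0 \<le> f c) \<longrightarrow>
       (\<integral>\<^sup>+ c. (\<Sum>\<^sub>\<infinity>x\<in>verts (rep_complex c). ennreal (f (rooted_class G (rep_complex c)
            [rep_root c, orbit G (action (rep_complex c)) x]))) \<partial>\<mu>) =
       (\<integral>\<^sup>+ c. (\<Sum>\<^sub>\<infinity>x\<in>verts (rep_complex c). ennreal (f (rooted_class G (rep_complex c)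
            [orbit G (action (rep_complex c)) x, rep_root c]))) \<partial>\<mu>))"

definition random_rooted_gcomplex :: "'g monoid \<Rightarrow> nat \<Rightarrow> 'g rclass measure \<Rightarrow> bool" where
  "random_rooted_gcomplex G D \<mu> \<longleftrightarrow>
     prob_space \<mu> \<and> sets \<mu> = sets (SC_borel G D 1) \<and> unimodular G D \<mu>"

definition finite_complex_measure ::
    "'g monoid \<Rightarrow> nat \<Rightarrow> ('g, 'v) gcomplex \<Rightarrow> 'g rclass measure" where
  "finite_complex_measure G D K = distr (uniform_count_measure (verts K)) (SC_borel G D 1)
     (\<lambda>x. rooted_class G (components_meeting K (orbit G (action K) x)) [orbit G (action K) x])"

definition weak_limit :: "'a topology \<Rightarrow> (nat \<Rightarrow> 'a measure) \<Rightarrow> 'a measure \<Rightarrow> bool" where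
  "weak_limit X \<nu> \<mu> \<longleftrightarrow> (\<forall>f :: 'a \<Rightarrow> real.
     continuous_map X euclideanreal f \<and> bounded (f ` topspace X) \<longrightarrow>
     (\<lambda>j. integral\<^sup>L (\<nu> j) f) \<longlonglongrightarrow> integral\<^sup>L \<mu> f)"

definition sofic :: "'g monoid \<Rightarrow> nat \<Rightarrow> 'g rclass measure \<Rightarrow> bool" where
  "sofic G D \<mu> \<longleftrightarrow> (\<exists>K :: nat \<Rightarrow> ('g, nat) gcomplex.
     (\<forall>j. simplicial_gcomplex G (K j) \<and> finite (verts (K j)) \<and> degree_bounded D (K j)) \<and>
     weak_limit (SC_top G D 1) (\<lambda>j. finite_complex_measure G D (K j)) \<mu>)"

section \<open>Induction\<close>

definition ind_pt :: "'g monoid \<Rightarrow> 'g set \<Rightarrow> ('g \<Rightarrow> 'v \<Rightarrow> 'v) \<Rightarrow> 'g \<Rightarrow> 'v \<Rightarrow> ('g \<times> 'v) set" where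
  "ind_pt G H \<phi> g y = {(g \<otimes>\<^bsub>G\<^esub> h, \<phi> (inv\<^bsub>G\<^esub> h) y) | h. h \<in> H}"

definition ind_complex ::
    "'g monoid \<Rightarrow> 'g set \<Rightarrow> ('g, 'v) gcomplex \<Rightarrow> ('g, ('g \<times> 'v) set) gcomplex" where
  "ind_complex G H K =
     \<lparr>simplices = {ind_pt G H (action K) g ` \<sigma> | g \<sigma>. g \<in> carrier G \<and> \<sigma> \<in> simplices K},
      action = (\<lambda>g. restrict (\<lambda>p. (\<lambda>(g', y). (g \<otimes>\<^bsub>G\<^esub> g', y)) ` p)
        {ind_pt G H (action K) g' y | g' y. g' \<in> carrier G \<and> y \<in> verts K})\<rparr>"

definition ind_class :: "'g monoid \<Rightarrow> 'g set \<Rightarrow> 'g rclass \<Rightarrow> 'g rclass" where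
  "ind_class G H c = rooted_class G (ind_complex G H (rep_complex c))
     [{ind_pt G H (action (rep_complex c)) g x | g x. g \<in> carrier G \<and> x \<in> rep_root c}]"

definition ind_measure :: "'g monoid \<Rightarrow> 'g set \<Rightarrow> nat \<Rightarrow> 'g rclass measure \<Rightarrow> 'g rclass measure" where
  "ind_measure G H D \<mu> = distr \<mu> (SC_borel G D 1) (ind_class G H)"

section \<open>The universal complex and the map \<open>\<Psi>\<close>\<close>

type_synonym ('g, 'x) gset = "'x set \<times> ('g \<Rightarrow> 'x \<Rightarrow> 'x)"

definition transitive_gset :: "'g monoid \<Rightarrow> ('g, 'x) gset \<Rightarrow> bool" where
  "transitive_gset G X \<longleftrightarrow> fst X \<noteq> {} \<and> transitive_action G (fst X) (snd X)"

definition gset_iso :: "'g monoid \<Rightarrow> ('g, 'x) gset \<Rightarrow> ('g, 'y) gset \<Rightarrow> bool" where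
  "gset_iso G X Y \<longleftrightarrow> (\<exists>f. bij_betw f (fst X) (fst Y) \<and>
     (\<forall>g\<in>carrier G. \<forall>x\<in>fst X. f (snd X g x) = snd Y g (f x)))"

text \<open>A system of representatives of the isomorphism classes of transitive \<open>G\<close>-sets.  It suffices to
  test against \<open>G\<close>-sets consisting of subsets of \<open>G\<close>, since every transitive \<open>G\<close>-set is isomorphic to
  a set of cosets.\<close>

definition orbit_representatives :: "'g monoid \<Rightarrow> ('g, 'x) gset set \<Rightarrow> bool" where
  "orbit_representatives G Orb \<longleftrightarrow> (\<forall>X\<in>Orb. transitive_gset G X) \<and>
     (\<forall>Y :: ('g, 'g set) gset. transitive_gset G Y \<longrightarrow> (\<exists>!X. X \<in> Orb \<and> gset_iso G X Y))"

text \<open>The point \<open>(k, x)\<close> of the summand of \<open>\<nat>\<^sub>G\<close> belonging to \<open>X\<close> is the triple \<open>(k, X, x)\<close>.\<close>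

type_synonym ('g, 'x) nvert = "nat \<times> ('g, 'x) gset \<times> 'x"

definition NG :: "('g, 'x) gset set \<Rightarrow> ('g, 'x) nvert set" where
  "NG Orb = {(k, X, x). X \<in> Orb \<and> x \<in> fst X}"

text \<open>The action is the identity off \<open>\<nat>\<^sub>G\<close>, so no junk vertex is moved into \<open>\<nat>\<^sub>G\<close>.\<close>

definition NG_act :: "'g \<Rightarrow> ('g, 'x) nvert \<Rightarrow> ('g, 'x) nvert" where
  "NG_act g = (\<lambda>(k, X, x). (k, X, if x \<in> fst X then snd X g x else x))"

definition Delta :: "nat \<Rightarrow> ('g, 'x) gset set \<Rightarrow> ('g, 'x) nvert set set" where
  "Delta D Orb = {s. s \<subseteq> NG Orb \<and> s \<noteq> {} \<and> finite s \<and> card s \<le> D + 1}"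

definition base_orbit :: "('g, 'x) gset \<Rightarrow> ('g, 'x) nvert set" where
  "base_orbit X = (\<lambda>x. (0, X, x)) ` fst X"

definition Sub :: "'g monoid \<Rightarrow> nat \<Rightarrow> ('g, 'x) gset set \<Rightarrow> ('g, 'x) nvert set set set" where
  "Sub G D Orb = {S. S \<subseteq> Delta D Orb \<and> simplicial_complex S \<and>
     (\<forall>g\<in>carrier G. \<forall>s\<in>S. NG_act g ` s \<in> S) \<and>
     (\<exists>!X. X \<in> Orb \<and> base_orbit X \<subseteq> \<Union> S)}"

definition sub_gcomplex :: "('g, 'x) nvert set set \<Rightarrow> ('g, ('g, 'x) nvert) gcomplex" where
  "sub_gcomplex S = \<lparr>simplices = S, action = (\<lambda>g. restrict (NG_act g) (\<Union> S))\<rparr>"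

definition realization_map ::
    "'g monoid \<Rightarrow> nat \<Rightarrow> ('g, 'x) gset set \<Rightarrow> ('g rclass \<Rightarrow> ('g, 'x) nvert set set) \<Rightarrow> bool" where
  "realization_map G D Orb \<Psi> \<longleftrightarrow>
     (\<forall>c\<in>SC G D 1. \<Psi> c \<in> Sub G D Orb) \<and>
     continuous_map (SC_top G D 1) (product_topology (\<lambda>s. discrete_topology (UNIV :: bool set)) (Delta D Orb))
       (\<lambda>c. \<lambda>s\<in>Delta D Orb. s \<in> \<Psi> c) \<and>
     (\<forall>c\<in>SC G D 1. \<forall>K o'. (K, [o']) \<in> c \<longrightarrow>
       (\<exists>X\<in>Orb. gset_iso G X (o', action K) \<and>
          rooted_class G (sub_gcomplex (\<Psi> c)) [base_orbit X] = c))"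

section \<open>Square-summable chains\<close>

text \<open>An oriented chain is an alternating function on the ordered simplices, that is on the
  repetition-free vertex lists of simplices; its value at a list is the coefficient of the
  correspondingly oriented simplex.  Every \<open>n\<close>-simplex has \<open>(n+1)!\<close> orderings, whence the
  factorial in the inner product, which makes the oriented simplices unit vectors.\<close>

definition ordered_simplices :: "'v set set \<Rightarrow> 'v list set" where
  "ordered_simplices L = {xs. distinct xs \<and> set xs \<in> L}"

definition l2_chains :: "'v set set \<Rightarrow> nat \<Rightarrow> ('v list \<Rightarrow> complex) set" where
  "l2_chains L n = {f.
     (\<forall>xs. f xs \<noteq> 0 \<longrightarrow> xs \<in> ordered_simplices L \<and> length xs = n + 1) \<and>
     (\<forall>xs p. p permutes {..<length xs} \<longrightarrow> f (permute_list p xs) = of_int (sign p) * f xs) \<and>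
     (\<lambda>xs. (cmod (f xs))\<^sup>2) summable_on ordered_simplices L}"

definition chain_inner :: "'v set set \<Rightarrow> ('v list \<Rightarrow> complex) \<Rightarrow> ('v list \<Rightarrow> complex) \<Rightarrow> complex" where
  "chain_inner L f h = (\<Sum>\<^sub>\<infinity>xs\<in>ordered_simplices L. f xs * cnj (h xs) / fact (length xs))"

definition oriented_simplex :: "'v list \<Rightarrow> 'v list \<Rightarrow> complex" where
  "oriented_simplex xs = (\<lambda>ys. \<Sum>p | p permutes {..<length xs} \<and> ys = permute_list p xs. of_int (sign p))"

text \<open>The coefficient of \<open>ys\<close> in the boundary is the sum of the coefficients of all \<open>v # ys\<close>, since
  \<open>ys\<close> occurs with sign \<open>+1\<close> in the boundary of \<open>v # ys\<close>.  The empty list is not an ordered simplex,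
  so the boundary of a \<open>0\<close>-chain vanishes.\<close>

definition boundary :: "'v set set \<Rightarrow> ('v list \<Rightarrow> complex) \<Rightarrow> 'v list \<Rightarrow> complex" where
  "boundary L f = (\<lambda>ys. if ys \<in> ordered_simplices L
     then \<Sum>v | v # ys \<in> ordered_simplices L. f (v # ys) else 0)"

text \<open>The adjoint of the boundary operator from \<open>n\<close>-chains to \<open>(n-1)\<close>-chains.\<close>

definition coboundary :: "'v set set \<Rightarrow> nat \<Rightarrow> ('v list \<Rightarrow> complex) \<Rightarrow> 'v list \<Rightarrow> complex" where
  "coboundary L n f = (THE h. h \<in> l2_chains L n \<and>
     (\<forall>k\<in>l2_chains L n. chain_inner L (boundary L k) f = chain_inner L k h))"

definition laplacian :: "'v set set \<Rightarrow> nat \<Rightarrow> ('v list \<Rightarrow> complex) \<Rightarrow> 'v list \<Rightarrow> complex" where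
  "laplacian L n f = (\<lambda>xs. boundary L (coboundary L (n + 1) f) xs + coboundary L n (boundary L f) xs)"

section \<open>The direct integral\<close>

text \<open>Vectors of the direct integral are square-integrable measurable fields of chains; fields that
  agree almost everywhere are not identified, and all subspaces below are closed under almost
  everywhere equality.\<close>

type_synonym ('g, 'x) chain = "('g, 'x) nvert list \<Rightarrow> complex"
type_synonym ('g, 'x) chain_field = "'g rclass \<Rightarrow> ('g, 'x) chain"
type_synonym ('g, 'x) realization = "'g rclass \<Rightarrow> ('g, 'x) nvert set set"

definition xi :: "('g, 'x) realization \<Rightarrow> ('g, 'x) nvert list \<Rightarrow> ('g, 'x) chain_field" where
  "xi \<Psi> xs = (\<lambda>c. if set xs \<in> \<Psi> c then oriented_simplex xs else (\<lambda>_. 0))"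

definition l2_fields :: "nat \<Rightarrow> ('g, 'x) gset set \<Rightarrow> ('g, 'x) realization \<Rightarrow> nat \<Rightarrow>
    'g rclass measure \<Rightarrow> ('g, 'x) chain_field set" where
  "l2_fields D Orb \<Psi> n \<mu> = {F. (\<forall>c\<in>space \<mu>. F c \<in> l2_chains (\<Psi> c) n) \<and>
     (\<forall>xs\<in>ordered_simplices (Delta D Orb). length xs = n + 1 \<longrightarrow>
        (\<lambda>c. chain_inner (\<Psi> c) (F c) (xi \<Psi> xs c)) \<in> borel_measurable \<mu>) \<and>
     integrable \<mu> (\<lambda>c. chain_inner (\<Psi> c) (F c) (F c))}"

definition field_inner :: "('g, 'x) realization \<Rightarrow> 'g rclass measure \<Rightarrow>
    ('g, 'x) chain_field \<Rightarrow> ('g, 'x) chain_field \<Rightarrow> complex" where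
  "field_inner \<Psi> \<mu> F F' = (\<integral>c. chain_inner (\<Psi> c) (F c) (F' c) \<partial>\<mu>)"

definition orth_proj :: "('g, 'x) realization \<Rightarrow> 'g rclass measure \<Rightarrow>
    ('g, 'x) chain_field set \<Rightarrow> ('g, 'x) chain_field \<Rightarrow> ('g, 'x) chain_field" where
  "orth_proj \<Psi> \<mu> \<K> F = (SOME P. P \<in> \<K> \<and>
     (\<forall>Q\<in>\<K>. field_inner \<Psi> \<mu> (\<lambda>c xs. F c xs - P c xs) Q = 0))"

definition orient :: "'v set \<Rightarrow> 'v list" where
  "orient s = (SOME xs. distinct xs \<and> set xs = s)"

definition vN_trace :: "nat \<Rightarrow> ('g, 'x) gset set \<Rightarrow> ('g, 'x) realization \<Rightarrow> nat \<Rightarrow>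
    'g rclass measure \<Rightarrow> (('g, 'x) chain_field \<Rightarrow> ('g, 'x) chain_field) \<Rightarrow> complex" where
  "vN_trace D Orb \<Psi> n \<mu> T = (\<Sum>X\<in>Orb. \<Sum>x\<in>fst X.
     \<Sum>\<^sub>\<infinity>s | s \<in> Delta D Orb \<and> card s = n + 1 \<and> (0, X, x) \<in> s.
       field_inner \<Psi> \<mu> (T (xi \<Psi> (orient s))) (xi \<Psi> (orient s)) /
         (of_nat (card (fst X)) * of_nat (n + 1)))"

definition vN_dim :: "nat \<Rightarrow> ('g, 'x) gset set \<Rightarrow> ('g, 'x) realization \<Rightarrow> nat \<Rightarrow>
    'g rclass measure \<Rightarrow> ('g, 'x) chain_field set \<Rightarrow> complex" where
  "vN_dim D Orb \<Psi> n \<mu> \<K> = vN_trace D Orb \<Psi> n \<mu> (orth_proj \<Psi> \<mu> \<K>)"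

definition l2_homology :: "nat \<Rightarrow> ('g, 'x) gset set \<Rightarrow> ('g, 'x) realization \<Rightarrow> nat \<Rightarrow>
    'g rclass measure \<Rightarrow> ('g, 'x) chain_field set" where
  "l2_homology D Orb \<Psi> n \<mu> = {F\<in>l2_fields D Orb \<Psi> n \<mu>.
     AE c in \<mu>. laplacian (\<Psi> c) n (F c) = (\<lambda>_. 0)}"

section \<open>Representations and multiplicities\<close>

definition representation :: "'g monoid \<Rightarrow> ('g \<Rightarrow> complex^'d^'d) \<Rightarrow> bool" where
  "representation G \<rho> \<longleftrightarrow> \<rho> \<one>\<^bsub>G\<^esub> = mat 1 \<and>
     (\<forall>g\<in>carrier G. \<forall>h\<in>carrier G. \<rho> (g \<otimes>\<^bsub>G\<^esub> h) = \<rho> g ** \<rho> h)"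

text \<open>The representation space \<open>complex^'d\<close> is never zero, since index types are nonempty.\<close>

definition irreducible_representation :: "'g monoid \<Rightarrow> ('g \<Rightarrow> complex^'d^'d) \<Rightarrow> bool" where
  "irreducible_representation G \<rho> \<longleftrightarrow> representation G \<rho> \<and>
     (\<forall>W. vec.subspace W \<and> (\<forall>g\<in>carrier G. \<forall>w\<in>W. \<rho> g *v w \<in> W) \<longrightarrow> W = {0} \<or> W = UNIV)"

definition rep_character :: "('g \<Rightarrow> complex^'d^'d) \<Rightarrow> 'g \<Rightarrow> complex" where
  "rep_character \<rho> g = trace (\<rho> g)"

definition chain_act :: "'g monoid \<Rightarrow> 'g \<Rightarrow> ('g, 'x) chain \<Rightarrow> ('g, 'x) chain" where
  "chain_act G g f = (\<lambda>xs. f (map (NG_act (inv\<^bsub>G\<^esub> g)) xs))"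

definition isotypic_proj :: "'g monoid \<Rightarrow> ('g \<Rightarrow> complex^'d^'d) \<Rightarrow> ('g, 'x) chain \<Rightarrow> ('g, 'x) chain" where
  "isotypic_proj G \<rho> f = (\<lambda>xs. rep_character \<rho> \<one>\<^bsub>G\<^esub> / of_nat (card (carrier G)) *
     (\<Sum>g\<in>carrier G. cnj (rep_character \<rho> g) * chain_act G g f xs))"

definition isotypic_component :: "'g monoid \<Rightarrow> nat \<Rightarrow> ('g, 'x) gset set \<Rightarrow> ('g, 'x) realization \<Rightarrow> nat \<Rightarrow>
    'g rclass measure \<Rightarrow> ('g \<Rightarrow> complex^'d^'d) \<Rightarrow> ('g, 'x) chain_field set \<Rightarrow> ('g, 'x) chain_field set" where
  "isotypic_component G D Orb \<Psi> n \<mu> \<rho> \<K> = {F\<in>l2_fields D Orb \<Psi> n \<mu>.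
     \<exists>F'\<in>\<K>. AE c in \<mu>. F c = isotypic_proj G \<rho> (F' c)}"

definition l2_multiplicity :: "'g monoid \<Rightarrow> nat \<Rightarrow> ('g, 'x) gset set \<Rightarrow> ('g, 'x) realization \<Rightarrow> nat \<Rightarrow>
    ('g \<Rightarrow> complex^'d^'d) \<Rightarrow> 'g rclass measure \<Rightarrow> complex" where
  "l2_multiplicity G D Orb \<Psi> n \<rho> \<mu> = 1 / rep_character \<rho> \<one>\<^bsub>G\<^esub> *
     vN_dim D Orb \<Psi> n \<mu> (isotypic_component G D Orb \<Psi> n \<mu> \<rho> (l2_homology D Orb \<Psi> n \<mu>))"

definition l2_betti :: "nat \<Rightarrow> ('g, 'x) gset set \<Rightarrow> ('g, 'x) realization \<Rightarrow> nat \<Rightarrow>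
    'g rclass measure \<Rightarrow> complex" where
  "l2_betti D Orb \<Psi> n \<mu> = vN_dim D Orb \<Psi> n \<mu> (l2_homology D Orb \<Psi> n \<mu>)"

abbreviation trivial_subgroup :: "'g monoid \<Rightarrow> 'g monoid" where
  "trivial_subgroup G \<equiv> G\<lparr>carrier := {\<one>\<^bsub>G\<^esub>}\<rparr>"

end

theory Submission
  imports Defs "HOL-Computational_Algebra.Fundamental_Theorem_Algebra"
begin

text \<open>
  A square-summable chain is harmonic and fixed by the isotypic projection iff it is orthogonal to
  countably many finitely supported functions which depend measurably on the complex. Hence the
  projections onto the fibres of the isotypic harmonic fields are measurable, and the trace is the
  integral of a trace density \<open>\<tau>\<close>, a sum of diagonal entries of the fibrewise projection over the
  simplices at the root. The complex representing an induced class is a disjoint union of translates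
  \<open>\<phi> g ` L\<close>, permuted freely by \<open>G\<close>. If \<open>a\<close> is the harmonic part of a simplex \<open>xs\<close> of \<open>L\<close>, then the
  \<open>\<rho>\<close>-isotypic part of its translate has the diagonal entry \<open>\<kappa> 1 * a xs\<close>, where \<open>\<kappa>\<close> is the
  coefficient function of the isotypic projection, since all other translates of \<open>xs\<close> lie in
  different copies. As \<open>\<kappa> 1 = (dim \<rho>)\<^sup>2 / |G|\<close>, the trace densities of a class and of the induced
  class differ by this factor at every point.
\<close>

section \<open>Characters of irreducible representations\<close>

text \<open>The two realization maps are chosen independently, so the complexes given by
  \<open>\<Psi>\<^sub>1\<close> and \<open>\<Psi>\<^sub>G\<close> share nothing but the isomorphism
  classes which they represent. The comparison therefore rests on diagonal entries of orthogonal
  projections, which depend on a subspace and a simplex alone. Two arbitrary choices have to be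
  neutralised: \<open>orth_proj\<close> picks a field that is determined only up to null sets, but
  it enters through inner products that all admissible fields share; \<open>orient\<close> picks an
  order of the vertices, but a diagonal entry is quadratic in the orientation. The root orbit of an
  induced complex has |G| points instead of one; the trace divides by the size of the orbit and so
  averages equal terms, which is why no further power of |G| appears. One of the two factors dim
  \<rho> disappears in the normalisation of the multiplicity. All fibrewise work is done once, for a
  group and a coefficient function \<kappa>; the Betti number is the case of the trivial group with
  \<kappa> = 1.\<close>

lemma poly_det:
  fixes M :: "complex poly^'n^'n"
  shows "poly (det M) t = det (\<chi> i j. poly (M $ i $ j) t)"
  by (simp add: det_def poly_sum poly_prod)

text \<open>A characteristic polynomial \<open>p\<close> without roots is a constant
  \<open>c\<close> by the fundamental theorem of algebra. The reversed polynomial \<open>q\<close>,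
  which is det(1 - t A), then equals c (-t)^n off 0, hence everywhere, although its value at 0 is 1.
  No degree of a determinant has to be computed.\<close>

lemma complex_matrix_eigenvalue:
  fixes A :: "complex^'n^'n"
  shows "\<exists>l v. v \<noteq> 0 \<and> A *v v = l *s v"
proof (rule ccontr)
  assume no: "\<not> ?thesis"
  define p where "p = det (\<chi> i j. [:A $ i $ j, - (if i = j then 1 else 0):])"
  define q where "q = det (\<chi> i j. [:(if i = j then 1 else 0), - A $ i $ j:])"
  have pl: "poly p l = det (A - mat l)" for l
    unfolding p_def poly_det by (rule arg_cong[where f = det]) (simp add: vec_eq_iff mat_def)
  have "poly p l \<noteq> 0" for l
  proof
    assume "poly p l = 0"
    then have "\<not> invertible (A - mat l)" by (simp add: pl invertible_det_nz)
    then obtain v where "v \<noteq> 0" "(A - mat l) *v v = 0"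
      using matrix_left_invertible_ker[of "A - mat l"] invertible_left_inverse[of "A - mat l"] by blast
    moreover have "mat l *v v = l *s v"
      by (simp add: vec_eq_iff matrix_vector_mult_def mat_def if_distrib[of "\<lambda>x. x * _"] cong: if_cong)
    ultimately show False using no by (auto simp: matrix_vector_mult_diff_rdistrib)
  qed
  then have "constant (poly p)" using fundamental_theorem_of_algebra by blast
  then obtain c where c: "poly p l = c" for l unfolding constant_def by metis
  have q: "poly q t = (- t) ^ CARD('n) * c" if "t \<noteq> 0" for t
  proof -
    \<comment> \<open>1 - t A is -t times A - 1/t, and each row contributes one factor -t to the
      determinant.\<close>
    have "poly q t = det (\<chi> i. (- t) *s ((A - mat (1 / t)) $ i))"
      unfolding q_def poly_det using that
      by (intro arg_cong[where f = det]) (simp add: vec_eq_iff mat_def algebra_simps)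
    also have "\<dots> = (- t) ^ CARD('n) * det (\<chi> i. (A - mat (1 / t)) $ i)"
      by (subst det_rows_mul) simp
    also have "(\<chi> i. (A - mat (1 / t)) $ i) = A - mat (1 / t)" by (simp add: vec_eq_iff)
    finally show ?thesis by (simp add: c flip: pl)
  qed
  \<comment> \<open>A polynomial that vanishes off a single point is zero. The monomial vanishes at
    0 because index types are nonempty.\<close>
  define r where "r = q - monom ((- 1) ^ CARD('n) * c) CARD('n)"
  have "poly r t = 0" if "t \<noteq> 0" for t
    using q[OF that] by (simp add: r_def poly_monom power_minus')
  then have "- {0} \<subseteq> {t. poly r t = 0}" by auto
  moreover have "infinite (- {0 :: complex})"
    using infinite_UNIV_char_0 by (metis Compl_eq_Diff_UNIV finite.emptyI finite_Diff_insert Diff_empty)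
  ultimately have "r = 0" using poly_roots_finite finite_subset by metis
  then have "poly r 0 = 0" by simp
  moreover have "poly q 0 = 1"
  proof -
    have "poly q 0 = det (mat 1 :: complex^'n^'n)"
      unfolding q_def poly_det by (intro arg_cong[where f = det]) (simp add: vec_eq_iff mat_def)
    then show ?thesis by simp
  qed
  ultimately show False by (simp add: r_def poly_monom power_0_left)
qed

text \<open>An eigenspace of \<open>B\<close> is invariant because \<open>B\<close> commutes with
  the representation, and it is not zero, so irreducibility makes it the whole space.\<close>

lemma schur_scalar:
  fixes \<rho> :: "'g \<Rightarrow> complex^'d^'d"
  assumes "irreducible_representation G \<rho>" and comm: "\<And>g. g \<in> carrier G \<Longrightarrow> \<rho> g ** B = B ** \<rho> g"
  shows "\<exists>l. B = mat l"
proof -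
  obtain l v where v: "v \<noteq> 0" "B *v v = l *s v" using complex_matrix_eigenvalue by blast
  define W where "W = {w. B *v w = l *s w}"
  have "vec.subspace W"
    by (auto simp: W_def vec.subspace_def matrix_vector_right_distrib vec.scale_right_distrib
        vector_scalar_commute mult.commute)
  moreover have "\<rho> g *v w \<in> W" if "g \<in> carrier G" "w \<in> W" for g w
  proof -
    have "B *v (\<rho> g *v w) = (\<rho> g ** B) *v w"
      by (simp add: comm[OF that(1)] matrix_vector_mul_assoc)
    also have "\<dots> = \<rho> g *v (l *s w)"
      using that by (simp add: W_def flip: matrix_vector_mul_assoc)
    finally show ?thesis by (simp add: W_def vector_scalar_commute)
  qed
  ultimately have "W = {0} \<or> W = UNIV"
    using assms(1) unfolding irreducible_representation_def by blast
  with v have "W = UNIV" by (auto simp: W_def)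
  moreover have "mat l *v w = l *s w" for w :: "complex^'d"
    by (simp add: vec_eq_iff matrix_vector_mult_def mat_def if_distrib[of "\<lambda>x. x * _"] cong: if_cong)
  ultimately have "B = mat l" by (subst matrix_eq) (auto simp: W_def)
  then show ?thesis ..
qed

lemma matrix_sum_mult:
  fixes f :: "'a \<Rightarrow> complex^'n^'n"
  shows "(\<Sum>x\<in>A. f x) ** B = (\<Sum>x\<in>A. f x ** B)" "B ** (\<Sum>x\<in>A. f x) = (\<Sum>x\<in>A. B ** f x)"
proof -
  have "(X + Y) ** B = X ** B + Y ** B" for X Y :: "complex^'n^'n"
    by (simp add: vec_eq_iff matrix_matrix_mult_def sum.distrib distrib_right)
  then show "(\<Sum>x\<in>A. f x) ** B = (\<Sum>x\<in>A. f x ** B)" "B ** (\<Sum>x\<in>A. f x) = (\<Sum>x\<in>A. B ** f x)"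
    by (induction A rule: infinite_finite_induct) (auto simp: matrix_add_ldistrib)
qed

lemma (in group) sum_carrier_mult_left:
  assumes "g \<in> carrier G"
  shows "(\<Sum>h\<in>carrier G. f (g \<otimes> h)) = (\<Sum>h\<in>carrier G. f h)"
  using assms
  by (intro sum.reindex_bij_witness[of _ "\<lambda>h. inv g \<otimes> h" "\<lambda>h. g \<otimes> h"]) (auto simp: m_assoc[symmetric])

lemma (in group) sum_carrier_mult_right:
  assumes "g \<in> carrier G"
  shows "(\<Sum>h\<in>carrier G. f (h \<otimes> g)) = (\<Sum>h\<in>carrier G. f h)"
  using assms
  by (intro sum.reindex_bij_witness[of _ "\<lambda>h. h \<otimes> inv g" "\<lambda>h. h \<otimes> g"]) (auto simp: m_assoc)

text \<open>Averaging the conjugates \<open>\<rho> h ** E ** \<rho> (inv h)\<close> over the group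
  gives an intertwiner, hence a scalar. Its trace determines the scalar, and its entry at (i, m) is
  the sum in question.\<close>

lemma schur_orthogonality:
  fixes G (structure) and \<rho> :: "'g \<Rightarrow> complex^'d^'d"
  assumes "group G" "finite (carrier G)" and irr: "irreducible_representation G \<rho>"
  shows "(\<Sum>h\<in>carrier G. \<rho> h $ i $ j * \<rho> (inv h) $ k $ m) =
    (if j = k \<and> i = m then of_nat (card (carrier G)) / of_nat CARD('d) else 0)"
proof -
  interpret group G by fact
  have rep: "\<rho> \<one> = mat 1" "\<And>g h. g \<in> carrier G \<Longrightarrow> h \<in> carrier G \<Longrightarrow> \<rho> (g \<otimes> h) = \<rho> g ** \<rho> h"
    using irr by (auto simp: irreducible_representation_def representation_def)
  \<comment> \<open>The matrix unit at (j, k) cuts one entry out of each of the two factors.\<close>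
  define E :: "complex^'d^'d" where "E = (\<chi> a b. if a = j \<and> b = k then 1 else 0)"
  define T where "T = (\<Sum>h\<in>carrier G. \<rho> h ** E ** \<rho> (inv h))"
  have "\<rho> g ** T = T ** \<rho> g" if g: "g \<in> carrier G" for g
  proof -
    have "\<rho> g ** T ** \<rho> (inv g) = (\<Sum>h\<in>carrier G. \<rho> (g \<otimes> h) ** E ** \<rho> (inv (g \<otimes> h)))"
      using g by (simp add: T_def matrix_sum_mult rep inv_mult_group matrix_mul_assoc)
    also have "\<dots> = T" unfolding T_def by (rule sum_carrier_mult_left[OF g])
    finally have "\<rho> g ** T ** \<rho> (inv g) ** \<rho> g = T ** \<rho> g" by simp
    then show ?thesis using g by (simp add: rep(1) flip: matrix_mul_assoc rep(2))
  qed
  then obtain l where l: "T = mat l" using schur_scalar[OF irr] by blast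
  have inv1: "\<rho> (inv h) ** \<rho> h = mat 1" if "h \<in> carrier G" for h
    using that by (simp add: rep(1) flip: rep(2))
  have tr_sum: "trace (sum F B) = (\<Sum>x\<in>B. trace (F x))" for F :: "'g \<Rightarrow> complex^'d^'d" and B
    by (induction B rule: infinite_finite_induct) (auto simp: trace_add trace_0[unfolded mat_0])
  have "trace T = (\<Sum>h\<in>carrier G. trace E)"
    unfolding T_def tr_sum
  proof (rule sum.cong[OF refl])
    fix h assume h: "h \<in> carrier G"
    have "trace (\<rho> h ** E ** \<rho> (inv h)) = trace (\<rho> (inv h) ** (\<rho> h ** E))" by (rule trace_mul_sym)
    then show "trace (\<rho> h ** E ** \<rho> (inv h)) = trace E" by (simp add: matrix_mul_assoc inv1[OF h])
  qed
  moreover have "trace (mat l :: complex^'d^'d) = of_nat CARD('d) * l" by (simp add: trace_def mat_def)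
  moreover have "trace E = (if j = k then 1 else 0)"
    by (cases "j = k") (auto simp: trace_def E_def intro!: sum.neutral)
  ultimately have l': "l = (if j = k then of_nat (card (carrier G)) / of_nat CARD('d) else 0)"
    by (auto simp: l field_simps split: if_splits)
  have "(\<rho> h ** E ** \<rho> (inv h)) $ i $ m = \<rho> h $ i $ j * \<rho> (inv h) $ k $ m" for h
  proof -
    have "(\<rho> h ** E) $ i $ b = (if b = k then \<rho> h $ i $ j else 0)" for b
    proof -
      have "(\<rho> h ** E) $ i $ b = (\<Sum>a\<in>UNIV. if a = j then if b = k then \<rho> h $ i $ a else 0 else 0)"
      proof -
        have "(\<rho> h ** E) $ i $ b = (\<Sum>a\<in>UNIV. \<rho> h $ i $ a * E $ a $ b)"
          by (simp add: matrix_matrix_mult_def)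
        also have "\<dots> = (\<Sum>a\<in>UNIV. if a = j then if b = k then \<rho> h $ i $ a else 0 else 0)"
          by (intro sum.cong refl) (auto simp: E_def)
        finally show ?thesis .
      qed
      then show ?thesis by simp
    qed
    then have "(\<rho> h ** E ** \<rho> (inv h)) $ i $ m =
      (\<Sum>b\<in>UNIV. if b = k then \<rho> h $ i $ j * \<rho> (inv h) $ b $ m else 0)"
    proof -
      have "(\<rho> h ** E ** \<rho> (inv h)) $ i $ m = (\<Sum>b\<in>UNIV. (\<rho> h ** E) $ i $ b * \<rho> (inv h) $ b $ m)"
        unfolding matrix_matrix_mult_def[of "\<rho> h ** E"] by simp
      also have "\<dots> = (\<Sum>b\<in>UNIV. if b = k then \<rho> h $ i $ j * \<rho> (inv h) $ b $ m else 0)"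
        by (intro sum.cong refl) (simp add: \<open>\<And>b. (\<rho> h ** E) $ i $ b = (if b = k then \<rho> h $ i $ j else 0)\<close>)
      finally show ?thesis .
    qed
    then show ?thesis by simp
  qed
  then have "(\<Sum>h\<in>carrier G. \<rho> h $ i $ j * \<rho> (inv h) $ k $ m) = T $ i $ m"
    by (simp add: T_def)
  then show ?thesis by (simp add: l l' mat_def)
qed

lemma character_one: "representation G \<rho> \<Longrightarrow> rep_character \<rho> \<one>\<^bsub>G\<^esub> = of_nat CARD('d)"
  for \<rho> :: "'g \<Rightarrow> complex^'d^'d"
  by (simp add: rep_character_def representation_def trace_def mat_def)

text \<open>In matrix entries each summand is an entry of \<open>\<rho> h\<close> times one of
  \<open>\<rho> (inv h)\<close> times one of \<open>\<rho> g\<close>; orthogonality leaves only the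
  diagonal of \<open>\<rho> g\<close>.\<close>

lemma character_convolution:
  fixes G (structure) and \<rho> :: "'g \<Rightarrow> complex^'d^'d"
  assumes "group G" "finite (carrier G)" and irr: "irreducible_representation G \<rho>" and g: "g \<in> carrier G"
  shows "(\<Sum>h\<in>carrier G. rep_character \<rho> h * rep_character \<rho> (inv h \<otimes> g)) =
    of_nat (card (carrier G)) / of_nat CARD('d) * rep_character \<rho> g"
proof -
  interpret group G by fact
  have rep: "\<And>g h. g \<in> carrier G \<Longrightarrow> h \<in> carrier G \<Longrightarrow> \<rho> (g \<otimes> h) = \<rho> g ** \<rho> h"
    using irr by (auto simp: irreducible_representation_def representation_def)
  have "(\<Sum>h\<in>carrier G. rep_character \<rho> h * rep_character \<rho> (inv h \<otimes> g)) =
    (\<Sum>h\<in>carrier G. \<Sum>i\<in>UNIV. \<Sum>k\<in>UNIV. \<Sum>m\<in>UNIV. \<rho> h $ i $ i * \<rho> (inv h) $ k $ m * \<rho> g $ m $ k)"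
  proof (rule sum.cong[OF refl])
    fix h assume h: "h \<in> carrier G"
    have "(\<Sum>i\<in>UNIV. \<Sum>k\<in>UNIV. \<Sum>m\<in>UNIV. \<rho> h $ i $ i * \<rho> (inv h) $ k $ m * \<rho> g $ m $ k) =
      (\<Sum>i\<in>UNIV. \<rho> h $ i $ i) * (\<Sum>k\<in>UNIV. \<Sum>m\<in>UNIV. \<rho> (inv h) $ k $ m * \<rho> g $ m $ k)"
      by (subst sum_distrib_right) (simp add: sum_distrib_left mult.assoc)
    then show "rep_character \<rho> h * rep_character \<rho> (inv h \<otimes> g) =
      (\<Sum>i\<in>UNIV. \<Sum>k\<in>UNIV. \<Sum>m\<in>UNIV. \<rho> h $ i $ i * \<rho> (inv h) $ k $ m * \<rho> g $ m $ k)"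
      using g h by (simp add: rep rep_character_def trace_def matrix_matrix_mult_def)
  qed
  also have "\<dots> = (\<Sum>i\<in>UNIV. \<Sum>k\<in>UNIV. \<Sum>m\<in>UNIV. (\<Sum>h\<in>carrier G. \<rho> h $ i $ i * \<rho> (inv h) $ k $ m) * \<rho> g $ m $ k)"
    by (simp add: sum.swap[of _ "carrier G"] sum_distrib_right)
  also have "\<dots> = (\<Sum>i\<in>UNIV. of_nat (card (carrier G)) / of_nat CARD('d) * \<rho> g $ i $ i)"
  proof (rule sum.cong[OF refl])
    fix i :: 'd
    have "(\<Sum>k\<in>UNIV. \<Sum>m\<in>UNIV. (\<Sum>h\<in>carrier G. \<rho> h $ i $ i * \<rho> (inv h) $ k $ m) * \<rho> g $ m $ k) =
      (\<Sum>k\<in>UNIV. \<Sum>m\<in>UNIV. if m = i then if k = i then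
        of_nat (card (carrier G)) / of_nat CARD('d) * \<rho> g $ m $ k else 0 else 0)"
      unfolding schur_orthogonality[OF assms(1-3)] by (intro sum.cong refl) auto
    then show "(\<Sum>k\<in>UNIV. \<Sum>m\<in>UNIV. (\<Sum>h\<in>carrier G. \<rho> h $ i $ i * \<rho> (inv h) $ k $ m) * \<rho> g $ m $ k) =
      of_nat (card (carrier G)) / of_nat CARD('d) * \<rho> g $ i $ i"
      by simp
  qed
  finally show ?thesis by (simp add: rep_character_def trace_def sum_distrib_left)
qed

text \<open>The representation need not be unitary. The averaged Gram matrix \<open>S\<close>
  intertwines \<open>\<rho> (inv g)\<close> with the adjoint of \<open>\<rho> g\<close> and is
  invertible, so these two have the same trace.\<close>

lemma character_inv:
  fixes G (structure) and \<rho> :: "'g \<Rightarrow> complex^'d^'d"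
  assumes "group G" "finite (carrier G)" and rep: "representation G \<rho>" and g: "g \<in> carrier G"
  shows "rep_character \<rho> (inv g) = cnj (rep_character \<rho> g)"
proof -
  interpret group G by fact
  have rep: "\<rho> \<one> = mat 1" "\<And>g h. g \<in> carrier G \<Longrightarrow> h \<in> carrier G \<Longrightarrow> \<rho> (g \<otimes> h) = \<rho> g ** \<rho> h"
    using rep by (auto simp: representation_def)
  define adj :: "complex^'d^'d \<Rightarrow> complex^'d^'d" where "adj = (\<lambda>A. \<chi> i j. cnj (A $ j $ i))"
  have adj_mult: "adj (A ** B) = adj B ** adj A" for A B
    by (simp add: adj_def vec_eq_iff matrix_matrix_mult_def mult.commute)
  define S where "S = (\<Sum>h\<in>carrier G. adj (\<rho> h) ** \<rho> h)"
  have "adj (\<rho> g) ** S ** \<rho> g = (\<Sum>h\<in>carrier G. adj (\<rho> (h \<otimes> g)) ** \<rho> (h \<otimes> g))"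
    using g by (simp add: S_def matrix_sum_mult rep adj_mult matrix_mul_assoc)
  also have "\<dots> = S" unfolding S_def by (rule sum_carrier_mult_right[OF g])
  finally have "adj (\<rho> g) ** S ** \<rho> g ** \<rho> (inv g) = S ** \<rho> (inv g)" by simp
  then have com: "adj (\<rho> g) ** S = S ** \<rho> (inv g)"
    using g by (simp add: rep(1) flip: matrix_mul_assoc rep(2))
  \<comment> \<open>The quadratic form of \<open>S\<close> is a sum of squared norms in which the
    identity of the group contributes the squared norm of \<open>x\<close> itself.\<close>
  have "x = 0" if "S *v x = 0" for x
  proof -
    have quad: "(\<Sum>i\<in>UNIV. cnj (x $ i) * ((adj A ** A) *v x) $ i) = of_real (\<Sum>j\<in>UNIV. (cmod ((A *v x) $ j))\<^sup>2)"
      for A :: "complex^'d^'d"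
    proof -
      have "(\<Sum>i\<in>UNIV. cnj (x $ i) * ((adj A ** A) *v x) $ i) =
        (\<Sum>i\<in>UNIV. \<Sum>j\<in>UNIV. cnj (x $ i) * cnj (A $ j $ i) * (A *v x) $ j)"
      proof -
        have "(adj A *v y) $ i = (\<Sum>j\<in>UNIV. cnj (A $ j $ i) * y $ j)" for y i
          by (simp add: adj_def matrix_vector_mult_def)
        then show ?thesis by (simp add: sum_distrib_left mult.assoc flip: matrix_vector_mul_assoc)
      qed
      also have "\<dots> = (\<Sum>j\<in>UNIV. \<Sum>i\<in>UNIV. cnj (x $ i) * cnj (A $ j $ i) * (A *v x) $ j)" by (rule sum.swap)
      also have "\<dots> = (\<Sum>j\<in>UNIV. cnj ((A *v x) $ j) * (A *v x) $ j)"
      proof (rule sum.cong[OF refl])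
        fix j
        have "(\<Sum>i\<in>UNIV. cnj (x $ i) * cnj (A $ j $ i)) = cnj ((A *v x) $ j)"
          by (simp add: matrix_vector_mult_def mult.commute)
        then show "(\<Sum>i\<in>UNIV. cnj (x $ i) * cnj (A $ j $ i) * (A *v x) $ j) = cnj ((A *v x) $ j) * (A *v x) $ j"
          by (subst sum_distrib_right[symmetric]) simp
      qed
      also have "\<dots> = of_real (\<Sum>j\<in>UNIV. (cmod ((A *v x) $ j))\<^sup>2)"
      unfolding of_real_sum by (intro sum.cong refl) (simp only: complex_norm_square mult.commute)
      finally show ?thesis .
    qed
    have Sx: "S *v x = (\<Sum>h\<in>carrier G. (adj (\<rho> h) ** \<rho> h) *v x)"
      unfolding S_def by (induction rule: infinite_finite_induct) (auto simp: matrix_vector_mult_add_rdistrib)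
    have "0 = (\<Sum>i\<in>UNIV. cnj (x $ i) * (S *v x) $ i)" using that by simp
    also have "\<dots> = (\<Sum>h\<in>carrier G. \<Sum>i\<in>UNIV. cnj (x $ i) * ((adj (\<rho> h) ** \<rho> h) *v x) $ i)"
      by (simp add: Sx sum_distrib_left sum.swap[of _ "carrier G"])
    also have "\<dots> = of_real (\<Sum>h\<in>carrier G. \<Sum>j\<in>UNIV. (cmod ((\<rho> h *v x) $ j))\<^sup>2)"
      by (simp only: quad of_real_sum)
    finally have "(\<Sum>h\<in>carrier G. \<Sum>j\<in>UNIV. (cmod ((\<rho> h *v x) $ j))\<^sup>2) = 0"
      by (rule of_real_eq_0_iff[THEN iffD1, OF sym])
    then have "(\<Sum>j\<in>UNIV. (cmod ((\<rho> \<one> *v x) $ j))\<^sup>2) = 0"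
      using assms(2) by (subst (asm) sum_nonneg_eq_0_iff) (auto intro: sum_nonneg)
    then show "x = 0"
      by (subst (asm) sum_nonneg_eq_0_iff) (auto simp: rep(1) vec_eq_iff)
  qed
  then obtain S' where S': "S' ** S = mat 1" using matrix_left_invertible_ker[of S] by blast
  then have S'2: "S ** S' = mat 1" by (simp add: matrix_left_right_inverse)
  have "trace (\<rho> (inv g)) = trace (S' ** (adj (\<rho> g) ** S))" by (simp add: com matrix_mul_assoc S')
  also have "\<dots> = trace ((adj (\<rho> g) ** S) ** S')" by (rule trace_mul_sym)
  also have "\<dots> = trace (adj (\<rho> g))" by (simp add: S'2 flip: matrix_mul_assoc)
  finally have "trace (\<rho> (inv g)) = trace (adj (\<rho> g))" .
  then show ?thesis by (simp add: rep_character_def trace_def adj_def)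
qed

section \<open>Projections in sequence spaces\<close>

text \<open>Chains are functions on all lists that vanish off their complex. Summing over the whole
  type places the chains of all fibres in one sequence space.\<close>

definition ell2 :: "('i \<Rightarrow> complex) \<Rightarrow> bool" where
  "ell2 f \<longleftrightarrow> (\<lambda>x. (cmod (f x))\<^sup>2) summable_on UNIV"

definition ip :: "('i \<Rightarrow> complex) \<Rightarrow> ('i \<Rightarrow> complex) \<Rightarrow> complex" where
  "ip f h = (\<Sum>\<^sub>\<infinity>x. f x * cnj (h x))"

definition nsq :: "('i \<Rightarrow> complex) \<Rightarrow> real" where
  "nsq f = (\<Sum>\<^sub>\<infinity>x. (cmod (f x))\<^sup>2)"

abbreviation fsupp :: "('i \<Rightarrow> complex) \<Rightarrow> bool" where
  "fsupp f \<equiv> finite {x. f x \<noteq> 0}"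

lemma ell2_summable_mult:
  assumes "ell2 f" "ell2 h"
  shows "(\<lambda>x. f x * cnj (h x)) summable_on UNIV"
proof -
  have "(\<lambda>x. norm (f x * cnj (h x))) summable_on UNIV"
    by (rule abs_summable_product) (use assms in \<open>simp_all add: ell2_def norm_mult power2_eq_square\<close>)
  then show ?thesis by (rule abs_summable_summable)
qed

lemma ell2_scale: "ell2 f \<Longrightarrow> ell2 (\<lambda>x. a * f x)"
  by (simp add: ell2_def norm_mult power_mult_distrib summable_on_cmult_right)

lemma ell2_add:
  assumes "ell2 f" "ell2 h"
  shows "ell2 (\<lambda>x. f x + h x)"
proof -
  have "(\<lambda>x. 2 * (cmod (f x))\<^sup>2 + 2 * (cmod (h x))\<^sup>2) summable_on UNIV"
    using assms unfolding ell2_def by (intro summable_on_add summable_on_cmult_right)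
  moreover have "(cmod (a + b))\<^sup>2 \<le> 2 * (cmod a)\<^sup>2 + 2 * (cmod b)\<^sup>2" for a b
  proof -
    have "(cmod (a + b))\<^sup>2 \<le> (cmod a + cmod b)\<^sup>2" by (intro power_mono norm_triangle_ineq) simp
    also have "\<dots> \<le> 2 * (cmod a)\<^sup>2 + 2 * (cmod b)\<^sup>2"
      using zero_le_power2[of "cmod a - cmod b"] by (simp add: power2_sum power2_diff)
    finally show ?thesis .
  qed
  ultimately show ?thesis
    unfolding ell2_def by (elim summable_on_comparison_test) auto
qed

lemma ell2_diff: "ell2 f \<Longrightarrow> ell2 h \<Longrightarrow> ell2 (\<lambda>x. f x - h x)"
  using ell2_add[of f "\<lambda>x. (-1) * h x"] ell2_scale[of h "-1"] by simp

lemma ell2_sum: "(\<And>y. y \<in> F \<Longrightarrow> ell2 (f y)) \<Longrightarrow> ell2 (\<lambda>x. \<Sum>y\<in>F. f y x)"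
  by (induction F rule: infinite_finite_induct) (auto intro: ell2_add simp: ell2_def[of "\<lambda>_. 0"])

lemma ell2_fsupp: "fsupp f \<Longrightarrow> ell2 f"
  unfolding ell2_def by (rule finite_nonzero_values_imp_summable_on) simp

lemma ip_fsupp:
  assumes "finite S" "\<And>x. x \<notin> S \<Longrightarrow> h x = 0"
  shows "ip f h = (\<Sum>x\<in>S. f x * cnj (h x))"
proof -
  have "ip f h = (\<Sum>\<^sub>\<infinity>x\<in>S. f x * cnj (h x))"
    unfolding ip_def by (rule infsum_cong_neutral) (use assms in auto)
  then show ?thesis using assms(1) by simp
qed

lemma ip_cnj: "ip h f = cnj (ip f h)"
  unfolding ip_def infsum_cnj[symmetric] by (simp add: mult.commute)

lemma ip_add_left: "ell2 f \<Longrightarrow> ell2 f' \<Longrightarrow> ell2 h \<Longrightarrow> ip (\<lambda>x. f x + f' x) h = ip f h + ip f' h"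
  unfolding ip_def distrib_right by (intro infsum_add ell2_summable_mult)

lemma ip_scale_left: "ip (\<lambda>x. a * f x) h = a * ip f h"
  unfolding ip_def mult.assoc by (rule infsum_cmult_right')

lemma ip_diff_left: "ell2 f \<Longrightarrow> ell2 f' \<Longrightarrow> ell2 h \<Longrightarrow> ip (\<lambda>x. f x - f' x) h = ip f h - ip f' h"
  using ip_add_left[of f "\<lambda>x. (-1) * f' x" h] ell2_scale[of f' "-1"] ip_scale_left[of "-1" f' h] by simp

lemma ip_diff_right: "ell2 f \<Longrightarrow> ell2 f' \<Longrightarrow> ell2 h \<Longrightarrow> ip h (\<lambda>x. f x - f' x) = ip h f - ip h f'"
  by (subst (1 2 3) ip_cnj) (simp add: ip_diff_left)

lemma ip_scale_right: "ip h (\<lambda>x. a * f x) = cnj a * ip h f"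
  by (subst (1 2) ip_cnj) (simp add: ip_scale_left)

lemma ip_zero: "ip (\<lambda>_. 0) h = 0" "ip h (\<lambda>_. 0) = 0"
  by (simp_all add: ip_def)

lemma ip_sum_left:
  "(\<And>y. y \<in> F \<Longrightarrow> ell2 (f y)) \<Longrightarrow> ell2 h \<Longrightarrow> ip (\<lambda>x. \<Sum>y\<in>F. f y x) h = (\<Sum>y\<in>F. ip (f y) h)"
  by (induction F rule: infinite_finite_induct) (auto simp: ip_zero ip_add_left ell2_sum)

lemma ip_self:
  assumes "ell2 f"
  shows "ip f f = of_real (nsq f)"
proof -
  have "((\<lambda>x. of_real ((cmod (f x))\<^sup>2) :: complex) has_sum of_real (nsq f)) UNIV"
    using assms unfolding ell2_def nsq_def by (rule has_sum_of_real[OF has_sum_infsum])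
  then have "((\<lambda>x. f x * cnj (f x)) has_sum of_real (nsq f)) UNIV"
    by (simp only: complex_norm_square)
  then show ?thesis unfolding ip_def by (rule infsumI)
qed

lemma nsq_nonneg: "nsq f \<ge> 0"
  unfolding nsq_def by (rule infsum_nonneg) simp

lemma nsq_ge: "ell2 f \<Longrightarrow> (cmod (f x))\<^sup>2 \<le> nsq f"
  unfolding nsq_def ell2_def by (rule finite_sum_le_infsum[of _ _ "{x}", simplified]) auto

lemma nsq_eq_0: "ell2 f \<Longrightarrow> nsq f = 0 \<Longrightarrow> f = (\<lambda>_. 0)"
  using nsq_ge[of f] by (auto simp: fun_eq_iff)

text \<open>Membership and norm bound both follow from uniform bounds on finite partial sums;
  boundary and coboundary are shown to be bounded in this way.\<close>

lemma nsq_le_finite: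
  assumes "\<And>S. finite S \<Longrightarrow> (\<Sum>x\<in>S. (cmod (f x))\<^sup>2) \<le> B"
  shows "ell2 f" "nsq f \<le> B"
proof -
  show "ell2 f"
    unfolding ell2_def by (rule nonneg_bounded_partial_sums_imp_summable_on[where C = B])
      (use assms in \<open>auto intro!: eventually_finite_subsets_at_top_weakI\<close>)
  then show "nsq f \<le> B"
    unfolding ell2_def nsq_def by (intro infsum_le_finite_sums) (use assms in auto)
qed

lemma nsq_diff:
  assumes "ell2 f" "ell2 h" "ip (\<lambda>x. f x - h x) h = 0"
  shows "nsq (\<lambda>x. f x - h x) = nsq f - nsq h"
proof -
  have fh: "ip f h = ip h h" using assms by (simp add: ip_diff_left)
  then have hf: "ip h f = ip h h" by (metis ip_cnj)
  have "ip (\<lambda>x. f x - h x) (\<lambda>x. f x - h x) = ip f f - ip h h"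
    using assms fh hf by (simp add: ip_diff_left ip_diff_right ell2_diff)
  then have "of_real (nsq (\<lambda>x. f x - h x)) = (of_real (nsq f - nsq h) :: complex)"
    using assms by (simp add: ip_self ell2_diff)
  then show ?thesis by (simp only: of_real_eq_iff)
qed

text \<open>Cauchy-Schwarz in the form of an inequality of means with a free weight
  \<open>t\<close>. It avoids square roots and allows one factor to be made small at the expense of
  the other.\<close>

lemma ip_bound:
  assumes "ell2 f" "ell2 h" "t > 0"
  shows "cmod (ip f h) \<le> (t * nsq f + nsq h / t) / 2"
proof -
  have "(\<lambda>x. norm (f x * cnj (h x))) summable_on UNIV"
    by (rule abs_summable_product) (use assms in \<open>simp_all add: ell2_def norm_mult power2_eq_square\<close>)
  then have 1: "(\<lambda>x. cmod (f x) * cmod (h x)) summable_on UNIV" by (simp add: norm_mult)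
  have 2: "(\<lambda>x. t / 2 * (cmod (f x))\<^sup>2 + 1 / (2 * t) * (cmod (h x))\<^sup>2) summable_on UNIV"
    using assms(1,2) unfolding ell2_def by (intro summable_on_add summable_on_cmult_right)
  have "cmod (ip f h) \<le> (\<Sum>\<^sub>\<infinity>x. cmod (f x) * cmod (h x))"
    unfolding ip_def using norm_infsum_bound[of "\<lambda>x. f x * cnj (h x)" UNIV] 1 by (simp add: norm_mult)
  also have "\<dots> \<le> (\<Sum>\<^sub>\<infinity>x. t / 2 * (cmod (f x))\<^sup>2 + 1 / (2 * t) * (cmod (h x))\<^sup>2)"
  proof (rule infsum_mono[OF 1 2])
    fix x
    have "0 \<le> (t * cmod (f x) - cmod (h x))\<^sup>2 / (2 * t)" using assms(3) by simp
    also have "\<dots> = t / 2 * (cmod (f x))\<^sup>2 + 1 / (2 * t) * (cmod (h x))\<^sup>2 - cmod (f x) * cmod (h x)"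
      using assms(3) by (simp add: field_simps power2_eq_square)
    finally show "cmod (f x) * cmod (h x) \<le> t / 2 * (cmod (f x))\<^sup>2 + 1 / (2 * t) * (cmod (h x))\<^sup>2" by simp
  qed
  also have "\<dots> = t / 2 * nsq f + 1 / (2 * t) * nsq h"
  proof -
    have "(\<Sum>\<^sub>\<infinity>x. t / 2 * (cmod (f x))\<^sup>2 + 1 / (2 * t) * (cmod (h x))\<^sup>2) =
      (\<Sum>\<^sub>\<infinity>x. t / 2 * (cmod (f x))\<^sup>2) + (\<Sum>\<^sub>\<infinity>x. 1 / (2 * t) * (cmod (h x))\<^sup>2)"
      using assms(1,2) unfolding ell2_def by (intro infsum_add summable_on_cmult_right)
    then show ?thesis by (simp only: infsum_cmult_right' nsq_def)
  qed
  finally show ?thesis using assms(3) by (simp add: field_simps)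
qed

text \<open>\<open>res u k x\<close> is the component of \<open>x\<close> orthogonal to \<open>u 0, \<dots>, u (k - 1)\<close>, computed by
  Gram-Schmidt; the division by zero that occurs for linearly dependent \<open>u\<close> is harmless.\<close>

primrec res :: "(nat \<Rightarrow> 'i \<Rightarrow> complex) \<Rightarrow> nat \<Rightarrow> ('i \<Rightarrow> complex) \<Rightarrow> 'i \<Rightarrow> complex" where
  "res u 0 = (\<lambda>x. x)"
| "res u (Suc k) = (\<lambda>x i. res u k x i -
     ip (res u k x) (res u k (u k)) / ip (res u k (u k)) (res u k (u k)) * res u k (u k) i)"

text \<open>The residuals converge to the component of \<open>x\<close> orthogonal to all
  \<open>u j\<close>. The limit is taken coordinatewise, so that measurability in a parameter
  survives it.\<close>

definition lproj :: "(nat \<Rightarrow> 'i \<Rightarrow> complex) \<Rightarrow> ('i \<Rightarrow> complex) \<Rightarrow> 'i \<Rightarrow> complex" where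
  "lproj u x = (\<lambda>i. lim (\<lambda>k. res u k x i))"

lemma res_support:
  assumes "\<And>j. {i. u j i \<noteq> 0} \<subseteq> A" "{i. x i \<noteq> 0} \<subseteq> A"
  shows "{i. res u k x i \<noteq> 0} \<subseteq> A"
  using assms(2)
proof (induction k arbitrary: x)
  case (Suc k)
  show ?case using Suc.IH[OF Suc.prems] Suc.IH[OF assms(1)] by force
qed simp

section \<open>Convergence of the Gram-Schmidt residuals\<close>

context
  fixes u :: "nat \<Rightarrow> 'i \<Rightarrow> complex"
  assumes u: "\<And>j. fsupp (u j)"
begin

lemma res_fsupp: "fsupp x \<Longrightarrow> fsupp (res u k x)"
proof (induction k arbitrary: x)
  case (Suc k)
  have "{i. res u (Suc k) x i \<noteq> 0} \<subseteq> {i. res u k x i \<noteq> 0} \<union> {i. res u k (u k) i \<noteq> 0}" by auto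
  then show ?case using Suc.IH[OF Suc.prems] Suc.IH[OF u[of k]] by (rule finite_subset[OF _ finite_UnI])
qed simp

lemma res_ell2: "fsupp x \<Longrightarrow> ell2 (res u k x)"
  by (intro ell2_fsupp res_fsupp)

lemma res_diff_orth:
  assumes "fsupp x" "ell2 f" "\<And>j. j < k \<Longrightarrow> ip (u j) f = 0"
  shows "ip (\<lambda>i. x i - res u k x i) f = 0"
  using assms
proof (induction k arbitrary: x)
  case 0
  have "(\<lambda>i. x i - res u 0 x i) = (\<lambda>_. 0)" by simp
  then show ?case by (simp only: ip_zero)
next
  case (Suc k)
  have IH: "ip (\<lambda>i. y i - res u k y i) f = 0" if "fsupp y" for y
    using Suc that by auto
  let ?w = "res u k (u k)"
  have "ip ?w f = 0"
    using IH[OF u, of k] Suc.prems by (simp add: ip_diff_left res_ell2 u ell2_fsupp)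
  define a where "a = ip (res u k x) ?w / ip ?w ?w"
  have eq: "(\<lambda>i. x i - res u (Suc k) x i) = (\<lambda>i. (x i - res u k x i) + a * ?w i)" by (auto simp: a_def)
  show ?case
  proof -
    have "ip (\<lambda>i. (x i - res u k x i) + a * ?w i) f = ip (\<lambda>i. x i - res u k x i) f + ip (\<lambda>i. a * ?w i) f"
      by (intro ip_add_left ell2_diff ell2_scale res_ell2 ell2_fsupp u Suc.prems)
    moreover have "ip (\<lambda>i. a * ?w i) f = a * ip ?w f" by (rule ip_scale_left)
    ultimately show ?thesis
      by (simp only: eq \<open>ip ?w f = 0\<close> IH[OF Suc.prems(1)] mult_zero_right add_0_right)
  qed
qed

lemma res_orth:
  assumes "fsupp x" "j < k"
  shows "ip (res u k x) (u j) = 0"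
  using assms
proof (induction k arbitrary: x j)
  case 0
  then show ?case by simp
next
  case (Suc k)
  let ?w = "res u k (u k)" and ?y = "res u (Suc k) x"
  have e: "ell2 ?w" "ell2 (res u k x)" "ell2 ?y" "\<And>j. ell2 (u j)"
    by (rule res_ell2[OF u] res_ell2[OF Suc.prems(1)] ell2_fsupp[OF u])+
  define a where "a = ip (res u k x) ?w / ip ?w ?w"
  have y: "?y = (\<lambda>i. res u k x i - a * ?w i)" by (simp add: a_def)
  have less: "ip ?y (u j) = 0" if "j < k" for j
    using Suc.IH[OF Suc.prems(1) that] Suc.IH[OF u that] unfolding y
    by (simp add: ip_diff_left ip_scale_left e ell2_scale)
  \<comment> \<open>If \<open>u k\<close> depends linearly on its predecessors, its residual is zero
    and orthogonality to it is trivial; otherwise the subtracted multiple was chosen for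
    this.\<close>
  have "ip ?y ?w = 0"
  proof (cases "ip ?w ?w = 0")
    case True
    then have "?w = (\<lambda>_. 0)" using nsq_eq_0[OF e(1)] by (simp add: ip_self e)
    then show ?thesis by (simp add: ip_zero del: res.simps)
  next
    case False
    then have "a * ip ?w ?w = ip (res u k x) ?w" by (simp add: a_def)
    then show ?thesis unfolding y by (simp add: ip_diff_left ip_scale_left e ell2_scale)
  qed
  moreover have "ip (\<lambda>i. u k i - ?w i) ?y = 0"
    by (rule res_diff_orth[OF u e(3)]) (metis less ip_cnj complex_cnj_zero)
  then have "ip ?y (\<lambda>i. u k i - ?w i) = 0" by (metis ip_cnj complex_cnj_zero)
  ultimately have "ip ?y (u k) = 0" using e by (simp add: ip_diff_right del: res.simps)
  with less Suc.prems(2) show ?case by (metis less_SucE)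
qed

text \<open>The difference of the two residuals is a combination of vectors \<open>u j\<close> with
  j < m, all orthogonal to the later residual, so Pythagoras applies.\<close>

lemma res_nsq_diff:
  assumes "fsupp x" "k \<le> m"
  shows "nsq (\<lambda>i. res u k x i - res u m x i) = nsq (res u k x) - nsq (res u m x)"
proof -
  note e = res_ell2[OF assms(1)] ell2_fsupp[OF assms(1)]
  have o: "ip (u j) (res u m x) = 0" if "j < m" for j
    using res_orth[OF assms(1) that] by (metis ip_cnj complex_cnj_zero)
  have "ip (\<lambda>i. x i - res u m x i) (res u m x) = 0" "ip (\<lambda>i. x i - res u k x i) (res u m x) = 0"
    by (rule res_diff_orth[OF assms(1) e(1)], use o assms(2) in auto)+
  then have "ip (\<lambda>i. res u k x i - res u m x i) (res u m x) = 0"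
    by (simp add: ip_diff_left e)
  then show ?thesis by (intro nsq_diff e)
qed

lemma res_nsq_antimono: "fsupp x \<Longrightarrow> k \<le> m \<Longrightarrow> nsq (res u m x) \<le> nsq (res u k x)"
  using res_nsq_diff[of x k m] nsq_nonneg[of "\<lambda>i. res u k x i - res u m x i"] by simp

lemma res_nsq_convergent:
  assumes "fsupp x"
  shows "convergent (\<lambda>k. nsq (res u k x))"
proof (rule Bseq_monoseq_convergent)
  show "monoseq (\<lambda>k. nsq (res u k x))"
    using res_nsq_antimono[OF assms] by (auto simp: monoseq_def)
  show "Bseq (\<lambda>k. nsq (res u k x))"
  proof (rule BseqI')
    show "norm (nsq (res u k x)) \<le> nsq x" for k
      using res_nsq_antimono[OF assms, of 0 k] nsq_nonneg[of "res u k x"] by simp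
  qed
qed

text \<open>The squared norms of the residuals decrease and hence converge. By Pythagoras their
  differences bound the differences of the residuals in every coordinate.\<close>

lemma lproj_tendsto:
  assumes x: "fsupp x"
  shows "(\<lambda>k. res u k x i) \<longlonglongrightarrow> lproj u x i"
proof -
  have "Cauchy (\<lambda>k. res u k x i)"
  proof (rule metric_CauchyI)
    fix e :: real assume e: "e > 0"
    from res_nsq_convergent[OF x] have "Cauchy (\<lambda>k. nsq (res u k x))" by (rule convergent_Cauchy)
    then obtain N where N: "\<And>k m. k \<ge> N \<Longrightarrow> m \<ge> N \<Longrightarrow> dist (nsq (res u k x)) (nsq (res u m x)) < e\<^sup>2"
      using e unfolding Cauchy_def by (metis zero_less_power)
    have "dist (res u k x i) (res u m x i) < e" if "N \<le> k" "k \<le> m" for k m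
    proof -
      have "(cmod (res u k x i - res u m x i))\<^sup>2 \<le> nsq (\<lambda>i. res u k x i - res u m x i)"
        using nsq_ge[of "\<lambda>i. res u k x i - res u m x i" i] by (simp add: ell2_diff res_ell2 x)
      also have "\<dots> < e\<^sup>2" using N[of k m] that by (simp add: res_nsq_diff[OF x] dist_real_def)
      finally show ?thesis using e by (simp add: dist_norm power_less_imp_less_base)
    qed
    then show "\<exists>M. \<forall>m\<ge>M. \<forall>n\<ge>M. dist (res u m x i) (res u n x i) < e"
      by (metis nle_le dist_commute)
  qed
  then show ?thesis unfolding lproj_def by (simp add: Cauchy_convergent convergent_LIMSEQ_iff[symmetric])
qed

text \<open>Fatou's argument: on a finite set of coordinates the bound holds against every later
  residual, and there the limit may be taken termwise.\<close>

lemma nsq_res_lproj: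
  assumes x: "fsupp x"
  shows "ell2 (\<lambda>i. res u k x i - lproj u x i)"
    "nsq (\<lambda>i. res u k x i - lproj u x i) \<le> nsq (res u k x) - lim (\<lambda>m. nsq (res u m x))"
proof -
  have "(\<Sum>i\<in>S. (cmod (res u k x i - lproj u x i))\<^sup>2) \<le> nsq (res u k x) - lim (\<lambda>m. nsq (res u m x))"
    if S: "finite S" for S
  proof (rule LIMSEQ_le)
    show "(\<lambda>m. \<Sum>i\<in>S. (cmod (res u k x i - res u m x i))\<^sup>2) \<longlonglongrightarrow> (\<Sum>i\<in>S. (cmod (res u k x i - lproj u x i))\<^sup>2)"
      by (intro tendsto_intros lproj_tendsto x)
    show "(\<lambda>m. nsq (res u k x) - nsq (res u m x)) \<longlonglongrightarrow> nsq (res u k x) - lim (\<lambda>m. nsq (res u m x))"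
      using res_nsq_convergent[OF x] by (intro tendsto_intros) (simp add: convergent_LIMSEQ_iff)
    have "(\<Sum>i\<in>S. (cmod (res u k x i - res u m x i))\<^sup>2) \<le> nsq (res u k x) - nsq (res u m x)" if "m \<ge> k" for m
      unfolding res_nsq_diff[OF x that, symmetric] unfolding nsq_def
      using ell2_diff[OF res_ell2[OF x, of k] res_ell2[OF x, of m]] S
      by (intro finite_sum_le_infsum) (auto simp: ell2_def)
    then show "\<exists>N. \<forall>m\<ge>N. (\<Sum>i\<in>S. (cmod (res u k x i - res u m x i))\<^sup>2) \<le> nsq (res u k x) - nsq (res u m x)"
      by blast
  qed
  from nsq_le_finite[OF this] show "ell2 (\<lambda>i. res u k x i - lproj u x i)"
    "nsq (\<lambda>i. res u k x i - lproj u x i) \<le> nsq (res u k x) - lim (\<lambda>m. nsq (res u m x))" by auto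
qed

lemma lproj_ell2: "fsupp x \<Longrightarrow> ell2 (lproj u x)"
  using ell2_diff[OF res_ell2[of x 0] nsq_res_lproj(1)[of x 0]] by simp

text \<open>Since \<open>u j\<close> has finite support, the product with it is a finite sum and
  passes to the coordinatewise limit; along the residuals it is 0 from index \<open>j + 1\<close>
  on.\<close>

lemma lproj_orth:
  assumes x: "fsupp x"
  shows "ip (lproj u x) (u j) = 0"
proof -
  have eq: "ip f (u j) = (\<Sum>i | u j i \<noteq> 0. f i * cnj (u j i))" for f
    using u by (intro ip_fsupp) auto
  have "(\<lambda>k. ip (res u k x) (u j)) \<longlonglongrightarrow> ip (lproj u x) (u j)"
    unfolding eq by (intro tendsto_intros lproj_tendsto x)
  moreover have "(\<lambda>k. ip (res u k x) (u j)) \<longlonglongrightarrow> 0"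
    by (rule tendsto_eventually) (use res_orth[OF x] in \<open>auto simp: eventually_sequentially intro!: exI[of _ "Suc j"]\<close>)
  ultimately show ?thesis by (rule LIMSEQ_unique)
qed

text \<open>Replacing \<open>x\<close> by any of its residuals does not change the inner product,
  while the residuals approach the limit in norm. So the product is arbitrarily small.\<close>

lemma lproj_diff_orth:
  assumes x: "fsupp x" and f: "ell2 f" "\<And>j. ip f (u j) = 0"
  shows "ip (\<lambda>i. x i - lproj u x i) f = 0"
proof (rule ccontr)
  let ?c = "ip (\<lambda>i. x i - lproj u x i) f"
  assume "?c \<noteq> 0"
  have f': "ip (u j) f = 0" for j using f(2) by (metis ip_cnj complex_cnj_zero)
  let ?a = "\<lambda>k. nsq (res u k x) - lim (\<lambda>m. nsq (res u m x))"
  have a: "?a \<longlonglongrightarrow> 0"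
    using res_nsq_convergent[OF x] by (intro tendsto_eq_intros) (auto simp: convergent_LIMSEQ_iff)
  have c: "?c = ip (\<lambda>i. res u k x i - lproj u x i) f" for k
    using res_diff_orth[OF x f(1) f', of k] f(1)
    by (simp add: ip_diff_left ell2_fsupp x lproj_ell2 res_ell2)
  \<comment> \<open>The weight is so large that \<open>nsq f / t\<close> is at most the modulus of
    \<open>?c\<close>; in the limit \<open>ip_bound\<close> then bounds this modulus by its own
    half.\<close>
  define t where "t = (nsq f + 1) / cmod ?c"
  have t: "t > 0" using \<open>?c \<noteq> 0\<close> nsq_nonneg[of f] by (simp add: t_def add_nonneg_pos)
  have "cmod ?c \<le> (t * ?a k + nsq f / t) / 2" for k
  proof -
    have "cmod ?c \<le> (t * nsq (\<lambda>i. res u k x i - lproj u x i) + nsq f / t) / 2"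
      unfolding c[of k] by (rule ip_bound[OF nsq_res_lproj(1)[OF x] f(1) t])
    also have "\<dots> \<le> (t * ?a k + nsq f / t) / 2"
      using nsq_res_lproj(2)[OF x, of k] t by (intro divide_right_mono add_right_mono mult_left_mono) auto
    finally show ?thesis .
  qed
  moreover have "(\<lambda>k. (t * ?a k + nsq f / t) / 2) \<longlonglongrightarrow> (t * 0 + nsq f / t) / 2"
    by (intro tendsto_intros a) simp
  ultimately have "cmod ?c \<le> (t * 0 + nsq f / t) / 2"
    by (intro LIMSEQ_le_const) auto
  then have half: "cmod ?c \<le> nsq f / t / 2" by simp
  have "nsq f / t = cmod ?c * (nsq f / (nsq f + 1))" by (simp add: t_def)
  also have "\<dots> \<le> cmod ?c * 1"
    using nsq_nonneg[of f] by (intro mult_left_mono) (auto simp: divide_simps)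
  finally have "nsq f / t \<le> cmod ?c" by simp
  moreover have "cmod ?c > 0" using \<open>?c \<noteq> 0\<close> by simp
  moreover have "cmod ?c \<le> cmod ?c / 2"
    by (rule order_trans[OF half divide_right_mono]) (use \<open>nsq f / t \<le> cmod ?c\<close> in auto)
  ultimately show False by linarith
qed

lemma lproj_support:
  assumes "\<And>j. {i. u j i \<noteq> 0} \<subseteq> A" "{i. x i \<noteq> 0} \<subseteq> A" "fsupp x"
  shows "{i. lproj u x i \<noteq> 0} \<subseteq> A"
proof safe
  fix i assume "lproj u x i \<noteq> 0"
  show "i \<in> A"
  proof (rule ccontr)
    assume "i \<notin> A"
    then have "res u k x i = 0" for k using res_support[where u = u and A = A, OF assms(1,2)] by blast
    then have "(\<lambda>k. res u k x i) \<longlonglongrightarrow> 0" by simp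
    with lproj_tendsto[OF assms(3)] \<open>lproj u x i \<noteq> 0\<close> LIMSEQ_unique show False by blast
  qed
qed

end

section \<open>Measurable dependence of sums and projections on a parameter\<close>

lemma countable_finite_exhaustion:
  assumes "countable A"
  obtains B :: "nat \<Rightarrow> 'a set" where "\<And>n. finite (B n)" "\<And>n. B n \<subseteq> A"
    "filterlim B (finite_subsets_at_top A) sequentially"
proof (cases "A = {}")
  case True
  then show ?thesis by (intro that[of "\<lambda>_. {}"]) (auto simp: filterlim_finite_subsets_at_top)
next
  case False
  let ?B = "\<lambda>n. from_nat_into A ` {..<n}"
  show ?thesis
  proof
    show "filterlim ?B (finite_subsets_at_top A) sequentially"
      unfolding filterlim_finite_subsets_at_top
    proof safe
      fix X assume X: "finite X" "X \<subseteq> A"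
      obtain m where m: "\<And>x. x \<in> X \<Longrightarrow> to_nat_on A x < m"
        using X(1) finite_nat_set_iff_bounded[of "to_nat_on A ` X"] by auto
      have "X \<subseteq> ?B n" if "n \<ge> m" for n
      proof
        fix x assume "x \<in> X"
        with m[OF this] that X(2) assms show "x \<in> ?B n"
          by (intro image_eqI[of _ _ "to_nat_on A x"]) auto
      qed
      then show "\<forall>\<^sub>F n in sequentially. finite (?B n) \<and> X \<subseteq> ?B n \<and> ?B n \<subseteq> A"
        using from_nat_into[OF False] by (intro eventually_sequentiallyI[of m]) auto
    qed
  qed (use from_nat_into[OF False] in auto)
qed

text \<open>\<open>infsum\<close> is a limit along the net of finite subsets, whereas measurability
  passes only to limits of sequences; an exhaustion provides a cofinal sequence.\<close>

lemma borel_measurable_infsum_countable: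
  fixes f :: "'c \<Rightarrow> 'i \<Rightarrow> 'b :: {second_countable_topology, real_normed_vector}"
  assumes "countable A" "\<And>i. i \<in> A \<Longrightarrow> (\<lambda>c. f c i) \<in> borel_measurable M"
    "\<And>c. c \<in> space M \<Longrightarrow> f c summable_on A"
  shows "(\<lambda>c. \<Sum>\<^sub>\<infinity>i\<in>A. f c i) \<in> borel_measurable M"
proof -
  obtain B where B: "\<And>n. finite (B n)" "\<And>n. B n \<subseteq> A" "filterlim B (finite_subsets_at_top A) sequentially"
    using countable_finite_exhaustion[OF assms(1)] by metis
  show ?thesis
  proof (rule borel_measurable_LIMSEQ_metric)
    show "(\<lambda>c. \<Sum>i\<in>B n. f c i) \<in> borel_measurable M" for n
      using assms(2) B by (intro borel_measurable_sum) auto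
    show "(\<lambda>n. \<Sum>i\<in>B n. f c i) \<longlonglongrightarrow> (\<Sum>\<^sub>\<infinity>i\<in>A. f c i)" if "c \<in> space M" for c
      using filterlim_compose[OF infsum_tendsto[OF assms(3)[OF that]] B(3)] by simp
  qed
qed

lemma borel_measurable_ip:
  assumes "countable A" "\<And>i. i \<in> A \<Longrightarrow> (\<lambda>c. f c i) \<in> borel_measurable M"
    "\<And>i. i \<in> A \<Longrightarrow> (\<lambda>c. h c i) \<in> borel_measurable M"
    "\<And>c. c \<in> space M \<Longrightarrow> {i. f c i \<noteq> 0} \<subseteq> A"
    "\<And>c. c \<in> space M \<Longrightarrow> ell2 (f c)" "\<And>c. c \<in> space M \<Longrightarrow> ell2 (h c)"
  shows "(\<lambda>c. ip (f c) (h c)) \<in> borel_measurable M"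
proof -
  have cnjm: "(\<lambda>c. cnj (h c i)) \<in> borel_measurable M" if "i \<in> A" for i
    using assms(3)[OF that] by (rule borel_measurable_continuous_onI[THEN measurable_compose_rev, rotated])
      (intro continuous_intros)
  have "(\<lambda>c. \<Sum>\<^sub>\<infinity>i\<in>A. f c i * cnj (h c i)) \<in> borel_measurable M"
  proof (rule borel_measurable_infsum_countable[OF assms(1)])
    show "(\<lambda>i. f c i * cnj (h c i)) summable_on A" if "c \<in> space M" for c
      using ell2_summable_mult[OF assms(5,6)[OF that]] summable_on_subset_banach by blast
  qed (use assms(2) cnjm in \<open>auto intro!: borel_measurable_times\<close>)
  moreover have "ip (f c) (h c) = (\<Sum>\<^sub>\<infinity>i\<in>A. f c i * cnj (h c i))" if "c \<in> space M" for c
    unfolding ip_def using assms(4)[OF that] by (intro infsum_cong_neutral) auto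
  ultimately show ?thesis by (simp cong: measurable_cong)
qed

text \<open>The induction covers all measurable families \<open>x\<close> at once, because the
  recursion applies the residual to \<open>u c k\<close> as well.\<close>

lemma borel_measurable_res:
  assumes "countable A" "\<And>j i. i \<in> A \<Longrightarrow> (\<lambda>c. u c j i) \<in> borel_measurable M"
    "\<And>c j. c \<in> space M \<Longrightarrow> {i. u c j i \<noteq> 0} \<subseteq> A" "\<And>c j. c \<in> space M \<Longrightarrow> fsupp (u c j)"
    "\<And>i. i \<in> A \<Longrightarrow> (\<lambda>c. x c i) \<in> borel_measurable M"
    "\<And>c. c \<in> space M \<Longrightarrow> {i. x c i \<noteq> 0} \<subseteq> A" "\<And>c. c \<in> space M \<Longrightarrow> fsupp (x c)"
    "i \<in> A"
  shows "(\<lambda>c. res (u c) k (x c) i) \<in> borel_measurable M"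
  using assms(5-8)
proof (induction k arbitrary: x i)
  case (Suc k)
  have w: "(\<lambda>c. res (u c) k (u c k) i) \<in> borel_measurable M" if "i \<in> A" for i
    using assms that by (intro Suc.IH) auto
  have v: "(\<lambda>c. res (u c) k (x c) i) \<in> borel_measurable M" if "i \<in> A" for i
    using Suc.prems that by (intro Suc.IH) auto
  have supp: "{i. res (u c) k (u c k) i \<noteq> 0} \<subseteq> A" "{i. res (u c) k (x c) i \<noteq> 0} \<subseteq> A" if "c \<in> space M" for c
    by (rule res_support[where u = "u c" and A = A] assms(3)[OF that] Suc.prems(2)[OF that])+
  have e: "ell2 (res (u c) k (u c k))" "ell2 (res (u c) k (x c))" if "c \<in> space M" for c
    by (rule res_ell2, use assms(4) Suc.prems(3) that in auto)+
  show ?case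
    unfolding res.simps
    by (intro borel_measurable_diff borel_measurable_times borel_measurable_divide
        borel_measurable_ip[OF assms(1)] w v supp e Suc.prems(4))
qed simp

lemma borel_measurable_lproj:
  assumes "countable A" "\<And>j i. i \<in> A \<Longrightarrow> (\<lambda>c. u c j i) \<in> borel_measurable M"
    "\<And>c j. c \<in> space M \<Longrightarrow> {i. u c j i \<noteq> 0} \<subseteq> A" "\<And>c j. c \<in> space M \<Longrightarrow> fsupp (u c j)"
    "\<And>i. i \<in> A \<Longrightarrow> (\<lambda>c. x c i) \<in> borel_measurable M"
    "\<And>c. c \<in> space M \<Longrightarrow> {i. x c i \<noteq> 0} \<subseteq> A" "\<And>c. c \<in> space M \<Longrightarrow> fsupp (x c)"
    "i \<in> A"
  shows "(\<lambda>c. lproj (u c) (x c) i) \<in> borel_measurable M"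
proof (rule borel_measurable_LIMSEQ_metric)
  show "(\<lambda>c. res (u c) k (x c) i) \<in> borel_measurable M" for k
    using assms by (rule borel_measurable_res)
  show "(\<lambda>k. res (u c) k (x c) i) \<longlonglongrightarrow> lproj (u c) (x c) i" if "c \<in> space M" for c
    using assms(4,7) that by (intro lproj_tendsto) auto
qed

section \<open>The Laplacian and harmonic chains\<close>

abbreviation sgn_of :: "(nat \<Rightarrow> nat) \<Rightarrow> complex" where
  "sgn_of p \<equiv> of_int (sign p)"

abbreviation perms :: "nat \<Rightarrow> (nat \<Rightarrow> nat) set" where
  "perms n \<equiv> {p. p permutes {..<n}}"

definition alternating :: "('v list \<Rightarrow> complex) \<Rightarrow> bool" where
  "alternating f \<longleftrightarrow> (\<forall>xs p. p permutes {..<length xs} \<longrightarrow> f (permute_list p xs) = sgn_of p * f xs)"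

text \<open>\<open>m\<close> counts vertices, so n-chains have \<open>m = n + 1\<close>. The value
  \<open>m = 0\<close> occurs for boundaries of 0-chains and leaves only the zero chain as soon as
  the empty list is not a simplex.\<close>

definition chain_supported :: "'v set set \<Rightarrow> nat \<Rightarrow> ('v list \<Rightarrow> complex) \<Rightarrow> bool" where
  "chain_supported L m f \<longleftrightarrow> (\<forall>xs. f xs \<noteq> 0 \<longrightarrow> xs \<in> ordered_simplices L \<and> length xs = m)"

lemma permutes_permutation: "p permutes {..<n::nat} \<Longrightarrow> permutation p"
  by (auto simp: permutation_permutes)

lemma sgn_of_square: "sgn_of p * (sgn_of p * z) = z" "cnj (sgn_of p) = sgn_of p"
proof -
  have "sgn_of p * sgn_of p = of_int (sign p * sign p)" by (simp only: of_int_mult)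
  then have "sgn_of p * sgn_of p = 1" by simp
  then show "sgn_of p * (sgn_of p * z) = z" by (simp flip: mult.assoc)
qed simp

lemma card_perms: "card (perms n) = fact n" "finite (perms n)"
  using card_permutations[of "{..<n}" n] finite_permutations[of "{..<n}"] by auto

lemma permute_ordered_simplices:
  "p permutes {..<length xs} \<Longrightarrow> permute_list p xs \<in> ordered_simplices L \<longleftrightarrow> xs \<in> ordered_simplices L"
  by (simp add: ordered_simplices_def)

lemma permute_list_inv:
  assumes "p permutes {..<length xs}"
  shows "permute_list (inv_into UNIV p) (permute_list p xs) = xs" "permute_list p (permute_list (inv_into UNIV p) xs) = xs"
  using assms permutes_inv[OF assms] permute_list_compose[of "inv_into UNIV p" xs p] permute_list_compose[of p xs "inv_into UNIV p"]
  by (simp_all add: permutes_inv_o)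

lemma alternatingD: "alternating f \<Longrightarrow> p permutes {..<length xs} \<Longrightarrow> f (permute_list p xs) = sgn_of p * f xs"
  by (simp add: alternating_def)

lemma l2_chains_iff: "f \<in> l2_chains L n \<longleftrightarrow> chain_supported L (n + 1) f \<and> alternating f \<and> ell2 f"
proof -
  have "(\<lambda>xs. (cmod (f xs))\<^sup>2) summable_on ordered_simplices L \<longleftrightarrow> ell2 f"
    if "chain_supported L (n + 1) f"
    unfolding ell2_def using that by (intro summable_on_cong_neutral) (auto simp: chain_supported_def)
  then show ?thesis by (auto simp: l2_chains_def chain_supported_def alternating_def)
qed

lemma chain_inner_eq:
  assumes "chain_supported L m f \<or> chain_supported L m h"
  shows "chain_inner L f h = ip f h / fact m"
proof -
  have "chain_inner L f h = (\<Sum>\<^sub>\<infinity>xs. f xs * cnj (h xs) / fact m)"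
    unfolding chain_inner_def
    by (rule infsum_cong_neutral) (use assms in \<open>auto simp: chain_supported_def\<close>)
  also have "\<dots> = ip f h / fact m"
    unfolding ip_def divide_inverse by (rule infsum_cmult_left')
  finally show ?thesis .
qed

lemma l2_chains_diff: "f \<in> l2_chains L n \<Longrightarrow> h \<in> l2_chains L n \<Longrightarrow> (\<lambda>xs. f xs - h xs) \<in> l2_chains L n"
  unfolding l2_chains_iff
  by (auto simp: ell2_diff alternating_def chain_supported_def right_diff_distrib)
    (metis diff_self)+

lemma l2_chains_scale: "f \<in> l2_chains L n \<Longrightarrow> (\<lambda>xs. a * f xs) \<in> l2_chains L n"
  unfolding l2_chains_iff by (auto simp: ell2_scale alternating_def chain_supported_def)

lemma l2_chains_zero: "(\<lambda>_. 0) \<in> l2_chains L n"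
  unfolding l2_chains_iff by (auto simp: alternating_def chain_supported_def ell2_def)

lemma l2_chains_sum:
  assumes "\<And>y. y \<in> F \<Longrightarrow> f y \<in> l2_chains L n"
  shows "(\<lambda>xs. \<Sum>y\<in>F. f y xs) \<in> l2_chains L n"
  unfolding l2_chains_iff
proof (intro conjI)
  show "ell2 (\<lambda>xs. \<Sum>y\<in>F. f y xs)" using assms by (intro ell2_sum) (auto simp: l2_chains_iff)
  show "alternating (\<lambda>xs. \<Sum>y\<in>F. f y xs)"
    using assms by (auto simp: alternating_def l2_chains_iff sum_distrib_left intro!: sum.cong)
  show "chain_supported L (n + 1) (\<lambda>xs. \<Sum>y\<in>F. f y xs)"
    unfolding chain_supported_def
  proof (intro allI impI)
    fix xs assume "(\<Sum>y\<in>F. f y xs) \<noteq> 0"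
    then obtain y where "y \<in> F" "f y xs \<noteq> 0" by (meson sum.neutral)
    then show "xs \<in> ordered_simplices L \<and> length xs = n + 1"
      using assms by (auto simp: l2_chains_iff chain_supported_def)
  qed
qed

text \<open>For \<open>p = id\<close> this deletes the first vertex, the operation dual to the
  prefixing of a vertex in the definition of the boundary.\<close>

definition tail_act :: "'v set set \<Rightarrow> nat \<Rightarrow> (nat \<Rightarrow> nat) \<Rightarrow> ('v list \<Rightarrow> complex) \<Rightarrow> 'v list \<Rightarrow> complex" where
  "tail_act L m p f = (\<lambda>xs. if xs \<in> ordered_simplices L \<and> length xs = m then f (tl (permute_list p xs)) else 0)"

text \<open>The explicit adjoint of the boundary operator. Antisymmetrizing the map that deletes
  the first vertex makes it evident that the values are alternating.\<close>

definition cobd :: "'v set set \<Rightarrow> nat \<Rightarrow> ('v list \<Rightarrow> complex) \<Rightarrow> 'v list \<Rightarrow> complex" where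
  "cobd L n f = (\<lambda>xs. 1 / fact n * (\<Sum>p\<in>perms (n + 1). sgn_of p * tail_act L (n + 1) p f xs))"

lemma cobd_supported: "chain_supported L (n + 1) (cobd L n f)"
  by (auto simp: chain_supported_def cobd_def tail_act_def split: if_splits intro!: sum.neutral)

text \<open>Permuting the list by \<open>q\<close> reindexes the sum over \<open>p\<close> by
  composition with \<open>q\<close>, and the sign of \<open>q\<close> comes out.\<close>

lemma cobd_alternating: "alternating (cobd L n f)"
  unfolding alternating_def
proof (intro allI impI)
  fix xs :: "'a list" and q assume q: "q permutes {..<length xs}"
  show "cobd L n f (permute_list q xs) = sgn_of q * cobd L n f xs"
  proof (cases "length xs = n + 1")
    case False
    then show ?thesis by (simp add: cobd_def tail_act_def)
  next
    case True
    then have q': "q permutes {..<n + 1}" using q by simp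
    have *: "sgn_of p * tail_act L (n + 1) p f (permute_list q xs) =
        sgn_of q * (sgn_of (q \<circ> p) * tail_act L (n + 1) (q \<circ> p) f xs)" if "p permutes {..<n + 1}" for p
    proof -
      have "permute_list (q \<circ> p) xs = permute_list p (permute_list q xs)"
        using that True by (intro permute_list_compose) simp
      moreover have "sgn_of (q \<circ> p) = sgn_of q * sgn_of p"
        using that q' by (simp add: sign_compose permutes_permutation)
      ultimately show ?thesis
        using sgn_of_square(1)[of q] True permute_ordered_simplices[OF q, of L]
        by (simp add: tail_act_def mult.assoc)
    qed
    have "(\<Sum>p\<in>perms (n + 1). sgn_of p * tail_act L (n + 1) p f (permute_list q xs)) =
      (\<Sum>p\<in>perms (n + 1). sgn_of q * (sgn_of (q \<circ> p) * tail_act L (n + 1) (q \<circ> p) f xs))"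
      by (intro sum.cong refl *) simp
    also have "\<dots> = (\<Sum>p\<in>perms (n + 1). sgn_of q * (sgn_of p * tail_act L (n + 1) p f xs))"
      by (rule setum_permutations_compose_left[OF q', symmetric])
    also have "\<dots> = sgn_of q * (\<Sum>p\<in>perms (n + 1). sgn_of p * tail_act L (n + 1) p f xs)"
      by (simp only: sum_distrib_left)
    finally show ?thesis by (simp only: cobd_def mult.left_commute)
  qed
qed

lemma boundary_supported: "chain_supported L (n + 1) f \<Longrightarrow> chain_supported L n (boundary L f)"
  unfolding chain_supported_def
proof (intro allI impI)
  fix ys
  assume f: "\<forall>xs. f xs \<noteq> 0 \<longrightarrow> xs \<in> ordered_simplices L \<and> length xs = n + 1" and "boundary L f ys \<noteq> 0"
  then have ys: "ys \<in> ordered_simplices L" "(\<Sum>v | v # ys \<in> ordered_simplices L. f (v # ys)) \<noteq> 0"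
    by (auto simp: boundary_def split: if_splits)
  then obtain v where "f (v # ys) \<noteq> 0" by (meson sum.neutral)
  with f have "length (v # ys) = n + 1" by blast
  with ys(1) show "ys \<in> ordered_simplices L \<and> length ys = n" by simp
qed

section \<open>Boundary, coboundary and Laplacian under a degree bound\<close>

locale bounded_complex =
  fixes L :: "'v set set" and D :: nat
  assumes complex: "simplicial_complex L"
    and degree: "\<And>v. v \<in> \<Union>L \<Longrightarrow> finite {\<sigma>\<in>L. card \<sigma> = 2 \<and> v \<in> \<sigma>} \<and> card {\<sigma>\<in>L. card \<sigma> = 2 \<and> v \<in> \<sigma>} \<le> D"
begin

lemma subset_simplex: "\<sigma> \<in> L \<Longrightarrow> \<tau> \<subseteq> \<sigma> \<Longrightarrow> \<tau> \<noteq> {} \<Longrightarrow> \<tau> \<in> L"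
  using complex unfolding simplicial_complex_def by blast

lemma Nil_not_simplex: "[] \<notin> ordered_simplices L"
  using complex by (auto simp: ordered_simplices_def simplicial_complex_def)

lemma neighbours:
  assumes "v \<in> \<Union>L"
  shows "finite {w. w \<noteq> v \<and> {v, w} \<in> L}" "card {w. w \<noteq> v \<and> {v, w} \<in> L} \<le> D"
proof -
  have inj: "inj_on (\<lambda>w. {v, w}) {w. w \<noteq> v \<and> {v, w} \<in> L}" by (auto simp: inj_on_def doubleton_eq_iff)
  have sub: "(\<lambda>w. {v, w}) ` {w. w \<noteq> v \<and> {v, w} \<in> L} \<subseteq> {\<sigma>\<in>L. card \<sigma> = 2 \<and> v \<in> \<sigma>}" by auto
  show "finite {w. w \<noteq> v \<and> {v, w} \<in> L}"
    using inj_on_finite[OF inj sub] degree[OF assms] by blast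
  show "card {w. w \<noteq> v \<and> {v, w} \<in> L} \<le> D"
    using card_inj_on_le[OF inj sub] degree[OF assms] by linarith
qed

lemma tl_ordered: "xs \<in> ordered_simplices L \<Longrightarrow> tl xs \<noteq> [] \<Longrightarrow> tl xs \<in> ordered_simplices L"
  unfolding ordered_simplices_def by (cases xs) (auto elim!: subset_simplex)

text \<open>A vertex that extends \<open>ys\<close> is a neighbour of the head of \<open>ys\<close>.
  The empty list has to be excluded, since every vertex extends it.\<close>

lemma extensions:
  assumes "ys \<noteq> []"
  shows "finite {v. v # ys \<in> ordered_simplices L}" "card {v. v # ys \<in> ordered_simplices L} \<le> D"
proof -
  have "finite {v. v # ys \<in> ordered_simplices L} \<and> card {v. v # ys \<in> ordered_simplices L} \<le> D"
  proof (cases "ys \<in> ordered_simplices L")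
    case False
    then have "{v. v # ys \<in> ordered_simplices L} = {}" using tl_ordered[of "_ # ys"] assms by auto
    then show ?thesis by simp
  next
    case True
    obtain y zs where ys: "ys = y # zs" using assms by (cases ys) auto
    have sub: "{v. v # ys \<in> ordered_simplices L} \<subseteq> {w. w \<noteq> y \<and> {y, w} \<in> L}"
      by (auto simp: ordered_simplices_def ys elim!: subset_simplex)
    have "y \<in> \<Union>L" using True by (auto simp: ordered_simplices_def ys)
    from neighbours[OF this] sub show ?thesis
      by (meson card_mono finite_subset order_trans)
  qed
  then show "finite {v. v # ys \<in> ordered_simplices L}" "card {v. v # ys \<in> ordered_simplices L} \<le> D" by auto
qed

text \<open>Cauchy-Schwarz over the at most D extensions of \<open>ys\<close> costs a factor D, and
  each list arises as \<open>v # ys\<close> only once.\<close>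

lemma boundary_ell2:
  assumes "ell2 f"
  shows "ell2 (boundary L f)"
proof (rule nsq_le_finite(1))
  fix S :: "'v list set" assume S: "finite S"
  let ?E = "\<lambda>ys. {v. v # ys \<in> ordered_simplices L}" and ?S = "S \<inter> ordered_simplices L"
  have nonempty: "ys \<noteq> []" if "ys \<in> ?S" for ys using that Nil_not_simplex by auto
  have "(\<Sum>ys\<in>S. (cmod (boundary L f ys))\<^sup>2) = (\<Sum>ys\<in>?S. (cmod (boundary L f ys))\<^sup>2)"
    using S by (intro sum.mono_neutral_right) (auto simp: boundary_def)
  also have "\<dots> \<le> (\<Sum>ys\<in>?S. \<Sum>v\<in>?E ys. real D * (cmod (f (v # ys)))\<^sup>2)"
  proof (rule sum_mono)
    fix ys assume ys: "ys \<in> ?S"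
    note E = extensions[OF nonempty[OF ys]]
    have "(cmod (boundary L f ys))\<^sup>2 \<le> (\<Sum>v\<in>?E ys. cmod (f (v # ys)))\<^sup>2"
      using ys by (intro power_mono) (auto simp: boundary_def intro: norm_sum)
    also have "\<dots> \<le> (\<Sum>v\<in>?E ys. (cmod (f (v # ys)))\<^sup>2) * card (?E ys)"
      by (rule sum_squared_le_sum_of_squares)
    also have "\<dots> \<le> (\<Sum>v\<in>?E ys. (cmod (f (v # ys)))\<^sup>2) * D"
      using E by (intro mult_left_mono sum_nonneg) auto
    finally show "(cmod (boundary L f ys))\<^sup>2 \<le> (\<Sum>v\<in>?E ys. real D * (cmod (f (v # ys)))\<^sup>2)"
      by (simp add: sum_distrib_left mult.commute)
  qed
  also have "\<dots> = (\<Sum>(ys, v)\<in>Sigma ?S ?E. real D * (cmod (f (v # ys)))\<^sup>2)"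
    using S extensions[OF nonempty] by (intro sum.Sigma) auto
  also have "\<dots> = (\<Sum>xs\<in>(\<lambda>(ys, v). v # ys) ` Sigma ?S ?E. real D * (cmod (f xs))\<^sup>2)"
    by (subst sum.reindex) (auto simp: inj_on_def case_prod_unfold)
  also have "\<dots> = real D * (\<Sum>xs\<in>(\<lambda>(ys, v). v # ys) ` Sigma ?S ?E. (cmod (f xs))\<^sup>2)"
    by (simp add: sum_distrib_left)
  also have "\<dots> \<le> real D * nsq f"
  proof (rule mult_left_mono)
    have "finite (Sigma ?S ?E)" using S extensions[OF nonempty] by (intro finite_SigmaI) auto
    then show "(\<Sum>xs\<in>(\<lambda>(ys, v). v # ys) ` Sigma ?S ?E. (cmod (f xs))\<^sup>2) \<le> nsq f"
      using assms unfolding nsq_def ell2_def by (intro finite_sum_le_infsum) auto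
  qed simp
  finally show "(\<Sum>ys\<in>S. (cmod (boundary L f ys))\<^sup>2) \<le> real D * nsq f" .
qed

text \<open>Deleting the first vertex is at most D-to-one on the ordered simplices with nonempty
  tail.\<close>

lemma tail_act_id_ell2:
  assumes "ell2 f" "chain_supported L n f"
  shows "ell2 (tail_act L (n + 1) id f)"
proof (rule nsq_le_finite(1))
  fix S :: "'v list set" assume S: "finite S"
  let ?S = "{xs\<in>S. xs \<in> ordered_simplices L \<and> tl xs \<noteq> []}"
  \<comment> \<open>All one-vertex lists have the empty tail, without any bound on their number;
    they do no harm because \<open>f\<close> vanishes there.\<close>
  have "f [] = 0" using assms(2) Nil_not_simplex by (auto simp: chain_supported_def)
  then have "(\<Sum>xs\<in>S. (cmod (tail_act L (n + 1) id f xs))\<^sup>2) = (\<Sum>xs\<in>?S. (cmod (tail_act L (n + 1) id f xs))\<^sup>2)"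
    using S by (intro sum.mono_neutral_right) (auto simp: tail_act_def)
  also have "\<dots> \<le> (\<Sum>xs\<in>?S. (cmod (f (tl xs)))\<^sup>2)"
    by (intro sum_mono) (auto simp: tail_act_def)
  also have "\<dots> = (\<Sum>ys\<in>tl ` ?S. \<Sum>xs | xs \<in> ?S \<and> tl xs = ys. (cmod (f (tl xs)))\<^sup>2)"
    using S by (intro sum.image_gen) auto
  also have "\<dots> \<le> (\<Sum>ys\<in>tl ` ?S. real D * (cmod (f ys))\<^sup>2)"
  proof (rule sum_mono)
    fix ys assume ys: "ys \<in> tl ` ?S"
    then have "ys \<noteq> []" by auto
    have "card {xs \<in> ?S. tl xs = ys} \<le> card ((\<lambda>v. v # ys) ` {v. v # ys \<in> ordered_simplices L})"
    proof (rule card_mono)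
      show "finite ((\<lambda>v. v # ys) ` {v. v # ys \<in> ordered_simplices L})" using extensions[OF \<open>ys \<noteq> []\<close>] by simp
      show "{xs \<in> ?S. tl xs = ys} \<subseteq> (\<lambda>v. v # ys) ` {v. v # ys \<in> ordered_simplices L}"
      proof safe
        fix xs assume "xs \<in> ordered_simplices L" "tl xs \<noteq> []" "ys = tl xs"
        then show "xs \<in> (\<lambda>v. v # tl xs) ` {v. v # tl xs \<in> ordered_simplices L}" by (cases xs) auto
      qed
    qed
    also have "\<dots> \<le> D" using extensions[OF \<open>ys \<noteq> []\<close>] by (meson card_image_le order_trans)
    finally have "real (card {xs \<in> ?S. tl xs = ys}) * (cmod (f ys))\<^sup>2 \<le> real D * (cmod (f ys))\<^sup>2"
      by (intro mult_right_mono) auto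
    then show "(\<Sum>xs | xs \<in> ?S \<and> tl xs = ys. (cmod (f (tl xs)))\<^sup>2) \<le> real D * (cmod (f ys))\<^sup>2"
      by simp
  qed
  also have "\<dots> = real D * (\<Sum>ys\<in>tl ` ?S. (cmod (f ys))\<^sup>2)" by (simp add: sum_distrib_left)
  also have "\<dots> \<le> real D * nsq f"
    using assms(1) S unfolding nsq_def ell2_def by (intro mult_left_mono finite_sum_le_infsum) auto
  finally show "(\<Sum>xs\<in>S. (cmod (tail_act L (n + 1) id f xs))\<^sup>2) \<le> real D * nsq f" .
qed

lemma bij_betw_permute_ordered:
  assumes "p permutes {..<m}"
  shows "bij_betw (permute_list p) {xs \<in> ordered_simplices L. length xs = m} {xs \<in> ordered_simplices L. length xs = m}"
  by (rule bij_betw_byWitness[of _ "permute_list (inv_into UNIV p)"])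
    (use assms permutes_inv[OF assms] in \<open>auto simp: permute_list_inv permute_ordered_simplices\<close>)

lemma tail_act_ell2:
  assumes "ell2 f" "chain_supported L n f" "p permutes {..<n + 1}"
  shows "ell2 (tail_act L (n + 1) p f)"
proof -
  let ?X = "{xs \<in> ordered_simplices L. length xs = n + 1}"
  have "(\<lambda>xs. (cmod (tail_act L (n + 1) id f xs))\<^sup>2) summable_on ?X"
    using tail_act_id_ell2[OF assms(1,2)] unfolding ell2_def by (rule summable_on_subset) auto
  then have "(\<lambda>xs. (cmod (tail_act L (n + 1) id f (permute_list p xs)))\<^sup>2) summable_on ?X"
    by (subst summable_on_reindex_bij_betw[OF bij_betw_permute_ordered[OF assms(3)]])
  then have "(\<lambda>xs. (cmod (tail_act L (n + 1) p f xs))\<^sup>2) summable_on ?X"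
    by (rule summable_on_cong[THEN iffD1, rotated])
      (use assms(3) in \<open>auto simp: tail_act_def permute_ordered_simplices\<close>)
  then show ?thesis
    unfolding ell2_def by (rule summable_on_cong_neutral[THEN iffD1, rotated -1]) (auto simp: tail_act_def)
qed

lemma cobd_l2_chains:
  assumes "ell2 f" "chain_supported L n f"
  shows "cobd L n f \<in> l2_chains L n"
  unfolding l2_chains_iff
proof (intro conjI cobd_supported cobd_alternating)
  show "ell2 (cobd L n f)"
    unfolding cobd_def by (intro ell2_scale ell2_sum tail_act_ell2 assms) simp
qed

text \<open>Substituting the permuted list moves the permutation onto the alternating chain
  \<open>k\<close>, which answers with the sign.\<close>

lemma ip_tail_act:
  assumes "k \<in> l2_chains L n" "p permutes {..<n + 1}"
  shows "ip k (tail_act L (n + 1) p f) = sgn_of p * ip k (tail_act L (n + 1) id f)"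
proof -
  let ?X = "{xs \<in> ordered_simplices L. length xs = n + 1}"
  have restr: "ip k (tail_act L (n + 1) p f) = (\<Sum>\<^sub>\<infinity>xs\<in>?X. k xs * cnj (f (tl (permute_list p xs))))" for p
    unfolding ip_def by (rule infsum_cong_neutral) (auto simp: tail_act_def)
  have "(\<Sum>\<^sub>\<infinity>xs\<in>?X. k xs * cnj (f (tl (permute_list p xs)))) =
    (\<Sum>\<^sub>\<infinity>xs\<in>?X. sgn_of p * (k (permute_list p xs) * cnj (f (tl (permute_list p xs)))))"
    using assms by (intro infsum_cong) (auto simp: l2_chains_iff alternatingD sgn_of_square(1) mult.assoc)
  also have "\<dots> = sgn_of p * (\<Sum>\<^sub>\<infinity>xs\<in>?X. k (permute_list p xs) * cnj (f (tl (permute_list p xs))))"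
    by (rule infsum_cmult_right')
  also have "(\<Sum>\<^sub>\<infinity>xs\<in>?X. k (permute_list p xs) * cnj (f (tl (permute_list p xs)))) =
    (\<Sum>\<^sub>\<infinity>xs\<in>?X. k xs * cnj (f (tl xs)))"
    using infsum_reindex_bij_betw[OF bij_betw_permute_ordered[OF assms(2)], of "\<lambda>xs. k xs * cnj (f (tl xs))"] .
  finally show ?thesis unfolding restr by simp
qed

text \<open>Fubini: a sum over pairs of a list \<open>ys\<close> and an extension \<open>v\<close>
  is a sum over the lists \<open>v # ys\<close>, so prefixing on one side is deleting on the
  other.\<close>

lemma ip_boundary:
  assumes "k \<in> l2_chains L n" "ell2 f" "chain_supported L n f"
  shows "ip (boundary L k) f = ip k (tail_act L (n + 1) id f)"
proof -
  let ?E = "\<lambda>ys. {v. v # ys \<in> ordered_simplices L}" and ?O = "ordered_simplices L"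
  let ?g = "\<lambda>xs. k xs * cnj (f (tl xs))"
  let ?X = "(\<lambda>(ys, v). v # ys) ` Sigma ?O ?E"
  have k: "chain_supported L (n + 1) k" "ell2 k" using assms(1) by (auto simp: l2_chains_iff)
  have f0: "f [] = 0" using assms(3) Nil_not_simplex by (auto simp: chain_supported_def)
  have zero: "k xs * cnj (tail_act L (n + 1) id f xs) = 0" if "xs \<notin> ?X" for xs
  proof (rule ccontr)
    assume "k xs * cnj (tail_act L (n + 1) id f xs) \<noteq> 0"
    then have *: "xs \<in> ?O" "f (tl xs) \<noteq> 0" by (auto simp: tail_act_def split: if_splits)
    then obtain v ys where "xs = v # ys" "ys \<in> ?O"
      using f0 assms(3) by (cases xs) (auto simp: chain_supported_def)
    with * that show False by force
  qed
  have eq: "k xs * cnj (tail_act L (n + 1) id f xs) = ?g xs" if "xs \<in> ?X" for xs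
    using that k(1) by (auto simp: tail_act_def chain_supported_def)
  have inj: "inj_on (\<lambda>(ys, v). v # ys) (Sigma ?O ?E)" by (auto simp: inj_on_def)
  have "(\<lambda>xs. k xs * cnj (tail_act L (n + 1) id f xs)) summable_on UNIV"
    by (intro ell2_summable_mult k tail_act_id_ell2 assms)
  then have "?g summable_on ?X"
    by (rule summable_on_cong_neutral[THEN iffD1, rotated -1]) (use zero eq in auto)
  then have summ: "(\<lambda>(ys, v). ?g (v # ys)) summable_on Sigma ?O ?E"
    by (subst (asm) summable_on_reindex[OF inj]) (simp add: o_def case_prod_unfold)
  have "ip k (tail_act L (n + 1) id f) = infsum ?g ?X"
    unfolding ip_def by (rule infsum_cong_neutral) (use zero eq in auto)
  also have "\<dots> = infsum (\<lambda>(ys, v). ?g (v # ys)) (Sigma ?O ?E)"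
    by (subst infsum_reindex[OF inj]) (simp add: o_def case_prod_unfold)
  also have "\<dots> = (\<Sum>\<^sub>\<infinity>ys\<in>?O. \<Sum>\<^sub>\<infinity>v\<in>?E ys. ?g (v # ys))"
    using infsum_Sigma'_banach[OF summ] by simp
  also have "\<dots> = (\<Sum>\<^sub>\<infinity>ys\<in>?O. boundary L k ys * cnj (f ys))"
  proof (rule infsum_cong)
    fix ys assume ys: "ys \<in> ?O"
    then have "ys \<noteq> []" using Nil_not_simplex by auto
    then have "finite (?E ys)" by (rule extensions(1))
    then show "(\<Sum>\<^sub>\<infinity>v\<in>?E ys. ?g (v # ys)) = boundary L k ys * cnj (f ys)"
      using ys by (simp add: boundary_def sum_distrib_right)
  qed
  also have "\<dots> = ip (boundary L k) f"
    unfolding ip_def by (rule infsum_cong_neutral) (auto simp: boundary_def)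
  finally show ?thesis by simp
qed

text \<open>All (n+1)! terms of the antisymmetrization contribute equally, so division by n! leaves
  a factor n + 1. It accounts for the different factorials n! and (n+1)! in the two inner
  products.\<close>

lemma boundary_cobd_adjoint:
  assumes "k \<in> l2_chains L n" "ell2 f" "chain_supported L n f"
  shows "chain_inner L (boundary L k) f = chain_inner L k (cobd L n f)"
proof -
  have "ip (cobd L n f) k = 1 / fact n * (\<Sum>p\<in>perms (n + 1). sgn_of p * ip (tail_act L (n + 1) p f) k)"
    unfolding cobd_def ip_scale_left using assms(1,2) assms(3)
    by (subst ip_sum_left)
      (auto simp: ip_scale_left l2_chains_iff intro!: ell2_scale tail_act_ell2[simplified])
  then have "ip k (cobd L n f) = cnj (1 / fact n * (\<Sum>p\<in>perms (n + 1). sgn_of p * ip (tail_act L (n + 1) p f) k))"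
    by (metis ip_cnj)
  also have "\<dots> = 1 / fact n * (\<Sum>p\<in>perms (n + 1). sgn_of p * ip k (tail_act L (n + 1) p f))"
    by (simp flip: ip_cnj)
  also have "(\<Sum>p\<in>perms (n + 1). sgn_of p * ip k (tail_act L (n + 1) p f)) =
      (\<Sum>p\<in>perms (n + 1). ip k (tail_act L (n + 1) id f))"
    using assms(1) by (intro sum.cong refl) (simp only: mem_Collect_eq ip_tail_act sgn_of_square(1))
  also have "1 / fact n * \<dots> = of_nat (n + 1) * ip (boundary L k) f"
    unfolding ip_boundary[OF assms] by (simp add: card_perms field_simps)
  finally have "ip k (cobd L n f) = of_nat (n + 1) * ip (boundary L k) f" .
  moreover have "chain_inner L (boundary L k) f = ip (boundary L k) f / fact n"
    using assms(3) by (intro chain_inner_eq) simp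
  moreover have "chain_inner L k (cobd L n f) = ip k (cobd L n f) / fact (n + 1)"
    using cobd_supported by (intro chain_inner_eq) blast
  moreover have "of_nat (n + 1) * ip (boundary L k) f / fact (n + 1) = ip (boundary L k) f / fact n"
    unfolding Suc_eq_plus1[symmetric] fact_Suc
    by (rule mult_divide_mult_cancel_left) (rule of_nat_neq_0)
  ultimately show ?thesis by (simp only:)
qed

text \<open>The description by \<open>THE\<close> is unique because a second adjoint value would
  differ from \<open>cobd\<close> by a chain orthogonal to itself.\<close>

lemma coboundary_eq:
  assumes "ell2 f" "chain_supported L n f"
  shows "coboundary L n f = cobd L n f"
  unfolding coboundary_def
proof (rule the_equality)
  show "cobd L n f \<in> l2_chains L n \<and>
    (\<forall>k\<in>l2_chains L n. chain_inner L (boundary L k) f = chain_inner L k (cobd L n f))"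
    using assms by (auto intro: cobd_l2_chains boundary_cobd_adjoint)
next
  fix h assume h: "h \<in> l2_chains L n \<and>
    (\<forall>k\<in>l2_chains L n. chain_inner L (boundary L k) f = chain_inner L k h)"
  let ?c = "cobd L n f"
  have c: "?c \<in> l2_chains L n" by (rule cobd_l2_chains[OF assms])
  let ?k = "\<lambda>xs. h xs - ?c xs"
  have k: "?k \<in> l2_chains L n" using h c by (intro l2_chains_diff) auto
  then have "chain_inner L ?k h = chain_inner L ?k ?c"
    using h boundary_cobd_adjoint[OF k assms] by simp
  moreover have "chain_inner L ?k g = ip ?k g / fact (n + 1)" for g
    using k by (intro chain_inner_eq) (simp add: l2_chains_iff)
  ultimately have "ip ?k h = ip ?k ?c" by (simp del: fact_Suc)
  then have "ip ?k ?k = 0"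
    using h c k by (simp add: ip_diff_right l2_chains_iff)
  then have "?k = (\<lambda>_. 0)" using nsq_eq_0[of ?k] k by (simp add: ip_self l2_chains_iff)
  then show "h = ?c" by (auto simp: fun_eq_iff)
qed

lemma boundary_zero: "boundary L (\<lambda>_. 0) = (\<lambda>_. 0)"
  by (simp add: boundary_def fun_eq_iff)

lemma cobd_zero: "cobd L n (\<lambda>_. 0) = (\<lambda>_. 0)"
  by (simp add: cobd_def tail_act_def fun_eq_iff)

lemma divide_cancel_fact:
  fixes X Y m :: complex
  assumes "X / fact k = Y / (m * fact k)"
  shows "X = Y / m"
  using assms by (cases "m = 0") (auto simp: field_simps)

text \<open>Pairing the Laplacian of \<open>f\<close> with \<open>f\<close> gives the squared norms
  of the coboundary and of the boundary with positive weights, so both vanish with it.\<close>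

lemma laplacian_eq_0_iff:
  assumes f: "f \<in> l2_chains L n"
  shows "laplacian L n f = (\<lambda>_. 0) \<longleftrightarrow> boundary L f = (\<lambda>_. 0) \<and> cobd L (n + 1) f = (\<lambda>_. 0)"
proof -
  have e: "ell2 f" "chain_supported L (n + 1) f" using f by (auto simp: l2_chains_iff)
  have b: "ell2 (boundary L f)" "chain_supported L n (boundary L f)"
    by (intro boundary_ell2 boundary_supported e)+
  have lap: "laplacian L n f = (\<lambda>xs. boundary L (cobd L (n + 1) f) xs + cobd L n (boundary L f) xs)"
    unfolding laplacian_def by (simp only: coboundary_eq[OF e] coboundary_eq[OF b])
  show ?thesis
  proof
    assume "boundary L f = (\<lambda>_. 0) \<and> cobd L (n + 1) f = (\<lambda>_. 0)"
    then show "laplacian L n f = (\<lambda>_. 0)"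
      unfolding lap by (simp only: boundary_zero cobd_zero add_0_left)
  next
    assume 0: "laplacian L n f = (\<lambda>_. 0)"
    have c: "cobd L (n + 1) f \<in> l2_chains L (n + 1)" "cobd L n (boundary L f) \<in> l2_chains L n"
      by (rule cobd_l2_chains, (rule e b)+)+
    have ec: "ell2 (cobd L (n + 1) f)" "ell2 (cobd L n (boundary L f))" using c by (auto simp: l2_chains_iff)
    have "ip (boundary L (cobd L (n + 1) f)) f + ip (cobd L n (boundary L f)) f = 0"
      using 0 ip_add_left[OF boundary_ell2[OF ec(1)] ec(2) e(1)] unfolding lap by (simp add: ip_zero)
    \<comment> \<open>The denominator n + 2 is the quotient of the factorials in the inner products
      of (n+1)-chains and of n-chains.\<close>
    moreover have "ip (boundary L (cobd L (n + 1) f)) f = of_real (nsq (cobd L (n + 1) f) / (of_nat n + 2))"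
    proof -
      have "chain_inner L (boundary L (cobd L (n + 1) f)) f = chain_inner L (cobd L (n + 1) f) (cobd L (n + 1) f)"
        by (rule boundary_cobd_adjoint[OF c(1) e])
      moreover have "chain_inner L (boundary L (cobd L (n + 1) f)) f = ip (boundary L (cobd L (n + 1) f)) f / fact (n + 1)"
        using e(2) by (intro chain_inner_eq) simp
      moreover have "chain_inner L (cobd L (n + 1) f) (cobd L (n + 1) f) =
          ip (cobd L (n + 1) f) (cobd L (n + 1) f) / fact (n + 1 + 1)"
        using cobd_supported[of L "n + 1" f] by (intro chain_inner_eq) simp
      ultimately have "ip (boundary L (cobd L (n + 1) f)) f / fact (n + 1) =
          ip (cobd L (n + 1) f) (cobd L (n + 1) f) / ((of_nat n + 2) * fact (n + 1))"
        by (simp add: algebra_simps)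
      then have "ip (boundary L (cobd L (n + 1) f)) f =
          ip (cobd L (n + 1) f) (cobd L (n + 1) f) / (of_nat n + 2)"
        by (rule divide_cancel_fact)
      then show ?thesis
        by (simp only: ip_self[OF ec(1)] of_real_divide of_real_add of_real_of_nat_eq of_real_numeral)
    qed
    moreover have "ip (cobd L n (boundary L f)) f = of_real (nsq (boundary L f) * (of_nat n + 1))"
    proof -
      have "chain_inner L (boundary L f) (boundary L f) = chain_inner L f (cobd L n (boundary L f))"
        by (rule boundary_cobd_adjoint[OF f b])
      moreover have "chain_inner L (boundary L f) (boundary L f) = ip (boundary L f) (boundary L f) / fact n"
        using b(2) by (intro chain_inner_eq) simp
      moreover have "chain_inner L f (cobd L n (boundary L f)) = ip f (cobd L n (boundary L f)) / fact (n + 1)"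
        using e(2) by (intro chain_inner_eq) simp
      ultimately have "ip (boundary L f) (boundary L f) / fact n =
          ip f (cobd L n (boundary L f)) / (of_nat (Suc n) * fact n)"
        by (simp add: algebra_simps)
      then have "ip (boundary L f) (boundary L f) = ip f (cobd L n (boundary L f)) / of_nat (Suc n)"
        by (rule divide_cancel_fact)
      then have "ip (boundary L f) (boundary L f) * of_nat (Suc n) = ip f (cobd L n (boundary L f))"
        by (metis nonzero_divide_eq_eq of_nat_neq_0)
      then have "ip f (cobd L n (boundary L f)) = of_real (nsq (boundary L f) * (of_nat n + 1))"
        by (simp add: ip_self[OF b(1)] add.commute)
      then show ?thesis by (subst ip_cnj) simp
    qed
    ultimately have "of_real (nsq (cobd L (n + 1) f) / (of_nat n + 2) + nsq (boundary L f) * (of_nat n + 1)) = (0 :: complex)"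
      by (simp only: of_real_add)
    then have sum0: "nsq (cobd L (n + 1) f) / (of_nat n + 2) + nsq (boundary L f) * (of_nat n + 1) = 0"
      by (simp only: of_real_eq_0_iff)
    have "nsq (cobd L (n + 1) f) / (of_nat n + 2) \<ge> 0" "nsq (boundary L f) * (of_nat n + 1) \<ge> 0"
      using nsq_nonneg by (auto intro!: divide_nonneg_nonneg mult_nonneg_nonneg)
    with sum0 have "nsq (cobd L (n + 1) f) / (of_nat n + 2) = 0" "nsq (boundary L f) * (of_nat n + 1) = 0"
      by linarith+
    then have "nsq (cobd L (n + 1) f) = 0" "nsq (boundary L f) = 0"
      by (auto simp: add_nonneg_eq_0_iff)
    then show "boundary L f = (\<lambda>_. 0) \<and> cobd L (n + 1) f = (\<lambda>_. 0)"
      using nsq_eq_0 ec(1) b(1) by blast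
  qed
qed

end

text \<open>By \<open>laplacian_eq_0_iff\<close> this is the kernel of the Laplacian for bounded
  degree. Written as equations with finitely many terms each, it can be transported between
  complexes and turned into orthogonality conditions.\<close>

definition harmonic :: "'v set set \<Rightarrow> nat \<Rightarrow> ('v list \<Rightarrow> complex) set" where
  "harmonic L n = {f \<in> l2_chains L n. boundary L f = (\<lambda>_. 0) \<and> cobd L (n + 1) f = (\<lambda>_. 0)}"

lemma harmonic_ell2: "f \<in> harmonic L n \<Longrightarrow> ell2 f"
  by (simp add: harmonic_def l2_chains_iff)

lemma oriented_simplex_alternating: "alternating (oriented_simplex xs)"
  unfolding alternating_def
proof (intro allI impI)
  fix ys :: "'a list" and q assume q: "q permutes {..<length ys}"
  show "oriented_simplex xs (permute_list q ys) = sgn_of q * oriented_simplex xs ys"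
  proof (cases "length ys = length xs")
    case False
    have "oriented_simplex xs zs = 0" if "length zs = length ys" for zs
      unfolding oriented_simplex_def using False that by (intro sum.neutral) auto
    then show ?thesis by simp
  next
    case True
    then have q': "q permutes {..<length xs}" using q by simp
    have "oriented_simplex xs (permute_list q ys) =
        (\<Sum>p | p permutes {..<length xs} \<and> ys = permute_list p xs. sgn_of (p \<circ> q))"
      unfolding oriented_simplex_def
    proof (rule sum.reindex_bij_witness[of _ "\<lambda>p. p \<circ> q" "\<lambda>p. p \<circ> inv_into UNIV q"])
      fix p assume p: "p \<in> {p. p permutes {..<length xs} \<and> permute_list q ys = permute_list p xs}"
      show "p \<circ> inv_into UNIV q \<circ> q = p" using permutes_inv_o[OF q'] by (simp add: comp_assoc)
      have "permute_list (p \<circ> inv_into UNIV q) xs = permute_list (inv_into UNIV q) (permute_list q ys)"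
        using p permutes_inv[OF q'] by (subst permute_list_compose) auto
      then show "p \<circ> inv_into UNIV q \<in> {p. p permutes {..<length xs} \<and> ys = permute_list p xs}"
        using p permutes_inv[OF q'] by (auto simp: permute_list_inv[OF q] intro: permutes_compose)
      show "sgn_of (p \<circ> inv_into UNIV q \<circ> q) = sgn_of p" using permutes_inv_o[OF q'] by (simp add: comp_assoc)
    next
      fix p assume p: "p \<in> {p. p permutes {..<length xs} \<and> ys = permute_list p xs}"
      show "p \<circ> q \<circ> inv_into UNIV q = p" using permutes_inv_o[OF q'] by (simp add: comp_assoc)
      show "p \<circ> q \<in> {p. p permutes {..<length xs} \<and> permute_list q ys = permute_list p xs}"
        using p q' by (auto simp: permute_list_compose intro: permutes_compose)
    qed
    also have "\<dots> = sgn_of q * oriented_simplex xs ys"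
      unfolding oriented_simplex_def sum_distrib_left
      using q' by (intro sum.cong refl) (auto simp: sign_compose permutes_permutation)
    finally show ?thesis .
  qed
qed

lemma oriented_simplex_support: "{ys. oriented_simplex xs ys \<noteq> 0} \<subseteq> (\<lambda>p. permute_list p xs) ` perms (length xs)"
proof safe
  fix ys assume "oriented_simplex xs ys \<noteq> 0"
  then have "{p. p permutes {..<length xs} \<and> ys = permute_list p xs} \<noteq> {}"
    by (auto simp: oriented_simplex_def simp del: Collect_empty_eq)
  then show "ys \<in> (\<lambda>p. permute_list p xs) ` perms (length xs)" by blast
qed

lemma oriented_simplex_fsupp: "fsupp (oriented_simplex xs)"
  by (rule finite_subset[OF oriented_simplex_support]) (simp add: card_perms)

lemma oriented_simplex_chain:
  assumes "xs \<in> ordered_simplices L" "length xs = n + 1"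
  shows "oriented_simplex xs \<in> l2_chains L n"
  unfolding l2_chains_iff
proof (intro conjI oriented_simplex_alternating ell2_fsupp oriented_simplex_fsupp)
  show "chain_supported L (n + 1) (oriented_simplex xs)"
    unfolding chain_supported_def
  proof (intro allI impI)
    fix ys assume "oriented_simplex xs ys \<noteq> 0"
    then obtain p where "p permutes {..<length xs}" "ys = permute_list p xs"
      using oriented_simplex_support by blast
    then show "ys \<in> ordered_simplices L \<and> length ys = n + 1"
      using assms by (simp add: permute_ordered_simplices)
  qed
qed

text \<open>Every ordering of the simplex contributes the same value, since the sign of
  \<open>f\<close> and that of the oriented simplex cancel. Thus oriented simplices represent
  evaluation.\<close>

lemma ip_oriented_simplex:
  assumes "alternating f"
  shows "ip f (oriented_simplex xs) = fact (length xs) * f xs"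
proof -
  let ?P = "perms (length xs)"
  let ?S = "(\<lambda>p. permute_list p xs) ` ?P"
  have os: "oriented_simplex xs ys = (\<Sum>p\<in>?P. if ys = permute_list p xs then sgn_of p else 0)" for ys
    unfolding oriented_simplex_def using card_perms(2)
    by (subst sum.inter_filter[symmetric]) (auto intro!: sum.cong)
  have "ip f (oriented_simplex xs) = (\<Sum>ys\<in>?S. f ys * cnj (oriented_simplex xs ys))"
    by (rule ip_fsupp) (use oriented_simplex_support card_perms(2) in blast)+
  also have "\<dots> = (\<Sum>p\<in>?P. \<Sum>ys\<in>?S. if ys = permute_list p xs then f ys * sgn_of p else 0)"
    unfolding os by (subst sum.swap) (auto simp: sum_distrib_left intro!: sum.cong)
  also have "\<dots> = (\<Sum>p\<in>?P. f (permute_list p xs) * sgn_of p)"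
    using card_perms(2) by (intro sum.cong refl) (simp add: sum.delta)
  also have "\<dots> = (\<Sum>p\<in>?P. f xs)"
  proof (rule sum.cong[OF refl])
    fix p assume "p \<in> ?P"
    then have "f (permute_list p xs) * sgn_of p = sgn_of p * (sgn_of p * f xs)"
      by (simp add: alternatingD[OF assms] mult.commute)
    then show "f (permute_list p xs) * sgn_of p = f xs" by (simp only: sgn_of_square(1))
  qed
  finally show ?thesis by (simp add: card_perms)
qed

lemma oriented_simplex_bound: "cmod (oriented_simplex xs ys) \<le> fact (length xs)"
proof -
  have "cmod (oriented_simplex xs ys) \<le> (\<Sum>p | p permutes {..<length xs} \<and> ys = permute_list p xs. 1)"
    unfolding oriented_simplex_def by (rule sum_norm_le) (auto simp: sign_def)
  also have "\<dots> \<le> real (card (perms (length xs)))"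
    using card_perms(2) by (simp add: card_mono Collect_mono)
  finally show ?thesis by (simp add: card_perms)
qed

lemma chain_inner_oriented_simplex:
  assumes "f \<in> l2_chains L n" "length xs = n + 1"
  shows "chain_inner L f (oriented_simplex xs) = f xs"
proof -
  have "chain_inner L f (oriented_simplex xs) = ip f (oriented_simplex xs) / fact (n + 1)"
    using assms(1) by (intro chain_inner_eq) (simp add: l2_chains_iff)
  also have "\<dots> = fact (n + 1) * f xs / fact (n + 1)"
    using assms by (simp only: l2_chains_iff ip_oriented_simplex)
  finally show ?thesis using fact_nonzero[of "n + 1", where ?'a = complex] by (simp del: fact_Suc)
qed

section \<open>Transport of harmonic chains\<close>

text \<open>Pullback along \<open>\<psi>\<close>, extended by zero outside \<open>W\<close>. One
  operation serves as restriction to a subcomplex, as extension by zero and as group action.\<close>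

definition transport :: "'v set set \<Rightarrow> 'v set \<Rightarrow> ('v \<Rightarrow> 'w) \<Rightarrow> ('w list \<Rightarrow> complex) \<Rightarrow> 'v list \<Rightarrow> complex" where
  "transport M W \<psi> f = (\<lambda>xs. if xs \<in> ordered_simplices M \<and> set xs \<subseteq> W then f (map \<psi> xs) else 0)"

text \<open>By the last two assumptions no simplex lies partly inside \<open>W\<close> or partly
  inside its image. Hence extension by zero respects boundary and coboundary.\<close>

locale component_map =
  fixes M :: "'v set set" and L :: "'w set set" and W :: "'v set" and \<psi> :: "'v \<Rightarrow> 'w"
  assumes complexes: "simplicial_complex M" "simplicial_complex L"
    and inj: "inj_on \<psi> W"
    and image: "\<And>\<sigma>. \<sigma> \<in> M \<Longrightarrow> \<sigma> \<inter> W \<noteq> {} \<Longrightarrow> \<sigma> \<subseteq> W \<and> \<psi> ` \<sigma> \<in> L"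
    and preimage: "\<And>\<tau>. \<tau> \<in> L \<Longrightarrow> \<tau> \<inter> \<psi> ` W \<noteq> {} \<Longrightarrow> \<exists>\<sigma>\<in>M. \<sigma> \<subseteq> W \<and> \<tau> = \<psi> ` \<sigma>"
begin

lemma Nil_notin: "[] \<notin> ordered_simplices M" "[] \<notin> ordered_simplices L"
  using complexes by (auto simp: ordered_simplices_def simplicial_complex_def)

lemma meets_imp_subset: "xs \<in> ordered_simplices M \<Longrightarrow> set xs \<inter> W \<noteq> {} \<Longrightarrow> set xs \<subseteq> W"
  using image by (auto simp: ordered_simplices_def)

lemma map_ordered:
  assumes "xs \<in> ordered_simplices M" "set xs \<subseteq> W"
  shows "map \<psi> xs \<in> ordered_simplices L"
proof -
  have "set xs \<in> M" "distinct xs" using assms by (auto simp: ordered_simplices_def)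
  moreover have "set xs \<inter> W \<noteq> {}" using assms Nil_notin by (cases xs) auto
  moreover have "inj_on \<psi> (set xs)" using inj assms(2) by (rule inj_on_subset)
  ultimately show ?thesis
    using image[of "set xs"] by (simp add: ordered_simplices_def distinct_map)
qed

lemma ordered_preimage:
  assumes "zs \<in> ordered_simplices L" "set zs \<inter> \<psi> ` W \<noteq> {}"
  obtains xs where "xs \<in> ordered_simplices M" "set xs \<subseteq> W" "zs = map \<psi> xs"
proof -
  obtain \<sigma> where s: "\<sigma> \<in> M" "\<sigma> \<subseteq> W" "set zs = \<psi> ` \<sigma>"
    using preimage[of "set zs"] assms by (auto simp: ordered_simplices_def)
  let ?xs = "map (inv_into W \<psi>) zs"
  have zs: "zs = map \<psi> ?xs"
  proof -
    have "\<psi> (inv_into W \<psi> z) = z" if "z \<in> set zs" for z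
      using that s by (intro f_inv_into_f) auto
    then show ?thesis by (simp add: map_idI)
  qed
  have "inv_into W \<psi> (\<psi> v) = v" if "v \<in> \<sigma>" for v
    using that s by (intro inv_into_f_f[OF inj]) auto
  then have "set ?xs = \<sigma>" by (simp add: s(3) image_image)
  moreover have "distinct zs" using assms by (simp add: ordered_simplices_def)
  then have "distinct ?xs"
    by (simp add: distinct_map inj_on_inv_into s image_mono)
  ultimately show ?thesis
    using s(1,2) by (intro that[of ?xs, OF _ _ zs]) (simp_all add: ordered_simplices_def)
qed

lemma inj_map: "inj_on (map \<psi>) {xs. set xs \<subseteq> W}"
proof (rule inj_onI)
  fix xs ys assume "xs \<in> {xs. set xs \<subseteq> W}" "ys \<in> {xs. set xs \<subseteq> W}" "map \<psi> xs = map \<psi> ys"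
  moreover from this have "inj_on \<psi> (set xs \<union> set ys)" by (intro inj_on_subset[OF inj]) auto
  ultimately show "xs = ys" by (simp add: inj_on_map_eq_map)
qed

lemma transport_l2_chains:
  assumes f: "f \<in> l2_chains L n"
  shows "transport M W \<psi> f \<in> l2_chains M n"
  unfolding l2_chains_iff
proof (intro conjI)
  show "chain_supported M (n + 1) (transport M W \<psi> f)"
    unfolding chain_supported_def
  proof (intro allI impI)
    fix xs assume "transport M W \<psi> f xs \<noteq> 0"
    then have "xs \<in> ordered_simplices M" "f (map \<psi> xs) \<noteq> 0" by (auto simp: transport_def split: if_splits)
    then show "xs \<in> ordered_simplices M \<and> length xs = n + 1"
      using f unfolding l2_chains_iff chain_supported_def by (metis length_map)
  qed
  show "alternating (transport M W \<psi> f)"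
    unfolding alternating_def
  proof (intro allI impI)
    fix xs :: "'v list" and p assume p: "p permutes {..<length xs}"
    then have "f (map \<psi> (permute_list p xs)) = sgn_of p * f (map \<psi> xs)"
      using f by (simp add: l2_chains_iff alternatingD flip: permute_list_map)
    then show "transport M W \<psi> f (permute_list p xs) = sgn_of p * transport M W \<psi> f xs"
      using p by (simp add: transport_def permute_ordered_simplices)
  qed
  let ?X = "{xs \<in> ordered_simplices M. set xs \<subseteq> W}"
  have inj: "inj_on (map \<psi>) ?X" by (rule inj_on_subset[OF inj_map]) auto
  have "(\<lambda>xs. (cmod (f xs))\<^sup>2) summable_on (map \<psi> ` ?X)"
    using f by (auto simp: l2_chains_iff ell2_def elim: summable_on_subset)
  then have "(\<lambda>xs. (cmod (f (map \<psi> xs)))\<^sup>2) summable_on ?X"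
    by (subst (asm) summable_on_reindex[OF inj]) (simp add: o_def)
  then show "ell2 (transport M W \<psi> f)"
    unfolding ell2_def
    by (rule summable_on_cong_neutral[THEN iffD1, rotated -1]) (auto simp: transport_def)
qed

text \<open>For a list inside \<open>W\<close> its extensions by one vertex correspond bijectively
  under \<open>\<psi>\<close>; for any other list all terms are zero.\<close>

lemma transport_boundary:
  assumes "boundary L f = (\<lambda>_. 0)"
  shows "boundary M (transport M W \<psi> f) = (\<lambda>_. 0)"
proof
  fix ys
  show "boundary M (transport M W \<psi> f) ys = 0"
  proof (cases "ys \<in> ordered_simplices M \<and> set ys \<subseteq> W")
    case False
    then show ?thesis by (auto simp: boundary_def transport_def intro!: sum.neutral)
  next
    case True
    then have "ys \<noteq> []" using Nil_notin by auto
    then have meets: "set ys \<inter> W \<noteq> {}" using True by (cases ys) auto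
    have vW: "v \<in> W" if "v # ys \<in> ordered_simplices M" for v
      using meets_imp_subset[OF that] meets by auto
    have bij: "bij_betw \<psi> {v. v # ys \<in> ordered_simplices M} {w. w # map \<psi> ys \<in> ordered_simplices L}"
      unfolding bij_betw_def
    proof safe
      show "inj_on \<psi> {v. v # ys \<in> ordered_simplices M}" using vW by (intro inj_on_subset[OF inj]) auto
      show "\<psi> v # map \<psi> ys \<in> ordered_simplices L" if "v # ys \<in> ordered_simplices M" for v
        using map_ordered[OF that] vW[OF that] True by simp
    next
      fix w assume w: "w # map \<psi> ys \<in> ordered_simplices L"
      have "set (w # map \<psi> ys) \<inter> \<psi> ` W \<noteq> {}" using meets by auto
      then obtain zs where zs: "zs \<in> ordered_simplices M" "set zs \<subseteq> W" "w # map \<psi> ys = map \<psi> zs"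
        using ordered_preimage[OF w] by metis
      then obtain v vs where v: "zs = v # vs" "w = \<psi> v" "map \<psi> ys = map \<psi> vs" by (cases zs) auto
      then have "ys = vs" using inj_map True zs(2) by (auto simp: inj_on_def)
      then show "w \<in> \<psi> ` {v. v # ys \<in> ordered_simplices M}" using zs v by auto
    qed
    have "boundary M (transport M W \<psi> f) ys = (\<Sum>v | v # ys \<in> ordered_simplices M. f (\<psi> v # map \<psi> ys))"
      using True vW by (auto simp: boundary_def transport_def intro!: sum.cong)
    also have "\<dots> = (\<Sum>w | w # map \<psi> ys \<in> ordered_simplices L. f (w # map \<psi> ys))"
      by (rule sum.reindex_bij_betw[OF bij])
    also have "\<dots> = boundary L f (map \<psi> ys)"
      using map_ordered[of ys] True by (simp add: boundary_def)
    finally show ?thesis by (simp add: assms)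
  qed
qed

lemma transport_cobd:
  assumes "cobd L (n + 1) f = (\<lambda>_. 0)"
  shows "cobd M (n + 1) (transport M W \<psi> f) = (\<lambda>_. 0)"
proof
  fix xs
  show "cobd M (n + 1) (transport M W \<psi> f) xs = 0"
  proof (cases "xs \<in> ordered_simplices M \<and> length xs = n + 1 + 1")
    case False
    then show ?thesis by (auto simp: cobd_def tail_act_def)
  next
    case xs: True
    have tl: "tl (permute_list p xs) \<noteq> []" "set (tl (permute_list p xs)) \<subseteq> set xs"
      "tl (permute_list p xs) \<in> ordered_simplices M" if p: "p permutes {..<n + 1 + 1}" for p
    proof -
      have pxs: "permute_list p xs \<in> ordered_simplices M" "length (permute_list p xs) = n + 1 + 1"
        using xs p permute_ordered_simplices[of p xs M] by auto
      then obtain v vs where v: "permute_list p xs = v # vs" by (cases "permute_list p xs") auto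
      then show ne: "tl (permute_list p xs) \<noteq> []" using pxs by auto
      show "set (tl (permute_list p xs)) \<subseteq> set xs"
        using set_permute_list[of p xs] xs p v by (metis list.sel(3) set_subset_Cons)
      show "tl (permute_list p xs) \<in> ordered_simplices M"
        using pxs ne v complexes(1) unfolding ordered_simplices_def simplicial_complex_def
        by (auto simp: subset_insertI)
    qed
    show ?thesis
    proof (cases "set xs \<subseteq> W")
      case False
      \<comment> \<open>A simplex not contained in \<open>W\<close> misses it altogether, so
        deleting a vertex cannot lead into \<open>W\<close>.\<close>
      then have "set xs \<inter> W = {}" using meets_imp_subset xs by blast
      then have "transport M W \<psi> f (tl (permute_list p xs)) = 0" if "p permutes {..<n + 1 + 1}" for p
        using tl(1,2)[OF that] by (cases "tl (permute_list p xs)") (auto simp: transport_def)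
      then show ?thesis unfolding cobd_def by (auto simp: tail_act_def intro!: sum.neutral)
    next
      case True
      have "tail_act M (n + 1 + 1) p (transport M W \<psi> f) xs = tail_act L (n + 1 + 1) p f (map \<psi> xs)"
        if p: "p permutes {..<n + 1 + 1}" for p
      proof -
        have "map \<psi> (tl (permute_list p xs)) = tl (permute_list p (map \<psi> xs))"
          using p xs by (simp add: permute_list_map map_tl)
        then show ?thesis
          using tl[OF p] xs True map_ordered[of xs] by (auto simp: tail_act_def transport_def)
      qed
      then have "cobd M (n + 1) (transport M W \<psi> f) xs = cobd L (n + 1) f (map \<psi> xs)"
        by (simp add: cobd_def)
      then show ?thesis by (simp only: assms)
    qed
  qed
qed

lemma transport_harmonic: "f \<in> harmonic L n \<Longrightarrow> transport M W \<psi> f \<in> harmonic M n"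
  by (auto simp: harmonic_def transport_l2_chains transport_boundary intro: transport_cobd[simplified])

end

text \<open>Here \<open>L\<close> as a whole is placed in \<open>M\<close> as a union of components.
  \<open>pull\<close> restricts to the copy and \<open>push\<close> extends by zero.\<close>

locale component_embedding =
  fixes L :: "'w set set" and M :: "'v set set" and \<phi> :: "'w \<Rightarrow> 'v"
  assumes cmap: "component_map L M (\<Union>L) \<phi>"
begin

sublocale component_map L M "\<Union>L" \<phi> by (rule cmap)

abbreviation pull :: "('v list \<Rightarrow> complex) \<Rightarrow> 'w list \<Rightarrow> complex" where
  "pull \<equiv> transport L (\<Union>L) \<phi>"

abbreviation push :: "('w list \<Rightarrow> complex) \<Rightarrow> 'v list \<Rightarrow> complex" where
  "push \<equiv> transport M (\<phi> ` \<Union>L) (inv_into (\<Union>L) \<phi>)"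

lemma ordered_subset: "xs \<in> ordered_simplices L \<Longrightarrow> set xs \<subseteq> \<Union>L"
  by (auto simp: ordered_simplices_def)

lemma simplex_image:
  assumes "\<sigma> \<in> L"
  shows "\<phi> ` \<sigma> \<in> M"
proof -
  have "\<sigma> \<noteq> {}" using complexes(1) assms by (auto simp: simplicial_complex_def)
  then have "\<sigma> \<inter> \<Union>L \<noteq> {}" using assms by blast
  then show ?thesis using image assms by blast
qed

lemma inv_image:
  assumes "\<sigma> \<in> L"
  shows "inv_into (\<Union>L) \<phi> ` \<phi> ` \<sigma> = \<sigma>"
proof -
  have "inv_into (\<Union>L) \<phi> (\<phi> v) = v" if "v \<in> \<sigma>" for v
    using that assms by (intro inv_into_f_f[OF inj]) auto
  then show ?thesis by (simp add: image_image)
qed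

lemma map_inv: "xs \<in> ordered_simplices L \<Longrightarrow> map (inv_into (\<Union>L) \<phi>) (map \<phi> xs) = xs"
  using inj ordered_subset by (auto intro!: map_idI simp: inv_into_f_f subset_iff)

text \<open>The inverse on the image satisfies the same axioms, so \<open>push\<close> is also a
  transport and preserves harmonic chains without a second proof.\<close>

lemma component_map_inv: "component_map M L (\<phi> ` \<Union>L) (inv_into (\<Union>L) \<phi>)"
proof
  show "simplicial_complex M" "simplicial_complex L" by (rule complexes)+
  show "inj_on (inv_into (\<Union>L) \<phi>) (\<phi> ` \<Union>L)" by (rule inj_on_inv_into) simp
next
  fix \<tau> assume t: "\<tau> \<in> M" "\<tau> \<inter> \<phi> ` \<Union>L \<noteq> {}"
  then obtain \<sigma> where s: "\<sigma> \<in> L" "\<tau> = \<phi> ` \<sigma>" using preimage by blast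
  then show "\<tau> \<subseteq> \<phi> ` \<Union>L \<and> inv_into (\<Union>L) \<phi> ` \<tau> \<in> L" by (auto simp: inv_image)
next
  fix \<sigma> assume s: "\<sigma> \<in> L"
  then show "\<exists>\<tau>\<in>M. \<tau> \<subseteq> \<phi> ` \<Union>L \<and> \<sigma> = inv_into (\<Union>L) \<phi> ` \<tau>"
    by (intro bexI[of _ "\<phi> ` \<sigma>"]) (auto simp: inv_image simplex_image)
qed

lemma push_harmonic: "f \<in> harmonic L n \<Longrightarrow> push f \<in> harmonic M n"
  by (rule component_map.transport_harmonic[OF component_map_inv])

lemma push_map: "xs \<in> ordered_simplices L \<Longrightarrow> push f (map \<phi> xs) = f xs"
  using map_ordered[of xs] ordered_subset[of xs] map_inv[of xs]
  by (auto simp: transport_def simp del: map_map)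

lemma push_support:
  assumes "push f ys \<noteq> 0"
  obtains xs where "xs \<in> ordered_simplices L" "ys = map \<phi> xs"
proof -
  have ys: "ys \<in> ordered_simplices M" "set ys \<subseteq> \<phi> ` \<Union>L"
    using assms by (auto simp: transport_def split: if_splits)
  moreover have "ys \<noteq> []" using ys Nil_notin by auto
  ultimately have "set ys \<inter> \<phi> ` \<Union>L \<noteq> {}" by (cases ys) auto
  from ordered_preimage[OF ys(1) this] that show ?thesis by metis
qed

text \<open>\<open>push a\<close> vanishes off the copy, so both sides are sums over the ordered
  simplices of \<open>L\<close>.\<close>

lemma ip_push:
  assumes "chain_supported L m a"
  shows "ip (push a) f = ip a (pull f)"
proof -
  let ?O = "ordered_simplices L"
  have inj: "inj_on (map \<phi>) ?O" using ordered_subset by (intro inj_on_subset[OF inj_map]) auto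
  have "ip (push a) f = (\<Sum>\<^sub>\<infinity>ys\<in>map \<phi> ` ?O. push a ys * cnj (f ys))"
    unfolding ip_def by (rule infsum_cong_neutral) (auto elim: push_support)
  also have "\<dots> = (\<Sum>\<^sub>\<infinity>xs\<in>?O. push a (map \<phi> xs) * cnj (f (map \<phi> xs)))"
    by (subst infsum_reindex[OF inj]) (simp add: o_def)
  also have "\<dots> = (\<Sum>\<^sub>\<infinity>xs\<in>?O. a xs * cnj (pull f xs))"
  proof (rule infsum_cong)
    fix xs assume xs: "xs \<in> ?O"
    then show "push a (map \<phi> xs) * cnj (f (map \<phi> xs)) = a xs * cnj (pull f xs)"
      using ordered_subset[OF xs] by (simp only: push_map[OF xs]) (simp add: transport_def)
  qed
  also have "\<dots> = ip a (pull f)"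
    unfolding ip_def by (rule infsum_cong_neutral) (use assms in \<open>auto simp: chain_supported_def\<close>)
  finally show ?thesis .
qed

lemma push_oriented_simplex:
  assumes "xs \<in> ordered_simplices L"
  shows "push (oriented_simplex xs) = oriented_simplex (map \<phi> xs)"
proof
  fix ys
  have perm: "permute_list p (map \<phi> xs) = map \<phi> (permute_list p xs)" "permute_list p xs \<in> ordered_simplices L"
    if "p permutes {..<length xs}" for p
    using that assms by (auto simp: permute_list_map permute_ordered_simplices)
  show "push (oriented_simplex xs) ys = oriented_simplex (map \<phi> xs) ys"
  proof (cases "\<exists>zs\<in>ordered_simplices L. ys = map \<phi> zs")
    case True
    then obtain zs where zs: "zs \<in> ordered_simplices L" "ys = map \<phi> zs" by blast
    have "map \<phi> zs = permute_list p (map \<phi> xs) \<longleftrightarrow> zs = permute_list p xs"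
      if "p permutes {..<length xs}" for p
      unfolding perm(1)[OF that]
      using inj_onD[OF inj_map, of zs "permute_list p xs"] ordered_subset[OF zs(1)] ordered_subset[OF perm(2)[OF that]]
      by auto
    then have "oriented_simplex (map \<phi> xs) ys = oriented_simplex xs zs"
      unfolding oriented_simplex_def zs(2) by (intro sum.cong) auto
    then show ?thesis using zs push_map by simp
  next
    case False
    then have "push (oriented_simplex xs) ys = 0" by (metis push_support)
    moreover have "oriented_simplex (map \<phi> xs) ys = 0"
      unfolding oriented_simplex_def using False perm by (intro sum.neutral) auto
    ultimately show ?thesis by simp
  qed
qed

end

lemma harmonic_sum:
  assumes "\<And>y. y \<in> F \<Longrightarrow> f y \<in> harmonic L n"
  shows "(\<lambda>xs. \<Sum>y\<in>F. a y * f y xs) \<in> harmonic L n"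
proof -
  have "(\<lambda>xs. \<Sum>y\<in>F. a y * f y xs) \<in> l2_chains L n"
    using assms by (intro l2_chains_sum l2_chains_scale) (simp add: harmonic_def)
  moreover have "boundary L (\<lambda>xs. \<Sum>y\<in>F. a y * f y xs) ys = (\<Sum>y\<in>F. a y * boundary L (f y) ys)" for ys
    by (auto simp: boundary_def sum_distrib_left intro: sum.swap)
  moreover have "cobd L (n + 1) (\<lambda>xs. \<Sum>y\<in>F. a y * f y xs) xs = (\<Sum>y\<in>F. a y * cobd L (n + 1) (f y) xs)" for xs
  proof -
    have "tail_act L (n + 1 + 1) p (\<lambda>xs. \<Sum>y\<in>F. a y * f y xs) xs =
        (\<Sum>y\<in>F. a y * tail_act L (n + 1 + 1) p (f y) xs)" for p
      by (cases "xs \<in> ordered_simplices L \<and> length xs = n + 1 + 1") (auto simp: tail_act_def)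
    then have "cobd L (n + 1) (\<lambda>xs. \<Sum>y\<in>F. a y * f y xs) xs =
      (\<Sum>p\<in>perms (n + 1 + 1). \<Sum>y\<in>F. 1 / fact (n + 1) * (sgn_of p * (a y * tail_act L (n + 1 + 1) p (f y) xs)))"
      unfolding cobd_def by (simp only: sum_distrib_left)
    also have "\<dots> = (\<Sum>y\<in>F. \<Sum>p\<in>perms (n + 1 + 1). 1 / fact (n + 1) * (sgn_of p * (a y * tail_act L (n + 1 + 1) p (f y) xs)))"
      by (rule sum.swap)
    also have "\<dots> = (\<Sum>y\<in>F. a y * cobd L (n + 1) (f y) xs)"
      unfolding cobd_def sum_distrib_left by (intro sum.cong refl) (simp only: mult_ac)
    finally show ?thesis .
  qed
  ultimately show ?thesis
    using assms unfolding harmonic_def by (auto simp: fun_eq_iff)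
qed

lemma harmonic_diff: "f \<in> harmonic L n \<Longrightarrow> h \<in> harmonic L n \<Longrightarrow> (\<lambda>xs. f xs - h xs) \<in> harmonic L n"
  using harmonic_sum[of "{True, False}" "\<lambda>b. if b then f else h" L n "\<lambda>b. if b then 1 else -1"] by simp

section \<open>Isotypic harmonic chains\<close>

text \<open>The coefficients stay abstract: characters enter for \<open>G\<close>, while \<kappa> =
  1 on the trivial group gives the identity on harmonic chains.\<close>

definition isoproj :: "'g monoid \<Rightarrow> ('g \<Rightarrow> complex) \<Rightarrow> ('g, 'x) chain \<Rightarrow> ('g, 'x) chain" where
  "isoproj G \<kappa> f = (\<lambda>xs. \<Sum>g\<in>carrier G. \<kappa> g * chain_act G g f xs)"

text \<open>Fixed chains instead of the image: for an idempotent these agree, and being fixed is a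
  linear equation on the chain.\<close>

definition iso_harmonic :: "'g monoid \<Rightarrow> ('g \<Rightarrow> complex) \<Rightarrow> ('g, 'x) nvert set set \<Rightarrow> nat \<Rightarrow> ('g, 'x) chain set" where
  "iso_harmonic G \<kappa> M n = {f \<in> harmonic M n. isoproj G \<kappa> f = f}"

section \<open>The group action on vertices and on harmonic chains\<close>

locale orbit_system = group G for G :: "'g monoid" (structure) +
  fixes Orb :: "('g, 'x) gset set"
  assumes finite_carrier: "finite (carrier G)"
    and transitive: "\<And>X. X \<in> Orb \<Longrightarrow> transitive_gset G X"
begin

lemma gset_action: "X \<in> Orb \<Longrightarrow> group_action G (fst X) (snd X)"
  using transitive by (auto simp: transitive_gset_def transitive_action_def)

lemma NG_act_one: "v \<in> NG Orb \<Longrightarrow> NG_act \<one> v = v"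
  using group_action.id_eq_one[OF gset_action]
  by (auto simp: NG_def NG_act_def) (metis restrict_apply')

lemma NG_act_mult:
  assumes "v \<in> NG Orb" "g \<in> carrier G" "h \<in> carrier G"
  shows "NG_act (g \<otimes> h) v = NG_act g (NG_act h v)"
proof -
  obtain k X x where v: "v = (k, X, x)" by (cases v)
  then have X: "X \<in> Orb" "x \<in> fst X" using assms(1) by (auto simp: NG_def)
  have "snd X h x \<in> fst X" using group_action.element_image[OF gset_action[OF X(1)] assms(3) X(2) refl] .
  then show ?thesis
    using group_action.composition_rule[OF gset_action[OF X(1)] X(2) assms(2,3)] X(2) by (simp add: v NG_act_def)
qed

lemma NG_act_NG: "v \<in> NG Orb \<Longrightarrow> g \<in> carrier G \<Longrightarrow> NG_act g v \<in> NG Orb"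
  using group_action.element_image[OF gset_action] by (auto simp: NG_def NG_act_def)

lemma NG_act_NG_iff: "g \<in> carrier G \<Longrightarrow> NG_act g v \<in> NG Orb \<longleftrightarrow> v \<in> NG Orb"
  using NG_act_NG by (auto simp: NG_def NG_act_def split: if_splits prod.splits)

lemma NG_act_inv:
  assumes "v \<in> NG Orb" "g \<in> carrier G"
  shows "NG_act (inv g) (NG_act g v) = v" "NG_act g (NG_act (inv g) v) = v"
  using assms by (simp_all add: NG_act_one flip: NG_act_mult)

end

locale orbit_complex = orbit_system G Orb for G :: "'g monoid" (structure) and Orb :: "('g, 'x) gset set" +
  fixes M :: "('g, 'x) nvert set set"
  assumes complex: "simplicial_complex M"
    and vertices: "\<Union>M \<subseteq> NG Orb"
    and invariant: "\<And>g s. g \<in> carrier G \<Longrightarrow> s \<in> M \<Longrightarrow> NG_act g ` s \<in> M"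
begin

lemma ordered_vertices: "xs \<in> ordered_simplices M \<Longrightarrow> set xs \<subseteq> NG Orb"
  using vertices by (auto simp: ordered_simplices_def)

lemma inj_NG_act: "g \<in> carrier G \<Longrightarrow> inj_on (NG_act g) (NG Orb)"
  by (rule inj_on_inverseI[of _ "NG_act (inv g)"]) (simp add: NG_act_inv)

lemma component_map_act:
  assumes g: "g \<in> carrier G"
  shows "component_map M M (\<Union>M) (NG_act g)"
proof
  show "inj_on (NG_act g) (\<Union>M)" using inj_NG_act[OF g] vertices by (rule inj_on_subset)
next
  fix \<tau> assume t: "\<tau> \<in> M"
  then have "\<tau> \<subseteq> NG Orb" using vertices by auto
  then have "NG_act g ` NG_act (inv g) ` \<tau> = \<tau>" using g by (force simp: image_image NG_act_inv subset_iff)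
  then show "\<exists>\<sigma>\<in>M. \<sigma> \<subseteq> \<Union>M \<and> \<tau> = NG_act g ` \<sigma>"
    using t g invariant[of "inv g" \<tau>] by (intro bexI[of _ "NG_act (inv g) ` \<tau>"]) auto
qed (use complex g invariant in auto)

lemma map_act_NG:
  assumes "set xs \<subseteq> NG Orb" "g \<in> carrier G"
  shows "map (NG_act (inv g)) (map (NG_act g) xs) = xs" "map (NG_act g) (map (NG_act (inv g)) xs) = xs"
  using assms by (auto intro!: map_idI simp: NG_act_inv subset_iff)

lemma map_act_ordered:
  assumes "xs \<in> ordered_simplices M" "g \<in> carrier G"
  shows "map (NG_act g) xs \<in> ordered_simplices M"
  using component_map.map_ordered[OF component_map_act[OF assms(2)] assms(1)] assms(1)
  by (auto simp: ordered_simplices_def)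

text \<open>\<open>NG_act\<close> fixes everything off \<open>NG Orb\<close>, so a list with a
  foreign vertex cannot be moved into the complex.\<close>

lemma map_act_ordered_iff:
  assumes g: "g \<in> carrier G"
  shows "map (NG_act g) xs \<in> ordered_simplices M \<longleftrightarrow> xs \<in> ordered_simplices M"
proof
  assume *: "map (NG_act g) xs \<in> ordered_simplices M"
  then have "set xs \<subseteq> NG Orb" using ordered_vertices NG_act_NG_iff[OF g] by fastforce
  from map_act_NG(1)[OF this g] map_act_ordered[OF * inv_closed[OF g]]
  show "xs \<in> ordered_simplices M" by simp
qed (rule map_act_ordered[OF _ g])

text \<open>As a transport along an automorphism, the action preserves harmonic chains by the
  general result.\<close>

lemma chain_act_transport:
  assumes "chain_supported M m f" and g: "g \<in> carrier G"
  shows "chain_act G g f = transport M (\<Union>M) (NG_act (inv g)) f"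
proof
  fix xs
  show "chain_act G g f xs = transport M (\<Union>M) (NG_act (inv g)) f xs"
  proof (cases "xs \<in> ordered_simplices M")
    case True
    then have "set xs \<subseteq> \<Union>M" by (auto simp: ordered_simplices_def)
    then show ?thesis using True by (simp add: chain_act_def transport_def)
  next
    case False
    then have "f (map (NG_act (inv g)) xs) = 0"
      using assms(1) map_act_ordered_iff[OF inv_closed[OF g]] by (auto simp: chain_supported_def)
    then show ?thesis using False by (simp add: chain_act_def transport_def)
  qed
qed

lemma harmonic_supported: "f \<in> harmonic M n \<Longrightarrow> chain_supported M (n + 1) f"
  by (simp add: harmonic_def l2_chains_iff)

lemma chain_act_harmonic:
  assumes "f \<in> harmonic M n" "g \<in> carrier G"
  shows "chain_act G g f \<in> harmonic M n"
  unfolding chain_act_transport[OF harmonic_supported[OF assms(1)] assms(2)]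
  using component_map.transport_harmonic[OF component_map_act[OF inv_closed[OF assms(2)]] assms(1)] .

lemma isoproj_harmonic: "f \<in> harmonic M n \<Longrightarrow> isoproj G \<kappa> f \<in> harmonic M n"
  unfolding isoproj_def by (intro harmonic_sum chain_act_harmonic)

lemma chain_act_mult:
  assumes "g \<in> carrier G" "h \<in> carrier G" "set xs \<subseteq> NG Orb"
  shows "chain_act G g (chain_act G h f) xs = chain_act G (g \<otimes> h) f xs"
proof -
  have "map (NG_act (inv h)) (map (NG_act (inv g)) xs) = map (NG_act (inv (g \<otimes> h))) xs"
    using assms by (auto simp: inv_mult_group NG_act_mult subset_iff)
  then show ?thesis by (simp add: chain_act_def del: map_map)
qed

text \<open>Composing two such operators convolves their coefficients, and \<kappa> is its own
  convolution square.\<close>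

lemma isoproj_idem:
  assumes conv: "\<And>k. k \<in> carrier G \<Longrightarrow> (\<Sum>g\<in>carrier G. \<kappa> g * \<kappa> (inv g \<otimes> k)) = \<kappa> k"
    and f: "f \<in> harmonic M n"
  shows "isoproj G \<kappa> (isoproj G \<kappa> f) = isoproj G \<kappa> f"
proof
  fix xs
  show "isoproj G \<kappa> (isoproj G \<kappa> f) xs = isoproj G \<kappa> f xs"
  proof (cases "xs \<in> ordered_simplices M")
    \<comment> \<open>The action law holds only for lists over \<open>NG Orb\<close>; off the
      complex both sides are zero.\<close>
    case False
    have "isoproj G \<kappa> f \<in> harmonic M n" "isoproj G \<kappa> (isoproj G \<kappa> f) \<in> harmonic M n"
      by (intro isoproj_harmonic f)+
    then have "isoproj G \<kappa> f xs = 0" "isoproj G \<kappa> (isoproj G \<kappa> f) xs = 0"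
      using False harmonic_supported unfolding chain_supported_def by blast+
    then show ?thesis by simp
  next
    case True
    then have xs: "set xs \<subseteq> NG Orb" by (rule ordered_vertices)
    have "isoproj G \<kappa> (isoproj G \<kappa> f) xs =
      (\<Sum>g\<in>carrier G. \<Sum>h\<in>carrier G. \<kappa> g * \<kappa> h * chain_act G g (chain_act G h f) xs)"
      unfolding isoproj_def by (simp add: chain_act_def sum_distrib_left mult.assoc)
    also have "\<dots> = (\<Sum>g\<in>carrier G. \<Sum>h\<in>carrier G. \<kappa> g * \<kappa> (inv g \<otimes> (g \<otimes> h)) * chain_act G (g \<otimes> h) f xs)"
      using xs by (intro sum.cong refl) (simp add: chain_act_mult flip: m_assoc)
    also have "\<dots> = (\<Sum>g\<in>carrier G. \<Sum>k\<in>carrier G. \<kappa> g * \<kappa> (inv g \<otimes> k) * chain_act G k f xs)"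
    proof (rule sum.cong[OF refl])
      fix g assume "g \<in> carrier G"
      then show "(\<Sum>h\<in>carrier G. \<kappa> g * \<kappa> (inv g \<otimes> (g \<otimes> h)) * chain_act G (g \<otimes> h) f xs) =
          (\<Sum>k\<in>carrier G. \<kappa> g * \<kappa> (inv g \<otimes> k) * chain_act G k f xs)"
        by (rule sum_carrier_mult_left[where f = "\<lambda>k. \<kappa> g * \<kappa> (inv g \<otimes> k) * chain_act G k f xs"])
    qed
    also have "\<dots> = (\<Sum>k\<in>carrier G. \<Sum>g\<in>carrier G. \<kappa> g * \<kappa> (inv g \<otimes> k) * chain_act G k f xs)"
      by (rule sum.swap)
    also have "\<dots> = (\<Sum>k\<in>carrier G. \<kappa> k * chain_act G k f xs)"
      by (intro sum.cong refl) (simp add: conv flip: sum_distrib_right)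
    finally show ?thesis by (simp add: isoproj_def)
  qed
qed

lemma ip_chain_act:
  assumes a: "chain_supported M m a" and g: "g \<in> carrier G"
  shows "ip (chain_act G g a) f = ip a (chain_act G (inv g) f)"
proof -
  let ?O = "ordered_simplices M"
  have bij: "bij_betw (map (NG_act (inv g))) ?O ?O"
    by (rule bij_betw_byWitness[of _ "map (NG_act g)"])
      (use g in \<open>auto simp: map_act_ordered map_act_NG ordered_vertices simp del: map_map\<close>)
  have "ip (chain_act G g a) f = (\<Sum>\<^sub>\<infinity>xs\<in>?O. chain_act G g a xs * cnj (f xs))"
    unfolding ip_def using chain_act_transport[OF a g]
    by (intro infsum_cong_neutral) (auto simp: transport_def)
  also have "\<dots> = (\<Sum>\<^sub>\<infinity>xs\<in>?O. (\<lambda>ys. a ys * cnj (f (map (NG_act g) ys))) (map (NG_act (inv g)) xs))"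
  proof (rule infsum_cong)
    fix xs assume "xs \<in> ?O"
    then have "map (NG_act g) (map (NG_act (inv g)) xs) = xs"
      using g by (intro map_act_NG ordered_vertices)
    then show "chain_act G g a xs * cnj (f xs) =
        (\<lambda>ys. a ys * cnj (f (map (NG_act g) ys))) (map (NG_act (inv g)) xs)"
      by (simp add: chain_act_def del: map_map)
  qed
  also have "\<dots> = (\<Sum>\<^sub>\<infinity>ys\<in>?O. a ys * cnj (f (map (NG_act g) ys)))"
    by (rule infsum_reindex_bij_betw[OF bij])
  also have "\<dots> = ip a (chain_act G (inv g) f)"
    unfolding ip_def using a g by (intro infsum_cong_neutral) (auto simp: chain_supported_def chain_act_def)
  finally show ?thesis .
qed

text \<open>The action is unitary, so taking the adjoint inverts \<open>g\<close> and conjugates its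
  coefficient; the symmetry of \<kappa> undoes both.\<close>

lemma isoproj_selfadjoint:
  assumes sym: "\<And>g. g \<in> carrier G \<Longrightarrow> \<kappa> (inv g) = cnj (\<kappa> g)"
    and a: "a \<in> harmonic M n" and f: "f \<in> harmonic M n"
  shows "ip (isoproj G \<kappa> a) f = ip a (isoproj G \<kappa> f)"
proof -
  have e: "ell2 (\<lambda>xs. \<kappa> g * chain_act G g b xs)" if "b \<in> harmonic M n" "g \<in> carrier G" for b g
    using that by (intro ell2_scale harmonic_ell2[OF chain_act_harmonic])
  have "ip (isoproj G \<kappa> a) f = (\<Sum>g\<in>carrier G. \<kappa> g * ip (chain_act G g a) f)"
    unfolding isoproj_def using a f e by (subst ip_sum_left) (auto simp: ip_scale_left harmonic_ell2)
  also have "\<dots> = (\<Sum>g\<in>carrier G. \<kappa> g * ip a (chain_act G (inv g) f))"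
    using a by (intro sum.cong refl) (simp add: ip_chain_act[OF harmonic_supported])
  also have "\<dots> = (\<Sum>g\<in>carrier G. cnj (\<kappa> g) * ip a (chain_act G g f))"
    by (rule sum.reindex_bij_witness[of _ "\<lambda>g. inv g" "\<lambda>g. inv g"]) (auto simp: sym)
  also have "\<dots> = cnj (\<Sum>g\<in>carrier G. \<kappa> g * ip (chain_act G g f) a)"
    by (simp flip: ip_cnj)
  also have "\<dots> = cnj (ip (isoproj G \<kappa> f) a)"
    unfolding isoproj_def using a f e by (subst ip_sum_left) (auto simp: ip_scale_left harmonic_ell2)
  finally show ?thesis by (simp flip: ip_cnj)
qed

end

section \<open>Disjoint unions of freely permuted copies\<close>

locale free_translates = orbit_complex G Orb M
  for G :: "'g monoid" (structure) and Orb :: "('g, 'x) gset set" and M :: "('g, 'x) nvert set set" +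
  fixes L :: "'w set set" and \<phi> :: "'g \<Rightarrow> 'w \<Rightarrow> ('g, 'x) nvert"
  assumes complex_L: "simplicial_complex L"
    and free: "\<And>g h v w. g \<in> carrier G \<Longrightarrow> h \<in> carrier G \<Longrightarrow> v \<in> \<Union>L \<Longrightarrow> w \<in> \<Union>L \<Longrightarrow>
      \<phi> g v = \<phi> h w \<Longrightarrow> g = h \<and> v = w"
    and translates: "M = {\<phi> g ` \<sigma> | g \<sigma>. g \<in> carrier G \<and> \<sigma> \<in> L}"
    and equivariant: "\<And>g h v. g \<in> carrier G \<Longrightarrow> h \<in> carrier G \<Longrightarrow> v \<in> \<Union>L \<Longrightarrow> NG_act h (\<phi> g v) = \<phi> (h \<otimes> g) v"
begin

lemma component_embedding_translate:
  assumes g: "g \<in> carrier G"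
  shows "component_embedding L M (\<phi> g)"
proof (unfold_locales)
  show "simplicial_complex L" "simplicial_complex M" by (rule complex_L complex)+
  show "inj_on (\<phi> g) (\<Union>L)" using free[OF g g] by (intro inj_onI) blast
  show "\<sigma> \<subseteq> \<Union>L \<and> \<phi> g ` \<sigma> \<in> M" if "\<sigma> \<in> L" for \<sigma>
    using that g by (auto simp: translates)
  show "\<exists>\<sigma>\<in>L. \<sigma> \<subseteq> \<Union>L \<and> \<tau> = \<phi> g ` \<sigma>" if t: "\<tau> \<in> M" "\<tau> \<inter> \<phi> g ` \<Union>L \<noteq> {}" for \<tau>
  proof -
    obtain h \<sigma> where h: "h \<in> carrier G" "\<sigma> \<in> L" "\<tau> = \<phi> h ` \<sigma>" using t(1) by (auto simp: translates)
    obtain y where "y \<in> \<phi> h ` \<sigma>" "y \<in> \<phi> g ` \<Union>L" using t(2) unfolding h(3) by blast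
    then obtain v w where v: "v \<in> \<sigma>" "w \<in> \<Union>L" "\<phi> h v = \<phi> g w" by (metis imageE)
    have "h = g" using free[OF h(1) g _ v(2,3)] v(1) h(2) by auto
    then show ?thesis using h by auto
  qed
qed

text \<open>The projection of the translated simplex is the isotypic part of \<open>a\<close>
  extended by zero. Against an isotypic harmonic \<open>f\<close> this has the right products,
  because \<open>isoproj\<close> is self-adjoint and fixes \<open>f\<close>, and \<open>push\<close>
  is adjoint to \<open>pull\<close>.\<close>

lemma projection_translate:
  assumes conv: "\<And>k. k \<in> carrier G \<Longrightarrow> (\<Sum>g\<in>carrier G. \<kappa> g * \<kappa> (inv g \<otimes> k)) = \<kappa> k"
    and sym: "\<And>g. g \<in> carrier G \<Longrightarrow> \<kappa> (inv g) = cnj (\<kappa> g)"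
    and g: "g \<in> carrier G" and xs: "xs \<in> ordered_simplices L" "length xs = n + 1"
    and a: "a \<in> harmonic L n" "\<And>f. f \<in> harmonic L n \<Longrightarrow> ip (\<lambda>zs. oriented_simplex xs zs - a zs) f = 0"
  obtains q where "q \<in> iso_harmonic G \<kappa> M n"
    "\<And>f. f \<in> iso_harmonic G \<kappa> M n \<Longrightarrow> ip (\<lambda>zs. oriented_simplex (map (\<phi> g) xs) zs - q zs) f = 0"
    "q (map (\<phi> g) xs) = \<kappa> \<one> * a xs"
proof -
  interpret E: component_embedding L M "\<phi> g" by (rule component_embedding_translate[OF g])
  define b where "b = E.push a"
  have b: "b \<in> harmonic M n" unfolding b_def by (rule E.push_harmonic[OF a(1)])
  let ?q = "isoproj G \<kappa> b" and ?s = "oriented_simplex (map (\<phi> g) xs)"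
  have q: "?q \<in> harmonic M n" by (rule isoproj_harmonic[OF b])
  have sup: "chain_supported L (n + 1) a" "chain_supported L (n + 1) (oriented_simplex xs)" "ell2 a"
    using a(1) oriented_simplex_chain[OF xs] by (auto simp: harmonic_def l2_chains_iff)
  have es: "ell2 ?s" "ell2 (oriented_simplex xs)" by (intro ell2_fsupp oriented_simplex_fsupp)+
  show ?thesis
  proof (rule that)
    show "?q \<in> iso_harmonic G \<kappa> M n"
      using q isoproj_idem[OF conv b] by (simp add: iso_harmonic_def)
  next
    fix f assume f': "f \<in> iso_harmonic G \<kappa> M n"
    then have f: "f \<in> harmonic M n" "isoproj G \<kappa> f = f" by (auto simp: iso_harmonic_def)
    have pf: "E.pull f \<in> harmonic L n" by (rule E.transport_harmonic[OF f(1)])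
    then have pe: "ell2 (E.pull f)" by (simp add: harmonic_def l2_chains_iff)
    have "ip (\<lambda>zs. ?s zs - ?q zs) f = ip ?s f - ip ?q f"
      by (intro ip_diff_left es harmonic_ell2[OF q] harmonic_ell2[OF f(1)])
    also have "ip ?q f = ip b f" using isoproj_selfadjoint[where \<kappa> = \<kappa>, OF sym b f(1)] f(2) by simp
    also have "\<dots> = ip a (E.pull f)" unfolding b_def by (rule E.ip_push[OF sup(1)])
    also have "ip ?s f = ip (oriented_simplex xs) (E.pull f)"
      unfolding E.push_oriented_simplex[OF xs(1), symmetric] by (rule E.ip_push[OF sup(2)])
    also have "ip (oriented_simplex xs) (E.pull f) - ip a (E.pull f) =
        ip (\<lambda>zs. oriented_simplex xs zs - a zs) (E.pull f)"
      by (rule ip_diff_left[symmetric, OF es(2) sup(3) pe])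
    also have "\<dots> = 0" by (rule a(2)[OF pf])
    finally show "ip (\<lambda>zs. ?s zs - ?q zs) f = 0" .
  next
    let ?ys = "map (\<phi> g) xs"
    have ne: "xs \<noteq> []" using xs(2) by auto
    have sub: "set xs \<subseteq> \<Union>L" using xs(1) by (auto simp: ordered_simplices_def)
    \<comment> \<open>Unless \<open>h\<close> is the identity, it moves the list into another copy,
      where the extension by zero vanishes.\<close>
    have off: "chain_act G h b ?ys = (if h = \<one> then a xs else 0)" if h: "h \<in> carrier G" for h
    proof -
      have act: "map (NG_act (inv h)) ?ys = map (\<phi> (inv h \<otimes> g)) xs"
        using sub h g equivariant by (auto simp: subset_iff)
      show ?thesis
      proof (cases "h = \<one>")
        case True
        then show ?thesis using g act by (simp add: chain_act_def b_def E.push_map[OF xs(1)] del: map_map)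
      next
        case False
        have "b (map (\<phi> (inv h \<otimes> g)) xs) = 0"
        proof (rule ccontr)
          assume "b (map (\<phi> (inv h \<otimes> g)) xs) \<noteq> 0"
          then obtain zs where zs: "zs \<in> ordered_simplices L" "map (\<phi> (inv h \<otimes> g)) xs = map (\<phi> g) zs"
            unfolding b_def by (rule E.push_support)
          then have "zs \<noteq> []" using ne by auto
          then have "\<phi> (inv h \<otimes> g) (hd xs) = \<phi> g (hd zs)" using zs(2) ne by (metis list.map_sel(1))
          moreover have "hd xs \<in> \<Union>L" "hd zs \<in> \<Union>L"
            using ne \<open>zs \<noteq> []\<close> sub E.ordered_subset[OF zs(1)] by (auto simp: subset_iff)
          ultimately have "inv h \<otimes> g = g" using free[of "inv h \<otimes> g" g] g h by blast
          then have "inv h = \<one>" using g h by (simp add: r_cancel_one)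
          then show False using False h by (metis inv_inv inv_one)
        qed
        then show ?thesis using False act by (simp add: chain_act_def del: map_map)
      qed
    qed
    have "?q ?ys = (\<Sum>h\<in>carrier G. if h = \<one> then \<kappa> h * a xs else 0)"
      unfolding isoproj_def by (intro sum.cong refl) (simp add: off)
    then show "?q ?ys = \<kappa> \<one> * a xs" using finite_carrier by simp
  qed
qed

end

lemma projection_unique:
  assumes diff: "\<And>f h. f \<in> V \<Longrightarrow> h \<in> V \<Longrightarrow> (\<lambda>i. f i - h i) \<in> V" and V: "\<And>f. f \<in> V \<Longrightarrow> ell2 f"
    and x: "ell2 x"
    and p: "p \<in> V" "\<And>f. f \<in> V \<Longrightarrow> ip (\<lambda>i. x i - p i) f = 0"
    and q: "q \<in> V" "\<And>f. f \<in> V \<Longrightarrow> ip (\<lambda>i. x i - q i) f = 0"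
  shows "p = q"
proof -
  let ?d = "\<lambda>i. p i - q i"
  have d: "?d \<in> V" "ell2 ?d" using diff V p q by auto
  have "ip ?d ?d = ip (\<lambda>i. x i - q i) ?d - ip (\<lambda>i. x i - p i) ?d"
    using d V p(1) q(1) x by (simp add: ip_diff_left)
  then have "ip ?d ?d = 0" using p(2)[OF d(1)] q(2)[OF d(1)] by simp
  then have "?d = (\<lambda>_. 0)" using nsq_eq_0[OF d(2)] by (simp add: ip_self[OF d(2)])
  then show ?thesis by (auto simp: fun_eq_iff)
qed

lemma isotypic_proj_isoproj:
  "isotypic_proj G \<rho> = isoproj G (\<lambda>g. rep_character \<rho> \<one>\<^bsub>G\<^esub> / of_nat (card (carrier G)) * cnj (rep_character \<rho> g))"
  by (intro ext) (simp add: isotypic_proj_def isoproj_def sum_distrib_left mult.assoc)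

text \<open>These are the coefficients of the central idempotent of the representation: the factor
  |G|/dim in the convolution of characters cancels one of the two factors dim/|G|.\<close>

lemma isotypic_coefficients:
  fixes G (structure) and \<rho> :: "'g \<Rightarrow> complex^'d^'d"
  assumes "group G" "finite (carrier G)" and irr: "irreducible_representation G \<rho>"
  defines "\<kappa> \<equiv> \<lambda>g. rep_character \<rho> \<one> / of_nat (card (carrier G)) * cnj (rep_character \<rho> g)"
  shows "k \<in> carrier G \<Longrightarrow> (\<Sum>g\<in>carrier G. \<kappa> g * \<kappa> (inv g \<otimes> k)) = \<kappa> k"
    and "g \<in> carrier G \<Longrightarrow> \<kappa> (inv g) = cnj (\<kappa> g)"
    and "\<kappa> \<one> = of_nat CARD('d) * of_nat CARD('d) / of_nat (card (carrier G))"
proof -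
  interpret group G by fact
  have rep: "representation G \<rho>" using irr by (simp add: irreducible_representation_def)
  have card: "card (carrier G) \<noteq> 0" using assms(2) by auto
  have one: "rep_character \<rho> \<one> = of_nat CARD('d)" by (rule character_one[OF rep])
  let ?c = "of_nat CARD('d) / of_nat (card (carrier G)) :: complex"
  have \<kappa>: "\<kappa> g = ?c * cnj (rep_character \<rho> g)" for g by (simp add: \<kappa>_def one)
  show "\<kappa> \<one> = of_nat CARD('d) * of_nat CARD('d) / of_nat (card (carrier G))"
    by (simp add: \<kappa> one)
  show "\<kappa> (inv g) = cnj (\<kappa> g)" if "g \<in> carrier G"
    using that by (simp add: \<kappa> character_inv[OF assms(1,2) rep])
  show "(\<Sum>g\<in>carrier G. \<kappa> g * \<kappa> (inv g \<otimes> k)) = \<kappa> k" if "k \<in> carrier G"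
  proof -
    have "(\<Sum>g\<in>carrier G. \<kappa> g * \<kappa> (inv g \<otimes> k)) =
      ?c * (?c * cnj (\<Sum>g\<in>carrier G. rep_character \<rho> g * rep_character \<rho> (inv g \<otimes> k)))"
      unfolding \<kappa> cnj_sum sum_distrib_left by (intro sum.cong refl) simp
    also have "\<dots> = \<kappa> k"
      unfolding character_convolution[OF assms(1-3) that] using card by (simp add: \<kappa>)
    finally show ?thesis .
  qed
qed

section \<open>Isotypic harmonic chains as an orthogonal complement\<close>

text \<open>The isotypic harmonic chains are the square-summable functions orthogonal to the following
  countably many finitely supported functions (support, alternation, boundary, coboundary,
  isotypic part). Each value depends on \<open>M\<close> through finitely many memberships only, so the
  orthogonal projections depend measurably on \<open>M\<close>.\<close>

definition point_mass :: "'i \<Rightarrow> 'i \<Rightarrow> complex" where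
  "point_mass x = (\<lambda>z. if z = x then 1 else 0)"

definition constraint :: "'g monoid \<Rightarrow> ('g \<Rightarrow> complex) \<Rightarrow> ('g, 'x) nvert set set \<Rightarrow> nat \<Rightarrow>
    nat \<times> ('g, 'x) nvert list \<times> (nat \<Rightarrow> nat) \<Rightarrow> ('g, 'x) chain" where
  "constraint G \<kappa> M n = (\<lambda>(t, xs, p).
     if t = 0 then (\<lambda>z. if xs \<in> ordered_simplices M \<and> length xs = n + 1 then 0 else point_mass xs z)
     else if t = 1 then (\<lambda>z. point_mass (permute_list p xs) z - sgn_of p * point_mass xs z)
     else if t = 2 then (\<lambda>z. if xs \<in> ordered_simplices M \<and> z \<in> ordered_simplices M \<and> z \<noteq> [] \<and> tl z = xs then 1 else 0)
     else if t = 3 then (\<lambda>z. if xs \<in> ordered_simplices M \<and> length xs = n + 1 + 1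
       then \<Sum>q\<in>perms (n + 1 + 1). sgn_of q * point_mass (tl (permute_list q xs)) z else 0)
     else (\<lambda>z. point_mass xs z - (\<Sum>g\<in>carrier G. cnj (\<kappa> g) * point_mass (map (NG_act (inv\<^bsub>G\<^esub> g)) xs) z)))"

text \<open>The lists range over \<open>NG Orb\<close> and not over one complex, so a single index
  set, countable for finite \<open>Orb\<close>, serves all fibres.\<close>

definition constraint_index :: "('g, 'x) gset set \<Rightarrow> (nat \<times> ('g, 'x) nvert list \<times> (nat \<Rightarrow> nat)) set" where
  "constraint_index Orb = {(t, xs, p). t < 5 \<and> set xs \<subseteq> NG Orb \<and> p \<in> perms (length xs)}"

lemma point_mass_fsupp: "fsupp (point_mass x)"
  by (simp add: point_mass_def)

lemma ip_point_mass: "ip f (point_mass x) = f x"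
  by (subst ip_fsupp[of "{x}"]) (auto simp: point_mass_def)

lemma ell2_point_mass: "ell2 (point_mass x)"
  by (intro ell2_fsupp point_mass_fsupp)

lemma ip_point_masses:
  assumes "ell2 f"
  shows "ip f (\<lambda>z. \<Sum>y\<in>F. a y * point_mass (x y) z) = (\<Sum>y\<in>F. cnj (a y) * f (x y))"
proof -
  have "ip f (\<lambda>z. \<Sum>y\<in>F. a y * point_mass (x y) z) = cnj (\<Sum>y\<in>F. a y * ip (point_mass (x y)) f)"
    by (subst ip_cnj, subst ip_sum_left) (simp_all add: assms ell2_scale ell2_point_mass ip_scale_left)
  also have "\<dots> = (\<Sum>y\<in>F. cnj (a y) * ip f (point_mass (x y)))"
    by (simp flip: ip_cnj)
  finally show ?thesis by (simp add: ip_point_mass)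
qed

lemma ell2_point_masses: "ell2 (\<lambda>z. \<Sum>y\<in>F. a y * point_mass (x y) z)"
  by (intro ell2_sum ell2_scale ell2_point_mass)

locale bounded_orbit_complex = orbit_complex G Orb M + bounded_complex M D
  for G :: "'g monoid" (structure) and Orb :: "('g, 'x) gset set" and M :: "('g, 'x) nvert set set" and D
begin

text \<open>Pairing with a constraint reads off one coordinate of one linear condition.
  \<open>ip\<close> conjugates its second argument, which explains the
  \<open>cnj (\<kappa> g)\<close> in the constraint.\<close>

lemma ip_constraint:
  assumes f: "ell2 f"
  shows "ip f (constraint G \<kappa> M n (0, xs, p)) = (if xs \<in> ordered_simplices M \<and> length xs = n + 1 then 0 else f xs)"
    and "ip f (constraint G \<kappa> M n (1, xs, p)) = f (permute_list p xs) - sgn_of p * f xs"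
    and "ip f (constraint G \<kappa> M n (2, xs, p)) = boundary M f xs"
    and "ip f (constraint G \<kappa> M n (3, xs, p)) = (if xs \<in> ordered_simplices M \<and> length xs = n + 1 + 1
       then \<Sum>q\<in>perms (n + 1 + 1). sgn_of q * f (tl (permute_list q xs)) else 0)"
    and "ip f (constraint G \<kappa> M n (4, xs, p)) = f xs - isoproj G \<kappa> f xs"
proof -
  show "ip f (constraint G \<kappa> M n (0, xs, p)) = (if xs \<in> ordered_simplices M \<and> length xs = n + 1 then 0 else f xs)"
    by (auto simp: constraint_def ip_zero ip_point_mass)
  have "constraint G \<kappa> M n (1, xs, p) = (\<lambda>z. point_mass (permute_list p xs) z - sgn_of p * point_mass xs z)"
    by (simp add: constraint_def)
  then show "ip f (constraint G \<kappa> M n (1, xs, p)) = f (permute_list p xs) - sgn_of p * f xs"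
    using f by (simp add: ip_diff_right ell2_point_mass ell2_scale ip_scale_right ip_point_mass)
  show "ip f (constraint G \<kappa> M n (2, xs, p)) = boundary M f xs"
  proof (cases "xs \<in> ordered_simplices M")
    case False
    then have "constraint G \<kappa> M n (2, xs, p) = (\<lambda>_. 0)" by (simp add: constraint_def)
    then show ?thesis using False by (simp add: ip_zero boundary_def)
  next
    case True
    let ?E = "{v. v # xs \<in> ordered_simplices M}"
    have "xs \<noteq> []" using True Nil_not_simplex by auto
    then have fin: "finite ?E" by (rule extensions)
    have c: "constraint G \<kappa> M n (2, xs, p) = (\<lambda>z. if z \<in> (\<lambda>v. v # xs) ` ?E then 1 else 0)"
    proof
      fix z show "constraint G \<kappa> M n (2, xs, p) z = (if z \<in> (\<lambda>v. v # xs) ` ?E then 1 else 0)"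
        using True by (cases z) (auto simp: constraint_def)
    qed
    have "ip f (constraint G \<kappa> M n (2, xs, p)) = (\<Sum>z\<in>(\<lambda>v. v # xs) ` ?E. f z)"
      unfolding c by (subst ip_fsupp[of "(\<lambda>v. v # xs) ` ?E"]) (use fin in auto)
    also have "\<dots> = (\<Sum>v\<in>?E. f (v # xs))" by (subst sum.reindex) (auto simp: inj_on_def)
    finally show ?thesis using True by (simp add: boundary_def)
  qed
  show "ip f (constraint G \<kappa> M n (3, xs, p)) = (if xs \<in> ordered_simplices M \<and> length xs = n + 1 + 1
       then \<Sum>q\<in>perms (n + 1 + 1). sgn_of q * f (tl (permute_list q xs)) else 0)"
  proof (cases "xs \<in> ordered_simplices M \<and> length xs = n + 1 + 1")
    case True
    then have "constraint G \<kappa> M n (3, xs, p) = (\<lambda>z. \<Sum>q\<in>perms (n + 1 + 1). sgn_of q * point_mass (tl (permute_list q xs)) z)"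
      by (simp add: constraint_def)
    then show ?thesis using True f by (simp only: ip_point_masses sgn_of_square(2) if_True simp_thms)
  next
    case False
    then have "constraint G \<kappa> M n (3, xs, p) = (\<lambda>_. 0)" by (auto simp: constraint_def)
    then show ?thesis using False by (auto simp: ip_zero)
  qed
  have c: "constraint G \<kappa> M n (4, xs, p) =
      (\<lambda>z. point_mass xs z - (\<Sum>g\<in>carrier G. cnj (\<kappa> g) * point_mass (map (NG_act (inv g)) xs) z))"
    by (simp add: constraint_def)
  show "ip f (constraint G \<kappa> M n (4, xs, p)) = f xs - isoproj G \<kappa> f xs"
    unfolding c using f
    by (simp add: ip_diff_right ell2_point_mass ell2_point_masses ip_point_mass ip_point_masses isoproj_def chain_act_def)
qed

text \<open>Only the boundary family \<open>t = 2\<close> relies on the degree bound, through the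
  finite number of extensions of \<open>xs\<close>.\<close>

lemma constraint_fsupp: "fsupp (constraint G \<kappa> M n (t, xs, p))"
proof -
  consider "t = 0" | "t = 1" | "t = 2" | "t = 3" | "t > 3" by linarith
  then show ?thesis
  proof cases
    case 1
    then have "{z. constraint G \<kappa> M n (t, xs, p) z \<noteq> 0} \<subseteq> {xs}"
      by (auto simp: constraint_def point_mass_def split: if_splits)
    then show ?thesis by (rule finite_subset) simp
  next
    case 2
    then have "{z. constraint G \<kappa> M n (t, xs, p) z \<noteq> 0} \<subseteq> {xs, permute_list p xs}"
      by (auto simp: constraint_def point_mass_def split: if_splits)
    then show ?thesis by (rule finite_subset) simp
  next
    case 3
    have "{z. constraint G \<kappa> M n (t, xs, p) z \<noteq> 0} \<subseteq> (\<lambda>v. v # xs) ` {v. v # xs \<in> ordered_simplices M \<and> xs \<in> ordered_simplices M}"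
    proof safe
      fix z assume "constraint G \<kappa> M n (t, xs, p) z \<noteq> 0"
      with 3 have "xs \<in> ordered_simplices M" "z \<in> ordered_simplices M" "z \<noteq> []" "tl z = xs"
        by (auto simp: constraint_def split: if_splits)
      then show "z \<in> (\<lambda>v. v # xs) ` {v. v # xs \<in> ordered_simplices M \<and> xs \<in> ordered_simplices M}"
        by (cases z) auto
    qed
    moreover have "finite {v. v # xs \<in> ordered_simplices M \<and> xs \<in> ordered_simplices M}"
    proof (cases "xs = []")
      case True
      then show ?thesis by (simp add: Nil_not_simplex)
    next
      case False
      show ?thesis by (rule finite_subset[OF _ extensions(1)[OF False]]) auto
    qed
    ultimately show ?thesis using finite_subset by blast
  next
    case 4
    have "{z. constraint G \<kappa> M n (t, xs, p) z \<noteq> 0} \<subseteq> (\<lambda>q. tl (permute_list q xs)) ` perms (n + 1 + 1)"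
    proof safe
      fix z assume "constraint G \<kappa> M n (t, xs, p) z \<noteq> 0"
      with 4 have "(\<Sum>q\<in>perms (n + 1 + 1). sgn_of q * point_mass (tl (permute_list q xs)) z) \<noteq> 0"
        by (auto simp: constraint_def split: if_splits)
      then obtain q where "q \<in> perms (n + 1 + 1)" "sgn_of q * point_mass (tl (permute_list q xs)) z \<noteq> 0"
        by (rule sum.not_neutral_contains_not_neutral)
      then show "z \<in> (\<lambda>q. tl (permute_list q xs)) ` perms (n + 1 + 1)"
        by (auto simp: point_mass_def split: if_splits)
    qed
    then show ?thesis by (rule finite_subset) (simp add: card_perms)
  next
    case 5
    have "{z. constraint G \<kappa> M n (t, xs, p) z \<noteq> 0} \<subseteq> insert xs ((\<lambda>g. map (NG_act (inv g)) xs) ` carrier G)"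
    proof safe
      fix z assume z: "constraint G \<kappa> M n (t, xs, p) z \<noteq> 0" "z \<notin> (\<lambda>g. map (NG_act (inv g)) xs) ` carrier G"
      then have "(\<Sum>g\<in>carrier G. cnj (\<kappa> g) * point_mass (map (NG_act (inv g)) xs) z) = 0"
        by (intro sum.neutral) (auto simp: point_mass_def)
      with z(1) 5 show "z = xs" by (auto simp: constraint_def point_mass_def split: if_splits)
    qed
    then show ?thesis by (rule finite_subset) (simp add: finite_carrier)
  qed
qed

lemma constraint_support:
  assumes "(t, xs, p) \<in> constraint_index Orb"
  shows "{z. constraint G \<kappa> M n (t, xs, p) z \<noteq> 0} \<subseteq> {z. set z \<subseteq> NG Orb}"
proof safe
  fix z v assume z: "constraint G \<kappa> M n (t, xs, p) z \<noteq> 0" and v: "v \<in> set z"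
  have xs: "set xs \<subseteq> NG Orb" "p permutes {..<length xs}" using assms by (auto simp: constraint_index_def)
  have ox: "point_mass ys z \<noteq> 0 \<Longrightarrow> set ys \<subseteq> NG Orb \<Longrightarrow> v \<in> NG Orb" for ys
    using v by (auto simp: point_mass_def split: if_splits)
  consider "t = 0" | "t = 1" | "t = 2" | "t = 3" | "t > 3" by linarith
  then show "v \<in> NG Orb"
  proof cases
    case 1
    then show ?thesis using z ox xs by (auto simp: constraint_def split: if_splits)
  next
    case 2
    then have "point_mass (permute_list p xs) z \<noteq> 0 \<or> point_mass xs z \<noteq> 0"
      using z by (auto simp: constraint_def)
    then show ?thesis using ox xs by (metis set_permute_list)
  next
    case 3
    then have "z \<in> ordered_simplices M" using z by (auto simp: constraint_def split: if_splits)
    then show ?thesis using v ordered_vertices by auto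
  next
    case 4
    then have len: "length xs = n + 1 + 1"
      and "(\<Sum>q\<in>perms (n + 1 + 1). sgn_of q * point_mass (tl (permute_list q xs)) z) \<noteq> 0"
      using z by (auto simp: constraint_def split: if_splits)
    from this(2) obtain q where q': "q \<in> perms (n + 1 + 1)" "sgn_of q * point_mass (tl (permute_list q xs)) z \<noteq> 0"
      by (rule sum.not_neutral_contains_not_neutral)
    then have q: "q \<in> perms (n + 1 + 1)" "point_mass (tl (permute_list q xs)) z \<noteq> 0" by auto
    have "set (tl ys) \<subseteq> set ys" for ys :: "('g, 'x) nvert list" by (cases ys) auto
    from this[of "permute_list q xs"] have "set (tl (permute_list q xs)) \<subseteq> set xs"
      using q(1) len by simp
    then show ?thesis using ox[OF q(2)] xs by auto
  next
    case 5
    show ?thesis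
    proof (rule ccontr)
      assume "v \<notin> NG Orb"
      then have "point_mass ys z = 0" if "set ys \<subseteq> NG Orb" for ys using ox that by blast
      moreover have "set (map (NG_act (inv g)) xs) \<subseteq> NG Orb" if "g \<in> carrier G" for g
      proof
        fix w assume "w \<in> set (map (NG_act (inv g)) xs)"
        then obtain u where "u \<in> set xs" "w = NG_act (inv g) u" by (metis imageE set_map)
        then show "w \<in> NG Orb" using xs(1) NG_act_NG[of u "inv g"] that by blast
      qed
      ultimately have "point_mass xs z = 0" "\<And>g. g \<in> carrier G \<Longrightarrow> point_mass (map (NG_act (inv g)) xs) z = 0"
        using xs(1) by blast+
      then have "constraint G \<kappa> M n (t, xs, p) z = 0" using 5 by (simp add: constraint_def)
      with z show False by simp
    qed
  qed
qed

text \<open>The support condition is listed separately because the constraints are indexed by lists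
  over \<open>NG Orb\<close> and do not exclude values at other lists.\<close>

lemma iso_harmonic_constraints:
  "f \<in> iso_harmonic G \<kappa> M n \<longleftrightarrow> ell2 f \<and> {z. f z \<noteq> 0} \<subseteq> {z. set z \<subseteq> NG Orb} \<and>
     (\<forall>j\<in>constraint_index Orb. ip f (constraint G \<kappa> M n j) = 0)"
proof
  assume f: "f \<in> iso_harmonic G \<kappa> M n"
  then have c: "chain_supported M (n + 1) f" "alternating f" "ell2 f" "boundary M f = (\<lambda>_. 0)"
    "cobd M (n + 1) f = (\<lambda>_. 0)" "isoproj G \<kappa> f = f"
    by (auto simp: iso_harmonic_def harmonic_def l2_chains_iff)
  have "ip f (constraint G \<kappa> M n (t, xs, p)) = 0" if j: "(t, xs, p) \<in> constraint_index Orb" for t xs p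
  proof -
    have p: "p permutes {..<length xs}" using j by (simp add: constraint_index_def)
    have "t < 5" using j by (simp add: constraint_index_def)
    then consider "t = 0" | "t = 1" | "t = 2" | "t = 3" | "t = 4" by linarith
    then show ?thesis
    proof cases
      case 1
      then show ?thesis using c(1) by (auto simp: ip_constraint[OF c(3)] chain_supported_def)
    next
      case 2
      then show ?thesis using alternatingD[OF c(2) p] by (simp add: ip_constraint[OF c(3), simplified])
    next
      case 3
      then show ?thesis by (simp add: ip_constraint[OF c(3)] c(4))
    next
      case 4
      have "cobd M (n + 1) f xs = 0" by (simp only: c(5))
      then have "(\<Sum>q\<in>perms (n + 1 + 1). sgn_of q * tail_act M (n + 1 + 1) q f xs) = 0"
        unfolding cobd_def using fact_nonzero[of "n + 1", where ?'a = complex] by (simp del: fact_Suc)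
      then show ?thesis using 4 by (auto simp: ip_constraint[OF c(3)] tail_act_def)
    next
      case 5
      then show ?thesis by (simp add: ip_constraint[OF c(3)] c(6))
    qed
  qed
  moreover have "{z. f z \<noteq> 0} \<subseteq> {z. set z \<subseteq> NG Orb}"
    using c(1) ordered_vertices by (auto simp: chain_supported_def)
  ultimately show "ell2 f \<and> {z. f z \<noteq> 0} \<subseteq> {z. set z \<subseteq> NG Orb} \<and>
     (\<forall>j\<in>constraint_index Orb. ip f (constraint G \<kappa> M n j) = 0)" using c(3) by auto
next
  assume *: "ell2 f \<and> {z. f z \<noteq> 0} \<subseteq> {z. set z \<subseteq> NG Orb} \<and>
     (\<forall>j\<in>constraint_index Orb. ip f (constraint G \<kappa> M n j) = 0)"
  then have e: "ell2 f" and z: "\<And>z. f z \<noteq> 0 \<Longrightarrow> set z \<subseteq> NG Orb"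
    and j: "\<And>t xs p. t < 5 \<Longrightarrow> set xs \<subseteq> NG Orb \<Longrightarrow> p permutes {..<length xs} \<Longrightarrow>
      ip f (constraint G \<kappa> M n (t, xs, p)) = 0"
    by (auto simp: constraint_index_def)
  have supp: "chain_supported M (n + 1) f"
    unfolding chain_supported_def
  proof (intro allI impI)
    fix xs assume "f xs \<noteq> 0"
    then show "xs \<in> ordered_simplices M \<and> length xs = n + 1"
      using j[of 0 xs id] z[of xs] by (simp add: ip_constraint[OF e] permutes_id split: if_splits)
  qed
  have alt: "alternating f"
    unfolding alternating_def
  proof (intro allI impI)
    fix xs :: "('g, 'x) nvert list" and p assume p: "p permutes {..<length xs}"
    show "f (permute_list p xs) = sgn_of p * f xs"
    proof (cases "set xs \<subseteq> NG Orb")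
      case True
      then show ?thesis using j[of 1 xs p] p ip_constraint(2)[OF e, of \<kappa> n xs p] by simp
    next
      case False
      then have "f xs = 0" "f (permute_list p xs) = 0" using z[of xs] z[of "permute_list p xs"] p by auto
      then show ?thesis by simp
    qed
  qed
  have bd: "boundary M f = (\<lambda>_. 0)"
  proof
    fix xs show "boundary M f xs = 0"
    proof (cases "xs \<in> ordered_simplices M")
      case True
      then show ?thesis
        using j[of 2 xs id] ordered_vertices[OF True] by (simp add: ip_constraint[OF e] permutes_id)
    qed (simp add: boundary_def)
  qed
  have cb: "cobd M (n + 1) f = (\<lambda>_. 0)"
  proof
    fix xs show "cobd M (n + 1) f xs = 0"
    proof (cases "xs \<in> ordered_simplices M \<and> length xs = n + 1 + 1")
      case True
      then have "(\<Sum>q\<in>perms (n + 1 + 1). sgn_of q * f (tl (permute_list q xs))) = 0"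
        using j[of 3 xs id] ordered_vertices[of xs] by (simp add: ip_constraint[OF e] permutes_id)
      then show ?thesis using True by (simp add: cobd_def tail_act_def)
    qed (auto simp: cobd_def tail_act_def)
  qed
  have h: "f \<in> harmonic M n"
    using supp alt e bd cb by (simp add: harmonic_def l2_chains_iff)
  have "isoproj G \<kappa> f xs = f xs" for xs
  proof (cases "xs \<in> ordered_simplices M")
    case True
    then show ?thesis
      using j[of 4 xs id] ordered_vertices[OF True] by (simp add: ip_constraint[OF e] permutes_id)
  next
    case False
    then show ?thesis
      using harmonic_supported[OF h] harmonic_supported[OF isoproj_harmonic[OF h]]
      unfolding chain_supported_def by metis
  qed
  then show "f \<in> iso_harmonic G \<kappa> M n" using h by (auto simp: iso_harmonic_def)
qed

end

text \<open>The diagonal entry of the projection onto \<open>V\<close>: evaluation at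
  \<open>xs\<close> is the normalised inner product with the oriented simplex. It involves neither
  measure nor realization, so it can be compared between complexes.\<close>

definition harmonic_diag :: "('v list \<Rightarrow> complex) set \<Rightarrow> 'v list \<Rightarrow> real" where
  "harmonic_diag V xs = Re ((THE p. p \<in> V \<and> (\<forall>f\<in>V. ip (\<lambda>i. oriented_simplex xs i - p i) f = 0)) xs)"

lemma harmonic_diag_eq:
  assumes diff: "\<And>f h. f \<in> V \<Longrightarrow> h \<in> V \<Longrightarrow> (\<lambda>i. f i - h i) \<in> V" and V: "\<And>f. f \<in> V \<Longrightarrow> ell2 f"
    and p: "p \<in> V" "\<And>f. f \<in> V \<Longrightarrow> ip (\<lambda>i. oriented_simplex xs i - p i) f = 0"
  shows "harmonic_diag V xs = Re (p xs)"
proof -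
  have "(THE p. p \<in> V \<and> (\<forall>f\<in>V. ip (\<lambda>i. oriented_simplex xs i - p i) f = 0)) = p"
    using p projection_unique[OF diff V ell2_fsupp[OF oriented_simplex_fsupp]]
    by (intro the_equality) blast+
  then show ?thesis by (simp add: harmonic_diag_def)
qed

lemma iso_harmonic_ell2: "f \<in> iso_harmonic G \<kappa> M n \<Longrightarrow> ell2 f"
  by (simp add: iso_harmonic_def harmonic_def l2_chains_iff)

lemma iso_harmonic_diff:
  assumes "f \<in> iso_harmonic G \<kappa> M n" "h \<in> iso_harmonic G \<kappa> M n"
  shows "(\<lambda>xs. f xs - h xs) \<in> iso_harmonic G \<kappa> M n"
proof -
  have "isoproj G \<kappa> (\<lambda>xs. f xs - h xs) xs = isoproj G \<kappa> f xs - isoproj G \<kappa> h xs" for xs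
    by (simp add: isoproj_def chain_act_def right_diff_distrib sum_subtractf)
  then show ?thesis using assms by (auto simp: iso_harmonic_def harmonic_diff)
qed

section \<open>The trace formula\<close>

text \<open>A simplex through \<open>v\<close> is \<open>v\<close> together with a set of neighbours
  of \<open>v\<close>.\<close>

lemma (in bounded_complex) star_bound:
  "finite {\<sigma>\<in>L. v \<in> \<sigma>}" "card {\<sigma>\<in>L. v \<in> \<sigma>} \<le> 2 ^ D"
proof -
  have "finite {\<sigma>\<in>L. v \<in> \<sigma>} \<and> card {\<sigma>\<in>L. v \<in> \<sigma>} \<le> 2 ^ D"
  proof (cases "v \<in> \<Union>L")
    case False
    then have "{\<sigma>\<in>L. v \<in> \<sigma>} = {}" by auto
    then show ?thesis by (metis card.empty finite.emptyI zero_le)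
  next
    case True
    let ?N = "{w. w \<noteq> v \<and> {v, w} \<in> L}"
    note N = neighbours[OF True]
    have sub: "{\<sigma>\<in>L. v \<in> \<sigma>} \<subseteq> insert v ` Pow ?N"
    proof
      fix \<sigma> assume s: "\<sigma> \<in> {\<sigma>\<in>L. v \<in> \<sigma>}"
      then have "\<sigma> - {v} \<subseteq> ?N" by (auto intro: subset_simplex)
      then show "\<sigma> \<in> insert v ` Pow ?N"
        using s by (intro image_eqI[of _ _ "\<sigma> - {v}"]) auto
    qed
    have fin: "finite (insert v ` Pow ?N)" using N by simp
    have "card (insert v ` Pow ?N) \<le> card (Pow ?N)" using N by (intro card_image_le) simp
    also have "\<dots> = 2 ^ card ?N" using N by (simp add: card_Pow)
    also have "\<dots> \<le> 2 ^ D" using N by (intro power_increasing) auto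
    finally show ?thesis using sub fin by (meson card_mono finite_subset order_trans)
  qed
  then show "finite {\<sigma>\<in>L. v \<in> \<sigma>}" "card {\<sigma>\<in>L. v \<in> \<sigma>} \<le> 2 ^ D" by auto
qed

text \<open>A countable exhaustion reduces the claim to dominated convergence with the constant
  \<open>B\<close>. Summability of the integrals is part of the claim, since \<open>infsum\<close>
  defaults to 0 without it.\<close>

lemma (in prob_space) has_sum_integral_bounded:
  fixes f :: "'s \<Rightarrow> 'a \<Rightarrow> real"
  assumes S: "countable S" and meas: "\<And>s. s \<in> S \<Longrightarrow> f s \<in> borel_measurable M"
    and nonneg: "\<And>s c. s \<in> S \<Longrightarrow> c \<in> space M \<Longrightarrow> 0 \<le> f s c"
    and bound: "\<And>F c. finite F \<Longrightarrow> F \<subseteq> S \<Longrightarrow> c \<in> space M \<Longrightarrow> (\<Sum>s\<in>F. f s c) \<le> B"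
  shows "((\<lambda>s. \<integral>c. f s c \<partial>M) has_sum (\<integral>c. (\<Sum>\<^sub>\<infinity>s\<in>S. f s c) \<partial>M)) S"
proof -
  obtain b where b: "\<And>n. finite (b n)" "\<And>n. b n \<subseteq> S" "filterlim b (finite_subsets_at_top S) sequentially"
    using countable_finite_exhaustion[OF S] by metis
  have int: "integrable M (f s)" if "s \<in> S" for s
    using nonneg[OF that] bound[of "{s}"] that
    by (intro integrable_const_bound[of _ B] meas AE_I2) auto
  have summ: "(\<lambda>s. f s c) summable_on S" if "c \<in> space M" for c
    using nonneg bound that
    by (intro nonneg_bounded_partial_sums_imp_summable_on[where C = B] eventually_finite_subsets_at_top_weakI) auto
  have "(\<Sum>s\<in>F. \<integral>c. f s c \<partial>M) \<le> B" if "finite F" "F \<subseteq> S" for F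
  proof -
    have iF: "integrable M (\<lambda>c. \<Sum>s\<in>F. f s c)" using int that by (intro Bochner_Integration.integrable_sum) auto
    have "(\<Sum>s\<in>F. \<integral>c. f s c \<partial>M) = (\<integral>c. (\<Sum>s\<in>F. f s c) \<partial>M)"
      using int that by (intro Bochner_Integration.integral_sum[symmetric]) auto
    also have "\<dots> \<le> (\<integral>c. B \<partial>M)" by (rule integral_mono[OF iF]) (use bound[OF that] in auto)
    finally show ?thesis by (simp add: prob_space)
  qed
  then have summ': "(\<lambda>s. \<integral>c. f s c \<partial>M) summable_on S"
    using nonneg
    by (intro nonneg_bounded_partial_sums_imp_summable_on[where C = B] eventually_finite_subsets_at_top_weakI)
      (auto intro!: Bochner_Integration.integral_nonneg)
  have "(\<lambda>n. \<Sum>s\<in>b n. \<integral>c. f s c \<partial>M) \<longlonglongrightarrow> (\<Sum>\<^sub>\<infinity>s\<in>S. \<integral>c. f s c \<partial>M)"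
    using filterlim_compose[OF infsum_tendsto[OF summ'] b(3)] by simp
  moreover have "(\<lambda>n. \<Sum>s\<in>b n. \<integral>c. f s c \<partial>M) \<longlonglongrightarrow> (\<integral>c. (\<Sum>\<^sub>\<infinity>s\<in>S. f s c) \<partial>M)"
  proof -
    have "(\<lambda>n. \<integral>c. (\<Sum>s\<in>b n. f s c) \<partial>M) \<longlonglongrightarrow> (\<integral>c. (\<Sum>\<^sub>\<infinity>s\<in>S. f s c) \<partial>M)"
    proof (rule integral_dominated_convergence[where w = "\<lambda>_. B"])
      have lim: "(\<lambda>n. \<Sum>s\<in>b n. f s c) \<longlonglongrightarrow> (\<Sum>\<^sub>\<infinity>s\<in>S. f s c)" if "c \<in> space M" for c
        using filterlim_compose[OF infsum_tendsto[OF summ[OF that]] b(3)] by simp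
      show m: "(\<lambda>c. \<Sum>s\<in>b n. f s c) \<in> borel_measurable M" for n
        using meas b by (intro borel_measurable_sum) auto
      show "(\<lambda>c. \<Sum>\<^sub>\<infinity>s\<in>S. f s c) \<in> borel_measurable M"
        using m lim by (rule borel_measurable_LIMSEQ_metric)
      show "AE c in M. (\<lambda>n. \<Sum>s\<in>b n. f s c) \<longlonglongrightarrow> (\<Sum>\<^sub>\<infinity>s\<in>S. f s c)" using lim by (intro AE_I2)
      show "AE c in M. norm (\<Sum>s\<in>b n. f s c) \<le> B" for n
      proof (rule AE_I2)
        fix c assume c: "c \<in> space M"
        have "0 \<le> (\<Sum>s\<in>b n. f s c)" by (intro sum_nonneg nonneg[OF _ c]) (use b(2) in blast)
        then show "norm (\<Sum>s\<in>b n. f s c) \<le> B" using bound[OF b(1,2) c] by simp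
      qed
    qed simp
    moreover have "(\<integral>c. (\<Sum>s\<in>b n. f s c) \<partial>M) = (\<Sum>s\<in>b n. \<integral>c. f s c \<partial>M)" for n
      using int b by (intro Bochner_Integration.integral_sum) auto
    ultimately show ?thesis by simp
  qed
  ultimately have "(\<Sum>\<^sub>\<infinity>s\<in>S. \<integral>c. f s c \<partial>M) = (\<integral>c. (\<Sum>\<^sub>\<infinity>s\<in>S. f s c) \<partial>M)" by (rule LIMSEQ_unique)
  then show ?thesis using has_sum_infsum[OF summ'] by simp
qed

lemma (in orbit_system) finite_orbit: "X \<in> Orb \<Longrightarrow> finite (fst X)"
proof -
  assume X: "X \<in> Orb"
  then obtain x where x: "x \<in> fst X" using transitive[OF X] by (auto simp: transitive_gset_def)
  have "fst X \<subseteq> (\<lambda>g. snd X g x) ` carrier G"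
    using transitive_action.unique_orbit[of G "fst X" "snd X" x] transitive[OF X] x
    by (fastforce simp: transitive_gset_def)
  then show ?thesis using finite_carrier by (meson finite_imageI finite_subset)
qed

text \<open>The setting of the trace computation, instantiated once with the trivial group and
  \<kappa> = 1 and once with \<open>G\<close> and the isotypic coefficients.\<close>

locale chain_field_space = orbit_system G Orb + prob_space \<mu>
  for G :: "'g monoid" (structure) and Orb :: "('g, 'x) gset set" and \<mu> :: "'g rclass measure" +
  fixes D n :: nat and \<Psi> :: "('g, 'x) realization" and \<kappa> :: "'g \<Rightarrow> complex"
  assumes finite_Orb: "finite Orb"
    and fibre: "\<And>c. c \<in> space \<mu> \<Longrightarrow> bounded_orbit_complex G Orb (\<Psi> c) D"
    and Delta: "\<And>c. c \<in> space \<mu> \<Longrightarrow> \<Psi> c \<subseteq> Delta D Orb"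
    and simplex_sets: "\<And>s. s \<in> Delta D Orb \<Longrightarrow> {c \<in> space \<mu>. s \<in> \<Psi> c} \<in> sets \<mu>"
begin

abbreviation "NG_lists \<equiv> {z. set z \<subseteq> NG Orb}"

abbreviation "fibre_space c \<equiv> iso_harmonic G \<kappa> (\<Psi> c) n"

definition conditions :: "'g rclass \<Rightarrow> nat \<Rightarrow> ('g, 'x) chain" where
  "conditions c j = constraint G \<kappa> (\<Psi> c) n (from_nat_into (constraint_index Orb) j)"

definition fibre_proj :: "('g, 'x) nvert list \<Rightarrow> ('g, 'x) chain_field" where
  "fibre_proj xs c = lproj (conditions c) (xi \<Psi> xs c)"

text \<open>The default 0 agrees with \<open>xi\<close>, which is the zero chain when the simplex is
  absent from the fibre.\<close>

definition diag :: "('g, 'x) nvert list \<Rightarrow> 'g rclass \<Rightarrow> real" where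
  "diag xs c = (if set xs \<in> \<Psi> c then harmonic_diag (fibre_space c) xs else 0)"

lemma countable_NG: "countable (NG Orb)"
proof -
  have "NG Orb \<subseteq> UNIV \<times> (SIGMA X:Orb. fst X)" by (auto simp: NG_def)
  moreover have "countable (UNIV \<times> (SIGMA X:Orb. fst X) :: (nat \<times> ('g, 'x) gset \<times> 'x) set)"
    using finite_Orb finite_orbit by (intro countable_SIGMA countableI_type countable_finite) auto
  ultimately show ?thesis by (rule countable_subset)
qed

lemma countable_lists_NG: "countable NG_lists"
  using countable_lists[OF countable_NG] by (simp add: lists_eq_set)

lemma constraint_index_props: "countable (constraint_index Orb)" "constraint_index Orb \<noteq> {}"
proof -
  have "constraint_index Orb \<subseteq> UNIV \<times> (SIGMA xs:NG_lists. perms (length xs))"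
    by (auto simp: constraint_index_def)
  moreover have "countable (UNIV \<times> (SIGMA xs:NG_lists. perms (length xs)) :: (nat \<times> _) set)"
    by (intro countable_SIGMA countableI_type countable_lists_NG countable_finite card_perms)
  ultimately show "countable (constraint_index Orb)" by (rule countable_subset)
  have "(0, [], id) \<in> constraint_index Orb" by (simp add: constraint_index_def permutes_id)
  then show "constraint_index Orb \<noteq> {}" by blast
qed

lemma ordered_sets: "Measurable.pred \<mu> (\<lambda>c. xs \<in> ordered_simplices (\<Psi> c))"
proof (cases "distinct xs \<and> set xs \<in> Delta D Orb")
  case True
  then show ?thesis using simplex_sets[of "set xs"] by (simp add: pred_def ordered_simplices_def)
next
  case False
  then have eq: "{c \<in> space \<mu>. xs \<in> ordered_simplices (\<Psi> c)} = {}"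
    using Delta by (auto simp: ordered_simplices_def)
  show ?thesis by (simp only: pred_def eq sets.empty_sets)
qed

lemma simplex_pred: "Measurable.pred \<mu> (\<lambda>c. s \<in> \<Psi> c)"
proof (cases "s \<in> Delta D Orb")
  case True
  then show ?thesis using simplex_sets by (simp add: pred_def)
next
  case False
  then have eq: "{c \<in> space \<mu>. s \<in> \<Psi> c} = {}" using Delta by auto
  show ?thesis by (simp only: pred_def eq sets.empty_sets)
qed

text \<open>For a fixed index and a fixed list \<open>z\<close> the class enters only through the
  membership of \<open>xs\<close> and of \<open>z\<close> in the fibre.\<close>

lemma conditions_measurable: "(\<lambda>c. conditions c j z) \<in> borel_measurable \<mu>"
proof -
  obtain t xs p where j: "from_nat_into (constraint_index Orb) j = (t, xs, p)" by (cases "from_nat_into (constraint_index Orb) j")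
  note [measurable] = ordered_sets
  consider "t = 0" | "t = 1" | "t = 2" | "t = 3" | "t > 3" by linarith
  then show ?thesis
    unfolding conditions_def j constraint_def by cases simp_all
qed

lemma from_nat_index: "from_nat_into (constraint_index Orb) j \<in> constraint_index Orb"
  by (rule from_nat_into[OF constraint_index_props(2)])

lemma conditions_props:
  assumes "c \<in> space \<mu>"
  shows "{i. conditions c j i \<noteq> 0} \<subseteq> NG_lists" "fsupp (conditions c j)"
proof -
  interpret bounded_orbit_complex G Orb "\<Psi> c" D by (rule fibre[OF assms])
  obtain t xs p where j: "from_nat_into (constraint_index Orb) j = (t, xs, p)" by (cases "from_nat_into (constraint_index Orb) j")
  then have j': "(t, xs, p) \<in> constraint_index Orb" using from_nat_index[of j] by simp
  show "{i. conditions c j i \<noteq> 0} \<subseteq> NG_lists" "fsupp (conditions c j)"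
    unfolding conditions_def j by (rule constraint_support[OF j'], rule constraint_fsupp)
qed

lemma fibre_space_iff:
  assumes "c \<in> space \<mu>"
  shows "f \<in> fibre_space c \<longleftrightarrow> ell2 f \<and> {z. f z \<noteq> 0} \<subseteq> NG_lists \<and> (\<forall>j. ip f (conditions c j) = 0)"
proof -
  interpret bounded_orbit_complex G Orb "\<Psi> c" D by (rule fibre[OF assms])
  have "(\<forall>j\<in>constraint_index Orb. ip f (constraint G \<kappa> (\<Psi> c) n j) = 0) \<longleftrightarrow> (\<forall>j. ip f (conditions c j) = 0)"
    unfolding conditions_def
    using from_nat_into_surj[OF constraint_index_props(1)] from_nat_index by metis
  then show ?thesis unfolding iso_harmonic_constraints by simp
qed

lemma xi_props:
  assumes "set xs \<subseteq> NG Orb"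
  shows "fsupp (xi \<Psi> xs c)" "{z. xi \<Psi> xs c z \<noteq> 0} \<subseteq> NG_lists" "(\<lambda>c. xi \<Psi> xs c z) \<in> borel_measurable \<mu>"
proof -
  show "fsupp (xi \<Psi> xs c)" by (simp add: xi_def oriented_simplex_fsupp)
  have "set ys \<subseteq> NG Orb" if "oriented_simplex xs ys \<noteq> 0" for ys
    using oriented_simplex_support[of xs] that assms by (auto simp: subset_iff)
  then show "{z. xi \<Psi> xs c z \<noteq> 0} \<subseteq> NG_lists" by (auto simp: xi_def split: if_splits)
  note [measurable] = simplex_pred
  have "(\<lambda>c. if set xs \<in> \<Psi> c then oriented_simplex xs z else 0) \<in> borel_measurable \<mu>" by measurable
  then show "(\<lambda>c. xi \<Psi> xs c z) \<in> borel_measurable \<mu>" by (simp add: xi_def if_distrib[of "\<lambda>f. f z"] cong: if_cong)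
qed

text \<open>\<open>lproj\<close> is orthogonal to all conditions and so lies in the fibre space;
  what it removes is orthogonal to everything that satisfies them.\<close>

lemma fibre_proj_props:
  assumes xs: "set xs \<subseteq> NG Orb" and c: "c \<in> space \<mu>"
  shows "fibre_proj xs c \<in> fibre_space c"
    "f \<in> fibre_space c \<Longrightarrow> ip (\<lambda>i. xi \<Psi> xs c i - fibre_proj xs c i) f = 0"
  unfolding fibre_space_iff[OF c] fibre_proj_def
  using lproj_ell2[of "conditions c" "xi \<Psi> xs c"] lproj_support[of "conditions c" NG_lists "xi \<Psi> xs c"]
    lproj_orth[of "conditions c" "xi \<Psi> xs c"] lproj_diff_orth[of "conditions c" "xi \<Psi> xs c" f]
    conditions_props[OF c] xi_props[OF xs]
  by blast+

lemma fibre_proj_measurable: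
  assumes xs: "set xs \<subseteq> NG Orb" and z: "z \<in> NG_lists"
  shows "(\<lambda>c. fibre_proj xs c z) \<in> borel_measurable \<mu>"
  unfolding fibre_proj_def
  by (rule borel_measurable_lproj[where u = conditions and x = "xi \<Psi> xs", OF countable_lists_NG conditions_measurable
        conditions_props xi_props(3)[OF xs] xi_props(2)[OF xs] xi_props(1)[OF xs] z])

lemma fibre_space_chains: "c \<in> space \<mu> \<Longrightarrow> f \<in> fibre_space c \<Longrightarrow> f \<in> l2_chains (\<Psi> c) n"
  by (simp add: iso_harmonic_def harmonic_def)

definition Delta_lists :: "('g, 'x) nvert list set" where
  "Delta_lists = {xs \<in> ordered_simplices (Delta D Orb). length xs = n + 1}"

lemma Delta_lists_NG: "xs \<in> Delta_lists \<Longrightarrow> set xs \<subseteq> NG Orb"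
  by (auto simp: Delta_lists_def ordered_simplices_def Delta_def)

lemma xi_chain:
  assumes "xs \<in> Delta_lists"
  shows "xi \<Psi> xs c \<in> l2_chains (\<Psi> c) n"
  using assms oriented_simplex_chain[of xs "\<Psi> c" n]
  by (auto simp: xi_def l2_chains_zero Delta_lists_def ordered_simplices_def)

text \<open>Through this evaluation, measurability of a field against the fundamental sequence is
  measurability of its coordinates.\<close>

lemma chain_inner_xi:
  assumes xs: "xs \<in> Delta_lists" and f: "f \<in> l2_chains (\<Psi> c) n"
  shows "chain_inner (\<Psi> c) f (xi \<Psi> xs c) = f xs"
proof (cases "set xs \<in> \<Psi> c")
  case True
  then show ?thesis using chain_inner_oriented_simplex[OF f, of xs] xs by (simp add: xi_def Delta_lists_def)
next
  case False
  then have "f xs = 0" using f by (auto simp: l2_chains_iff chain_supported_def ordered_simplices_def)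
  then show ?thesis using False by (simp add: xi_def chain_inner_def)
qed

lemma chain_inner_ip:
  assumes "f \<in> l2_chains (\<Psi> c) n"
  shows "chain_inner (\<Psi> c) f h = ip f h / fact (n + 1)"
  using assms by (intro chain_inner_eq) (simp add: l2_chains_iff)

lemma chains_support:
  assumes "c \<in> space \<mu>" "f \<in> l2_chains (\<Psi> c) n"
  shows "{z. f z \<noteq> 0} \<subseteq> Delta_lists"
  using assms Delta by (fastforce simp: l2_chains_iff chain_supported_def Delta_lists_def ordered_simplices_def)

section \<open>Square-integrable fields of chains\<close>

abbreviation "chain_fields \<equiv> l2_fields D Orb \<Psi> n \<mu>"

lemma fields_chains: "F \<in> chain_fields \<Longrightarrow> c \<in> space \<mu> \<Longrightarrow> F c \<in> l2_chains (\<Psi> c) n"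
  by (simp add: l2_fields_def)

lemma fields_ell2: "F \<in> chain_fields \<Longrightarrow> c \<in> space \<mu> \<Longrightarrow> ell2 (F c)"
  using fields_chains by (simp add: l2_chains_iff)

lemma fields_measurable:
  assumes "F \<in> chain_fields" "z \<in> Delta_lists"
  shows "(\<lambda>c. F c z) \<in> borel_measurable \<mu>"
proof -
  have "(\<lambda>c. chain_inner (\<Psi> c) (F c) (xi \<Psi> z c)) \<in> borel_measurable \<mu>"
    using assms by (simp add: l2_fields_def Delta_lists_def)
  moreover have "chain_inner (\<Psi> c) (F c) (xi \<Psi> z c) = F c z" if "c \<in> space \<mu>" for c
    by (rule chain_inner_xi[OF assms(2) fields_chains[OF assms(1) that]])
  ultimately show ?thesis by (simp cong: measurable_cong)
qed

lemma countable_Delta_lists: "countable Delta_lists"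
  using Delta_lists_NG by (intro countable_subset[OF _ countable_lists_NG]) auto

lemma inner_measurable:
  assumes "\<And>z. z \<in> Delta_lists \<Longrightarrow> (\<lambda>c. F c z) \<in> borel_measurable \<mu>"
    "\<And>z. z \<in> Delta_lists \<Longrightarrow> (\<lambda>c. F' c z) \<in> borel_measurable \<mu>"
    "\<And>c. c \<in> space \<mu> \<Longrightarrow> F c \<in> l2_chains (\<Psi> c) n" "\<And>c. c \<in> space \<mu> \<Longrightarrow> F' c \<in> l2_chains (\<Psi> c) n"
  shows "(\<lambda>c. chain_inner (\<Psi> c) (F c) (F' c)) \<in> borel_measurable \<mu>"
proof -
  have "(\<lambda>c. ip (F c) (F' c)) \<in> borel_measurable \<mu>"
    using assms(3,4) by (intro borel_measurable_ip[OF countable_Delta_lists assms(1,2) chains_support])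
      (auto simp: l2_chains_iff)
  then have "(\<lambda>c. ip (F c) (F' c) / fact (n + 1)) \<in> borel_measurable \<mu>"
    by (intro borel_measurable_divide) auto
  then show ?thesis using chain_inner_ip[OF assms(3)] by (simp cong: measurable_cong)
qed

lemma inner_integrable:
  assumes F: "F \<in> chain_fields" and F': "F' \<in> chain_fields"
  shows "integrable \<mu> (\<lambda>c. chain_inner (\<Psi> c) (F c) (F' c))"
proof (rule Bochner_Integration.integrable_bound)
  show "integrable \<mu> (\<lambda>c. norm (chain_inner (\<Psi> c) (F c) (F c)) + norm (chain_inner (\<Psi> c) (F' c) (F' c)))"
    using F F' by (intro Bochner_Integration.integrable_add integrable_norm) (auto simp: l2_fields_def)
  show "(\<lambda>c. chain_inner (\<Psi> c) (F c) (F' c)) \<in> borel_measurable \<mu>"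
    by (intro inner_measurable fields_measurable fields_chains F F')
  show "AE c in \<mu>. norm (chain_inner (\<Psi> c) (F c) (F' c))
      \<le> norm (norm (chain_inner (\<Psi> c) (F c) (F c)) + norm (chain_inner (\<Psi> c) (F' c) (F' c)))"
  proof (rule AE_I2)
    fix c assume c: "c \<in> space \<mu>"
    note e = fields_ell2[OF F c] fields_ell2[OF F' c]
    have "cmod (ip (F c) (F' c)) \<le> (1 * nsq (F c) + nsq (F' c) / 1) / 2" by (rule ip_bound[OF e]) simp
    also have "\<dots> \<le> nsq (F c) + nsq (F' c)" using nsq_nonneg[of "F c"] nsq_nonneg[of "F' c"] by simp
    also have "\<dots> = cmod (ip (F c) (F c)) + cmod (ip (F' c) (F' c))"
      by (simp add: ip_self e nsq_nonneg)
    finally have "cmod (ip (F c) (F' c)) / fact (n + 1) \<le>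
        (cmod (ip (F c) (F c)) + cmod (ip (F' c) (F' c))) / fact (n + 1)"
      by (rule divide_right_mono) simp
    then show "norm (chain_inner (\<Psi> c) (F c) (F' c))
      \<le> norm (norm (chain_inner (\<Psi> c) (F c) (F c)) + norm (chain_inner (\<Psi> c) (F' c) (F' c)))"
      by (simp add: chain_inner_ip[OF fields_chains[OF F c]] chain_inner_ip[OF fields_chains[OF F' c]]
          norm_divide add_divide_distrib del: fact_Suc)
  qed
qed

lemma fieldsI:
  assumes "\<And>c. c \<in> space \<mu> \<Longrightarrow> F c \<in> l2_chains (\<Psi> c) n"
    "\<And>z. z \<in> Delta_lists \<Longrightarrow> (\<lambda>c. F c z) \<in> borel_measurable \<mu>"
    "\<And>c. c \<in> space \<mu> \<Longrightarrow> nsq (F c) \<le> B"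
  shows "F \<in> chain_fields"
  unfolding l2_fields_def
proof (intro CollectI conjI ballI impI)
  show "F c \<in> l2_chains (\<Psi> c) n" if "c \<in> space \<mu>" for c by (rule assms(1)[OF that])
  show "(\<lambda>c. chain_inner (\<Psi> c) (F c) (xi \<Psi> xs c)) \<in> borel_measurable \<mu>"
    if "xs \<in> ordered_simplices (Delta D Orb)" "length xs = n + 1" for xs
  proof -
    have xs: "xs \<in> Delta_lists" using that by (simp add: Delta_lists_def)
    then show ?thesis using assms(2)[OF xs] chain_inner_xi[OF xs assms(1)] by (simp cong: measurable_cong)
  qed
  show "integrable \<mu> (\<lambda>c. chain_inner (\<Psi> c) (F c) (F c))"
  proof (rule integrable_const_bound)
    show "(\<lambda>c. chain_inner (\<Psi> c) (F c) (F c)) \<in> borel_measurable \<mu>"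
      by (intro inner_measurable assms)
    show "AE c in \<mu>. norm (chain_inner (\<Psi> c) (F c) (F c)) \<le> B / fact (n + 1)"
    proof (rule AE_I2)
      fix c assume c: "c \<in> space \<mu>"
      have "ell2 (F c)" using assms(1)[OF c] by (simp add: l2_chains_iff)
      then have "norm (chain_inner (\<Psi> c) (F c) (F c)) = nsq (F c) / fact (n + 1)"
        by (simp add: chain_inner_ip[OF assms(1)[OF c]] ip_self norm_divide nsq_nonneg del: fact_Suc)
      then show "norm (chain_inner (\<Psi> c) (F c) (F c)) \<le> B / fact (n + 1)"
        using divide_right_mono[OF assms(3)[OF c], of "fact (n + 1)"] by (simp del: fact_Suc)
    qed
  qed
qed

lemma nsq_xi:
  assumes "xs \<in> Delta_lists"
  shows "nsq (xi \<Psi> xs c) \<le> fact (n + 1) * fact (n + 1)"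
proof (cases "set xs \<in> \<Psi> c")
  case True
  have len: "length xs = n + 1" using assms by (simp add: Delta_lists_def)
  have "of_real (nsq (xi \<Psi> xs c)) = fact (n + 1) * oriented_simplex xs xs"
    using True ip_oriented_simplex[OF oriented_simplex_alternating, of xs xs] len
    by (simp add: ip_self[symmetric] ell2_fsupp oriented_simplex_fsupp xi_def del: fact_Suc)
  then have "cmod (of_real (nsq (xi \<Psi> xs c))) = fact (n + 1) * cmod (oriented_simplex xs xs)"
    by (simp add: norm_mult del: fact_Suc)
  also have "\<dots> \<le> fact (n + 1) * fact (n + 1)"
    using oriented_simplex_bound[of xs xs] by (simp add: len del: fact_Suc)
  finally show ?thesis using nsq_nonneg[of "xi \<Psi> xs c"] by (simp del: fact_Suc)
next
  case False
  then have "nsq (xi \<Psi> xs c) = 0" by (simp add: xi_def nsq_def)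
  then show ?thesis by (simp del: fact_Suc)
qed

text \<open>For an orthogonal projection P the product of Px with x is the squared norm of Px. Hence
  diagonal entries are real and nonnegative, and Pythagoras bounds them.\<close>

lemma nsq_fibre_proj:
  assumes xs: "xs \<in> Delta_lists" and c: "c \<in> space \<mu>"
  shows "nsq (fibre_proj xs c) \<le> fact (n + 1) * fact (n + 1)"
    "fibre_proj xs c xs = of_real (nsq (fibre_proj xs c) / fact (n + 1))"
    "diag xs c = nsq (fibre_proj xs c) / fact (n + 1)"
proof -
  let ?q = "fibre_proj xs c" and ?x = "xi \<Psi> xs c"
  note q = fibre_proj_props[OF Delta_lists_NG[OF xs] c]
  have x: "ell2 ?x" using xi_chain[OF xs] by (simp add: l2_chains_iff)
  have qe: "ell2 ?q" using q(1) by (rule iso_harmonic_ell2)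
  have "nsq (\<lambda>i. ?x i - ?q i) = nsq ?x - nsq ?q" by (rule nsq_diff[OF x qe q(2)[OF q(1)]])
  then show "nsq ?q \<le> fact (n + 1) * fact (n + 1)"
    using nsq_xi[OF xs, of c] nsq_nonneg[of "\<lambda>i. ?x i - ?q i"] by linarith
  have "ip ?x ?q = ip ?q ?q" using q(2)[OF q(1)] x qe by (simp add: ip_diff_left)
  then have "ip ?q ?x = of_real (nsq ?q)" by (subst ip_cnj) (simp add: ip_self qe)
  then show val: "?q xs = of_real (nsq ?q / fact (n + 1))"
    using chain_inner_xi[OF xs fibre_space_chains[OF c q(1)]] chain_inner_ip[OF fibre_space_chains[OF c q(1)], of ?x]
    by (simp del: fact_Suc)
  show "diag xs c = nsq ?q / fact (n + 1)"
  proof (cases "set xs \<in> \<Psi> c")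
    case True
    then have "harmonic_diag (fibre_space c) xs = Re (?q xs)"
      using q by (intro harmonic_diag_eq iso_harmonic_diff iso_harmonic_ell2) (auto simp: xi_def)
    then have "harmonic_diag (fibre_space c) xs = nsq ?q / fact (n + 1)"
      unfolding val Re_complex_of_real .
    then show ?thesis using True by (simp only: diag_def if_True)
  next
    case False
    \<comment> \<open>The projection is a chain on the fibre and \<open>xs\<close> is not a simplex
      there, so the value agrees with the default of \<open>diag\<close>.\<close>
    then have "?q xs = 0"
      using fibre_space_chains[OF c q(1)] by (auto simp: l2_chains_iff chain_supported_def ordered_simplices_def)
    then have "nsq ?q / fact (n + 1) = 0" using val by (metis of_real_eq_0_iff)
    then show ?thesis using False by (simp only: diag_def if_False)
  qed
qed

lemma diag_bounds:
  assumes "xs \<in> Delta_lists" "c \<in> space \<mu>"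
  shows "0 \<le> diag xs c" "diag xs c \<le> fact (n + 1)"
proof -
  show "0 \<le> diag xs c"
    unfolding nsq_fibre_proj(3)[OF assms] by (intro divide_nonneg_nonneg nsq_nonneg) simp
  have "diag xs c \<le> fact (n + 1) * fact (n + 1) / fact (n + 1)"
    unfolding nsq_fibre_proj(3)[OF assms] by (intro divide_right_mono nsq_fibre_proj(1)[OF assms]) simp
  then show "diag xs c \<le> fact (n + 1)" by simp
qed

lemma diag_measurable:
  assumes "xs \<in> Delta_lists"
  shows "diag xs \<in> borel_measurable \<mu>"
proof -
  have "(\<lambda>c. Re (fibre_proj xs c xs)) \<in> borel_measurable \<mu>"
  proof -
    have [measurable]: "(\<lambda>c. fibre_proj xs c xs) \<in> borel_measurable \<mu>"
      using Delta_lists_NG[OF assms] by (intro fibre_proj_measurable) simp_all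
    show ?thesis by measurable
  qed
  moreover have "Re (fibre_proj xs c xs) = diag xs c" if "c \<in> space \<mu>" for c
    unfolding nsq_fibre_proj(2,3)[OF assms that] by (rule Re_complex_of_real)
  ultimately show ?thesis by (simp cong: measurable_cong)
qed

lemma xi_field: "xs \<in> Delta_lists \<Longrightarrow> xi \<Psi> xs \<in> chain_fields"
  using xi_props(3)[OF Delta_lists_NG] by (intro fieldsI[OF xi_chain _ nsq_xi]) auto

lemma fibre_proj_field:
  assumes "xs \<in> Delta_lists"
  shows "fibre_proj xs \<in> chain_fields"
  using Delta_lists_NG[OF assms] Delta_lists_NG
  by (intro fieldsI[OF fibre_space_chains[OF _ fibre_proj_props(1)] fibre_proj_measurable nsq_fibre_proj(1)[OF assms]]) auto

lemma field_inner_diff_left: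
  assumes "F \<in> chain_fields" "F' \<in> chain_fields" "H \<in> chain_fields"
  shows "field_inner \<Psi> \<mu> (\<lambda>c xs. F c xs - F' c xs) H = field_inner \<Psi> \<mu> F H - field_inner \<Psi> \<mu> F' H"
proof -
  have "field_inner \<Psi> \<mu> (\<lambda>c xs. F c xs - F' c xs) H =
      (\<integral>c. chain_inner (\<Psi> c) (F c) (H c) - chain_inner (\<Psi> c) (F' c) (H c) \<partial>\<mu>)"
    unfolding field_inner_def
  proof (rule Bochner_Integration.integral_cong[OF refl])
    fix c assume c: "c \<in> space \<mu>"
    note k = fields_chains[OF assms(1) c] fields_chains[OF assms(2) c]
    show "chain_inner (\<Psi> c) (\<lambda>xs. F c xs - F' c xs) (H c) =
      chain_inner (\<Psi> c) (F c) (H c) - chain_inner (\<Psi> c) (F' c) (H c)"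
      unfolding chain_inner_ip[OF k(1)] chain_inner_ip[OF k(2)] chain_inner_ip[OF l2_chains_diff[OF k]]
      using assms fields_ell2 c by (simp add: ip_diff_left diff_divide_distrib del: fact_Suc)
  qed
  also have "\<dots> = field_inner \<Psi> \<mu> F H - field_inner \<Psi> \<mu> F' H"
    unfolding field_inner_def by (intro Bochner_Integration.integral_diff inner_integrable assms)
  finally show ?thesis .
qed

lemma field_inner_cnj:
  assumes "F \<in> chain_fields" "F' \<in> chain_fields"
  shows "field_inner \<Psi> \<mu> F' F = cnj (field_inner \<Psi> \<mu> F F')"
proof -
  have "chain_inner (\<Psi> c) (F' c) (F c) = cnj (chain_inner (\<Psi> c) (F c) (F' c))" if "c \<in> space \<mu>" for c
    unfolding chain_inner_ip[OF fields_chains[OF assms(1) that]] chain_inner_ip[OF fields_chains[OF assms(2) that]]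
    by (subst ip_cnj) (simp del: fact_Suc)
  then show ?thesis
    unfolding field_inner_def by (simp cong: Bochner_Integration.integral_cong)
qed

lemma field_inner_self:
  assumes "F \<in> chain_fields"
  shows "cnj (field_inner \<Psi> \<mu> F F) = field_inner \<Psi> \<mu> F F"
  using field_inner_cnj[OF assms assms] by simp

text \<open>\<open>orth_proj\<close> is some choice, fixed only up to null sets, so its values
  cannot be computed. The measurable fibrewise projection shows that the choice succeeds, and
  testing the two against each other shows that they have the same product with
  \<open>xi\<close>.\<close>

lemma orth_proj_inner:
  assumes K: "K = {F \<in> chain_fields. AE c in \<mu>. F c \<in> fibre_space c}" and xs: "xs \<in> Delta_lists"
  shows "field_inner \<Psi> \<mu> (orth_proj \<Psi> \<mu> K (xi \<Psi> xs)) (xi \<Psi> xs) = of_real (\<integral>c. diag xs c \<partial>\<mu>)"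
proof -
  let ?x = "xi \<Psi> xs" and ?Q = "fibre_proj xs" and ?ip = "field_inner \<Psi> \<mu>"
  have x: "?x \<in> chain_fields" by (rule xi_field[OF xs])
  have Qf: "?Q \<in> chain_fields" by (rule fibre_proj_field[OF xs])
  have Q: "?Q \<in> K" unfolding K using Qf fibre_proj_props(1)[OF Delta_lists_NG[OF xs]] by (auto intro: AE_I2)
  have Qo: "?ip (\<lambda>c xs. ?x c xs - ?Q c xs) R = 0" if R: "R \<in> K" for R
  proof -
    have "AE c in \<mu>. chain_inner (\<Psi> c) (\<lambda>xs. ?x c xs - ?Q c xs) (R c) = 0"
    proof -
      have "AE c in \<mu>. R c \<in> fibre_space c" using R by (simp add: K)
      then show ?thesis
      proof (rule AE_mp, intro AE_I2 impI)
        fix c assume c: "c \<in> space \<mu>" and r: "R c \<in> fibre_space c"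
        show "chain_inner (\<Psi> c) (\<lambda>xs. ?x c xs - ?Q c xs) (R c) = 0"
          using fibre_proj_props(2)[OF Delta_lists_NG[OF xs] c r]
            chain_inner_ip[OF l2_chains_diff[OF fields_chains[OF x c] fields_chains[OF Qf c]], of "R c"]
          by (simp del: fact_Suc)
      qed
    qed
    then show ?thesis unfolding field_inner_def by (rule integral_eq_zero_AE)
  qed
  define P where "P = orth_proj \<Psi> \<mu> K ?x"
  have P: "P \<in> K \<and> (\<forall>R\<in>K. ?ip (\<lambda>c xs. ?x c xs - P c xs) R = 0)"
    unfolding P_def orth_proj_def by (rule someI[of _ ?Q]) (use Q Qo in auto)
  then have Pf: "P \<in> chain_fields" by (simp add: K)
  \<comment> \<open>Each of \<open>P\<close> and \<open>?Q\<close> satisfies the projection identity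
    against both; with conjugate symmetry this forces the product of \<open>P\<close> with
    \<open>?x\<close> to be that of \<open>?x\<close> with \<open>?Q\<close>.\<close>
  have "?ip ?x ?Q = ?ip P ?Q" "?ip ?x P = ?ip P P" "?ip ?x P = ?ip ?Q P" "?ip ?x ?Q = ?ip ?Q ?Q"
    using P Q Qo[of P] Qo[of ?Q] field_inner_diff_left[OF x Pf Qf] field_inner_diff_left[OF x Pf Pf]
      field_inner_diff_left[OF x Qf Pf] field_inner_diff_left[OF x Qf Qf] by auto
  then have "?ip P ?x = ?ip ?x ?Q"
    using field_inner_cnj[OF x Pf] field_inner_cnj[OF Pf Qf] field_inner_self[OF Pf] field_inner_self[OF Qf]
    by metis
  also have "\<dots> = cnj (?ip ?Q ?x)" by (rule field_inner_cnj[OF Qf x])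
  also have "?ip ?Q ?x = (\<integral>c. of_real (diag xs c) \<partial>\<mu>)"
    unfolding field_inner_def
  proof (rule Bochner_Integration.integral_cong[OF refl])
    fix c assume c: "c \<in> space \<mu>"
    have "chain_inner (\<Psi> c) (?Q c) (?x c) = ?Q c xs" by (rule chain_inner_xi[OF xs fields_chains[OF Qf c]])
    then show "chain_inner (\<Psi> c) (?Q c) (?x c) = of_real (diag xs c)"
      using nsq_fibre_proj(2,3)[OF xs c] by simp
  qed
  finally show ?thesis by (simp add: P_def)
qed

definition star_sum :: "('g, 'x) nvert \<Rightarrow> 'g rclass \<Rightarrow> real" where
  "star_sum v c = (\<Sum>s | s \<in> \<Psi> c \<and> card s = n + 1 \<and> v \<in> s. harmonic_diag (fibre_space c) (orient s))"

text \<open>With the integral moved outside all sums of the trace, a number is attached to each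
  single class, and the two sides can be compared pointwise.\<close>

definition trace_density :: "'g rclass \<Rightarrow> real" where
  "trace_density c = (\<Sum>X\<in>Orb. \<Sum>x\<in>fst X. star_sum (0, X, x) c / (card (fst X) * (n + 1)))"

abbreviation "star v \<equiv> {s. s \<in> Delta D Orb \<and> card s = n + 1 \<and> v \<in> s}"

lemma orient_props:
  assumes "finite s"
  shows "distinct (orient s)" "set (orient s) = s"
  using someI_ex[OF finite_distinct_list[OF assms]] by (auto simp: orient_def conj_commute)

lemma star_orient:
  assumes "s \<in> star v"
  shows "orient s \<in> Delta_lists"
    "diag (orient s) c = (if s \<in> \<Psi> c then harmonic_diag (fibre_space c) (orient s) else 0)"
proof -
  have "finite s" using assms by (simp add: Delta_def)
  note o = orient_props[OF this]
  show "orient s \<in> Delta_lists"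
    using o assms distinct_card[of "orient s"] by (auto simp: Delta_lists_def ordered_simplices_def)
  show "diag (orient s) c = (if s \<in> \<Psi> c then harmonic_diag (fibre_space c) (orient s) else 0)"
    using o by (simp add: diag_def)
qed

lemma countable_star: "countable (star v)"
  by (rule countable_subset[OF _ countable_Collect_finite_subset[OF countable_NG]]) (auto simp: Delta_def)

text \<open>Entries are at most (n+1)! and at most 2^D simplices of the fibre contain
  \<open>v\<close>. The bound is independent of the class and dominates all partial sums.\<close>

lemma diag_sum_bound:
  assumes F: "finite F" "F \<subseteq> star v" and c: "c \<in> space \<mu>"
  shows "(\<Sum>s\<in>F. diag (orient s) c) \<le> 2 ^ D * fact (n + 1)"
proof -
  interpret bounded_orbit_complex G Orb "\<Psi> c" D by (rule fibre[OF c])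
  have "(\<Sum>s\<in>F. diag (orient s) c) = (\<Sum>s\<in>F \<inter> \<Psi> c. diag (orient s) c)"
  proof (intro sum.mono_neutral_right ballI)
    fix s assume "s \<in> F - F \<inter> \<Psi> c"
    then show "diag (orient s) c = 0" using star_orient(2)[of s v c] F by auto
  qed (use F in auto)
  also have "\<dots> \<le> (\<Sum>s\<in>F \<inter> \<Psi> c. fact (n + 1))"
    using F star_orient(1) by (intro sum_mono diag_bounds c) blast
  also have "\<dots> = real (card (F \<inter> \<Psi> c)) * fact (n + 1)" by (simp del: fact_Suc)
  also have "\<dots> \<le> 2 ^ D * fact (n + 1)"
  proof (rule mult_right_mono)
    have "card (F \<inter> \<Psi> c) \<le> card {\<sigma>\<in>\<Psi> c. v \<in> \<sigma>}" using F star_bound by (intro card_mono) auto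
    also have "\<dots> \<le> 2 ^ D" by (rule star_bound)
    finally show "real (card (F \<inter> \<Psi> c)) \<le> 2 ^ D" by (metis of_nat_le_iff of_nat_numeral of_nat_power)
  qed simp
  finally show ?thesis .
qed

text \<open>The trace runs over all simplices of the universal complex at \<open>v\<close>, of which
  one fibre contains only finitely many.\<close>

lemma star_sum_eq:
  assumes c: "c \<in> space \<mu>"
  shows "((\<lambda>s. diag (orient s) c) has_sum star_sum v c) (star v)"
proof -
  interpret bounded_orbit_complex G Orb "\<Psi> c" D by (rule fibre[OF c])
  let ?T = "{s. s \<in> \<Psi> c \<and> card s = n + 1 \<and> v \<in> s}"
  have fin: "finite ?T" using star_bound(1)[of v] by (rule rev_finite_subset) auto
  have sub: "?T \<subseteq> star v" using Delta[OF c] by auto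
  have "((\<lambda>s. diag (orient s) c) has_sum (\<Sum>s\<in>?T. diag (orient s) c)) (star v)"
    by (rule has_sum_finite_neutralI[OF fin sub _ refl]) (auto simp: star_orient(2))
  also have "(\<Sum>s\<in>?T. diag (orient s) c) = star_sum v c"
    unfolding star_sum_def using star_orient(2)[of _ v c] sub by (intro sum.cong refl) auto
  finally show ?thesis .
qed

lemma star_sum_measurable: "star_sum v \<in> borel_measurable \<mu>"
proof -
  have "(\<lambda>c. \<Sum>\<^sub>\<infinity>s\<in>star v. diag (orient s) c) \<in> borel_measurable \<mu>"
    using star_sum_eq by (intro borel_measurable_infsum_countable countable_star diag_measurable star_orient(1) has_sum_imp_summable)
  then show ?thesis using infsumI[OF star_sum_eq] by (simp cong: measurable_cong)
qed

lemma star_sum_integral: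
  shows "((\<lambda>s. \<integral>c. diag (orient s) c \<partial>\<mu>) has_sum (\<integral>c. star_sum v c \<partial>\<mu>)) (star v)"
    and "integrable \<mu> (star_sum v)"
proof -
  have "((\<lambda>s. \<integral>c. diag (orient s) c \<partial>\<mu>) has_sum (\<integral>c. (\<Sum>\<^sub>\<infinity>s\<in>star v. diag (orient s) c) \<partial>\<mu>)) (star v)"
    by (intro has_sum_integral_bounded[OF countable_star diag_measurable diag_bounds(1) diag_sum_bound] star_orient(1))
  also have "(\<integral>c. (\<Sum>\<^sub>\<infinity>s\<in>star v. diag (orient s) c) \<partial>\<mu>) = (\<integral>c. star_sum v c \<partial>\<mu>)"
    using infsumI[OF star_sum_eq] by (simp cong: Bochner_Integration.integral_cong)
  finally show "((\<lambda>s. \<integral>c. diag (orient s) c \<partial>\<mu>) has_sum (\<integral>c. star_sum v c \<partial>\<mu>)) (star v)" .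
  show "integrable \<mu> (star_sum v)"
  proof (rule integrable_const_bound[of _ "2 ^ D * fact (n + 1)"])
    show "AE c in \<mu>. norm (star_sum v c) \<le> 2 ^ D * fact (n + 1)"
    proof (rule AE_I2)
      fix c assume c: "c \<in> space \<mu>"
      have "0 \<le> star_sum v c"
        by (rule has_sum_nonneg[OF star_sum_eq[OF c]]) (intro diag_bounds(1) star_orient(1) c)
      moreover have "star_sum v c \<le> 2 ^ D * fact (n + 1)"
        by (rule has_sum_le_finite_sums[OF star_sum_eq[OF c]]) (rule diag_sum_bound[OF _ _ c])
      ultimately show "norm (star_sum v c) \<le> 2 ^ D * fact (n + 1)" by simp
    qed
  qed (rule star_sum_measurable)
qed

lemma trace_density_measurable: "trace_density \<in> borel_measurable \<mu>"
  unfolding trace_density_def by (intro borel_measurable_sum borel_measurable_divide star_sum_measurable borel_measurable_const)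

lemma vN_dim_eq:
  assumes K: "K = {F \<in> chain_fields. AE c in \<mu>. F c \<in> fibre_space c}"
  shows "vN_dim D Orb \<Psi> n \<mu> K = of_real (\<integral>c. trace_density c \<partial>\<mu>)"
proof -
  have "(\<Sum>\<^sub>\<infinity>s\<in>star v. field_inner \<Psi> \<mu> (orth_proj \<Psi> \<mu> K (xi \<Psi> (orient s))) (xi \<Psi> (orient s)) / a) =
    of_real (\<integral>c. star_sum v c \<partial>\<mu>) / a" for v and a :: complex
  proof -
    have "((\<lambda>s. of_real (\<integral>c. diag (orient s) c \<partial>\<mu>) / a) has_sum of_real (\<integral>c. star_sum v c \<partial>\<mu>) / a) (star v)"
      by (intro has_sum_divide_const has_sum_of_real star_sum_integral)
    moreover have "(\<Sum>\<^sub>\<infinity>s\<in>star v. field_inner \<Psi> \<mu> (orth_proj \<Psi> \<mu> K (xi \<Psi> (orient s))) (xi \<Psi> (orient s)) / a) =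
        (\<Sum>\<^sub>\<infinity>s\<in>star v. of_real (\<integral>c. diag (orient s) c \<partial>\<mu>) / a)"
      by (intro infsum_cong) (simp only: orth_proj_inner[OF K star_orient(1)])
    ultimately show ?thesis by (simp add: infsumI)
  qed
  then have "vN_dim D Orb \<Psi> n \<mu> K = of_real (\<Sum>X\<in>Orb. \<Sum>x\<in>fst X.
      (\<integral>c. star_sum (0, X, x) c \<partial>\<mu>) / (card (fst X) * (n + 1)))"
    unfolding vN_dim_def vN_trace_def by (simp add: distrib_left)
  also have "(\<Sum>X\<in>Orb. \<Sum>x\<in>fst X. (\<integral>c. star_sum (0, X, x) c \<partial>\<mu>) / (card (fst X) * (n + 1))) =
      (\<integral>c. trace_density c \<partial>\<mu>)"
    unfolding trace_density_def
    by (subst Bochner_Integration.integral_sum; (subst Bochner_Integration.integral_sum)?)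
      (auto intro!: Bochner_Integration.integrable_sum integrable_divide star_sum_integral(2))
  finally show ?thesis .
qed

end

section \<open>Isomorphisms and isomorphism classes\<close>

text \<open>An action is a homomorphism into \<open>BijGroup\<close>. Bijectivity comes from the
  inverse element, and equality there is equality of extensional functions, hence the first
  condition on the maps.\<close>

lemma group_actionI:
  fixes G (structure)
  assumes "group G"
    and ext: "\<And>g. g \<in> carrier G \<Longrightarrow> \<phi> g \<in> extensional E"
    and closed: "\<And>g x. g \<in> carrier G \<Longrightarrow> x \<in> E \<Longrightarrow> \<phi> g x \<in> E"
    and one: "\<And>x. x \<in> E \<Longrightarrow> \<phi> \<one> x = x"
    and mult: "\<And>g h x. g \<in> carrier G \<Longrightarrow> h \<in> carrier G \<Longrightarrow> x \<in> E \<Longrightarrow> \<phi> (g \<otimes> h) x = \<phi> g (\<phi> h x)"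
  shows "group_action G E \<phi>"
proof -
  interpret group G by fact
  have inv1: "\<phi> (inv g) (\<phi> g x) = x" "\<phi> g (\<phi> (inv g) x) = x" if "g \<in> carrier G" "x \<in> E" for g x
    using that one by (simp_all flip: mult)
  have bij: "\<phi> g \<in> Bij E" if g: "g \<in> carrier G" for g
    unfolding Bij_def using ext[OF g] inv1[OF g] closed g
    by (auto intro!: bij_betw_byWitness[of E "\<phi> (inv g)" "\<phi> g" E])
  have "\<phi> \<in> hom G (BijGroup E)"
  proof (rule homI)
    fix g h assume gh: "g \<in> carrier G" "h \<in> carrier G"
    show "\<phi> (g \<otimes> h) = \<phi> g \<otimes>\<^bsub>BijGroup E\<^esub> \<phi> h"
    proof (rule extensionalityI[of _ E])
      show "\<phi> (g \<otimes> h) \<in> extensional E" using ext gh by simp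
    qed (use gh bij mult in \<open>auto simp: BijGroup_def compose_def\<close>)
  qed (use bij in \<open>simp add: BijGroup_def\<close>)
  then show ?thesis
    by (simp add: group_action_def group_hom_def group_hom_axioms_def \<open>group G\<close> group_BijGroup)
qed

lemma gcomplex_simps [simp]:
  "verts \<lparr>simplices = S, action = a\<rparr> = \<Union>S"
  by (simp add: verts_def)

lemma simplex_verts: "\<sigma> \<in> simplices K \<Longrightarrow> \<sigma> \<subseteq> verts K"
  by (auto simp: verts_def)

lemma simplicial_gcomplexD:
  assumes "simplicial_gcomplex G K"
  shows "simplicial_complex (simplices K)" "group_action G (verts K) (action K)" "group G"
    "g \<in> carrier G \<Longrightarrow> \<sigma> \<in> simplices K \<Longrightarrow> action K g ` \<sigma> \<in> simplices K"
    "g \<in> carrier G \<Longrightarrow> v \<in> verts K \<Longrightarrow> action K g v \<in> verts K"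
proof -
  show a: "simplicial_complex (simplices K)" "group_action G (verts K) (action K)"
    "g \<in> carrier G \<Longrightarrow> \<sigma> \<in> simplices K \<Longrightarrow> action K g ` \<sigma> \<in> simplices K"
    using assms by (auto simp: simplicial_gcomplex_def)
  show "group G" using a(2) by (simp add: group_action_def group_hom_def)
  show "g \<in> carrier G \<Longrightarrow> v \<in> verts K \<Longrightarrow> action K g v \<in> verts K"
    using group_action.element_image[OF a(2)] by blast
qed

definition giso :: "'g monoid \<Rightarrow> ('v \<Rightarrow> 'w) \<Rightarrow> ('g, 'v) gcomplex \<Rightarrow> ('g, 'w) gcomplex \<Rightarrow> bool" where
  "giso G f K L \<longleftrightarrow> bij_betw f (verts K) (verts L) \<and> (`) f ` simplices K = simplices L \<and>
     (\<forall>g\<in>carrier G. \<forall>x\<in>verts K. f (action K g x) = action L g (f x))"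

lemma rooted_iso_iff: "rooted_iso G K os L os' \<longleftrightarrow> (\<exists>f. giso G f K L \<and> map ((`) f) os = os')"
  by (auto simp: rooted_iso_def giso_def)

lemma giso_comp:
  assumes "giso G f K L" "giso G h L N"
  shows "giso G (h \<circ> f) K N"
  unfolding giso_def
proof (intro conjI ballI)
  show "bij_betw (h \<circ> f) (verts K) (verts N)" using assms by (auto simp: giso_def intro: bij_betw_trans)
  have "(`) (h \<circ> f) ` simplices K = (`) h ` (`) f ` simplices K" by (simp add: image_comp)
  then show "(`) (h \<circ> f) ` simplices K = simplices N" using assms by (simp add: giso_def)
  fix g x assume "g \<in> carrier G" "x \<in> verts K"
  moreover from this have "f x \<in> verts L" using assms by (auto simp: giso_def bij_betw_def)
  ultimately show "(h \<circ> f) (action K g x) = action N g ((h \<circ> f) x)" using assms by (simp add: giso_def)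
qed

lemma giso_inv:
  assumes f: "giso G f K L" and K: "simplicial_gcomplex G K"
  shows "giso G (inv_into (verts K) f) L K"
  unfolding giso_def
proof (intro conjI ballI)
  let ?h = "inv_into (verts K) f"
  have bij: "bij_betw f (verts K) (verts L)" and simp: "(`) f ` simplices K = simplices L"
    using f by (auto simp: giso_def)
  have inj: "inj_on f (verts K)" using bij by (simp add: bij_betw_def)
  show "bij_betw ?h (verts L) (verts K)" by (rule bij_betw_inv_into[OF bij])
  have "?h ` f ` \<sigma> = \<sigma>" if "\<sigma> \<in> simplices K" for \<sigma>
    using inj simplex_verts[OF that] by (simp add: inv_into_image_cancel)
  then have "(`) ?h ` (`) f ` simplices K = simplices K" by (simp add: image_image)
  then show "(`) ?h ` simplices L = simplices K" by (simp add: simp)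
  fix g y assume g: "g \<in> carrier G" and y: "y \<in> verts L"
  then obtain x where x: "x \<in> verts K" "y = f x" using bij by (auto simp: bij_betw_def)
  have "?h (action L g (f x)) = ?h (f (action K g x))" using f g x by (simp add: giso_def)
  then show "?h (action L g y) = action K g (?h y)"
    using inj x simplicial_gcomplexD(5)[OF K g] by (simp add: inv_into_f_f)
qed

lemma giso_verts: "giso G f K L \<Longrightarrow> v \<in> verts K \<Longrightarrow> f v \<in> verts L"
  by (auto simp: giso_def bij_betw_def)

lemma giso_preimage:
  assumes "giso G f K L" "w \<in> verts L"
  obtains v where "v \<in> verts K" "w = f v"
proof -
  have "w \<in> f ` verts K" using assms by (simp add: giso_def bij_betw_def)
  then show ?thesis using that by blast
qed

lemma rooted_iso_trans: "rooted_iso G K os L os' \<Longrightarrow> rooted_iso G L os' N os'' \<Longrightarrow> rooted_iso G K os N os''"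
  unfolding rooted_iso_iff using giso_comp by (fastforce simp: image_comp)

lemma rooted_iso_sym:
  assumes "rooted_iso G K os L os'" "simplicial_gcomplex G K" "\<And>r. r \<in> set os \<Longrightarrow> r \<subseteq> verts K"
  shows "rooted_iso G L os' K os"
proof -
  obtain f where f: "giso G f K L" "map ((`) f) os = os'" using assms(1) by (auto simp: rooted_iso_iff)
  have inj: "inj_on f (verts K)" using f by (simp add: giso_def bij_betw_def)
  have "map ((`) (inv_into (verts K) f)) os' = os"
    using assms(3) inj unfolding f(2)[symmetric] by (auto intro!: map_idI simp: inv_into_image_cancel)
  then show ?thesis unfolding rooted_iso_iff using giso_inv[OF f(1) assms(2)] by blast
qed

text \<open>Renaming of vertices along an injection. It moves complexes to the vertex type
  \<open>nat\<close> and produces copies that avoid a given number.\<close>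

definition copy_complex :: "('v \<Rightarrow> 'w) \<Rightarrow> ('g, 'v) gcomplex \<Rightarrow> ('g, 'w) gcomplex" where
  "copy_complex e K = \<lparr>simplices = (`) e ` simplices K,
     action = (\<lambda>g. restrict (\<lambda>y. e (action K g (inv_into (verts K) e y))) (e ` verts K))\<rparr>"

lemma copy_complex:
  assumes K: "simplicial_gcomplex G K" and e: "inj_on e (verts K)"
  shows "verts (copy_complex e K) = e ` verts K" "giso G e K (copy_complex e K)"
    "simplicial_gcomplex G (copy_complex e K)"
proof -
  note KD = simplicial_gcomplexD[OF K]
  show v: "verts (copy_complex e K) = e ` verts K"
    by (auto simp: copy_complex_def verts_def)
  have act: "action (copy_complex e K) g (e x) = e (action K g x)" if "x \<in> verts K" for g x
    using that e by (simp add: copy_complex_def inv_into_f_f)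
  show "giso G e K (copy_complex e K)"
    unfolding giso_def v using e act by (auto simp: copy_complex_def intro: inj_on_imp_bij_betw)
  show "simplicial_gcomplex G (copy_complex e K)"
    unfolding simplicial_gcomplex_def
  proof (intro conjI ballI)
    show "simplicial_complex (simplices (copy_complex e K))"
      unfolding simplicial_complex_def
    proof (intro conjI ballI allI impI)
      show "simplices (copy_complex e K) \<noteq> {}" using KD(1) by (simp add: copy_complex_def simplicial_complex_def)
      fix \<sigma> assume "\<sigma> \<in> simplices (copy_complex e K)"
      then obtain \<sigma>' where s: "\<sigma>' \<in> simplices K" "\<sigma> = e ` \<sigma>'" by (auto simp: copy_complex_def)
      then show "finite \<sigma>" "\<sigma> \<noteq> {}" using KD(1) by (auto simp: simplicial_complex_def)
      fix \<tau> assume "\<tau> \<subseteq> \<sigma> \<and> \<tau> \<noteq> {}"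
      then obtain \<tau>' where t: "\<tau>' \<subseteq> \<sigma>'" "\<tau> = e ` \<tau>'" "\<tau>' \<noteq> {}" unfolding s(2) by (metis image_empty subset_imageE)
      then have "\<tau>' \<in> simplices K" using KD(1) s(1) unfolding simplicial_complex_def by blast
      then show "\<tau> \<in> simplices (copy_complex e K)" by (simp add: copy_complex_def t(2))
    qed
    show "group_action G (verts (copy_complex e K)) (action (copy_complex e K))"
      unfolding v
    proof (rule group_actionI[OF KD(3)])
      show "action (copy_complex e K) g \<in> extensional (e ` verts K)" for g by (simp add: copy_complex_def)
    next
      fix g y assume "g \<in> carrier G" "y \<in> e ` verts K"
      then show "action (copy_complex e K) g y \<in> e ` verts K" using act KD(5) by auto
    next
      fix y assume "y \<in> e ` verts K"
      then show "action (copy_complex e K) \<one>\<^bsub>G\<^esub> y = y"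
        using act group_action.id_eq_one[OF KD(2)] by (auto simp flip: group_action.id_eq_one[OF KD(2)])
    next
      fix g h y assume "g \<in> carrier G" "h \<in> carrier G" "y \<in> e ` verts K"
      then show "action (copy_complex e K) (g \<otimes>\<^bsub>G\<^esub> h) y = action (copy_complex e K) g (action (copy_complex e K) h y)"
        using act KD(5) group_action.composition_rule[OF KD(2)] by auto
    qed
    fix g \<sigma> assume g: "g \<in> carrier G" and "\<sigma> \<in> simplices (copy_complex e K)"
    then obtain \<sigma>' where s: "\<sigma>' \<in> simplices K" "\<sigma> = e ` \<sigma>'" by (auto simp: copy_complex_def)
    have "action (copy_complex e K) g ` \<sigma> = e ` (action K g ` \<sigma>')"
      using act simplex_verts[OF s(1)] unfolding s(2) by (auto simp: image_image subset_iff intro!: image_cong)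
    then show "action (copy_complex e K) g ` \<sigma> \<in> simplices (copy_complex e K)"
      using KD(4)[OF g s(1)] by (simp add: copy_complex_def)
  qed
qed

lemma rooted_class_iff:
  "(L, os') \<in> rooted_class G K os \<longleftrightarrow> simplicial_gcomplex G L \<and> rooted_iso G K os L os'"
  by (simp add: rooted_class_def)

lemma copy_in_class:
  assumes "simplicial_gcomplex G K" "inj_on e (verts K)"
  shows "(copy_complex e K, map ((`) e) os) \<in> rooted_class G K os"
  using copy_complex[OF assms] by (auto simp: rooted_class_iff rooted_iso_iff)

text \<open>The way back needs roots that consist of vertices, because the inverse of an isomorphism
  is controlled only there.\<close>

lemma rooted_class_cong:
  fixes K :: "('g, 'v) gcomplex" and L :: "('g, 'w) gcomplex"
  assumes "rooted_iso G K os L os'" "simplicial_gcomplex G K" "\<And>r. r \<in> set os \<Longrightarrow> r \<subseteq> verts K"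
  shows "rooted_class G K os = rooted_class G L os'"
proof -
  have "rooted_iso G L os' K os" by (rule rooted_iso_sym[OF assms(1,2)]) (rule assms(3))
  then have "rooted_iso G K os N ns \<longleftrightarrow> rooted_iso G L os' N ns" for N :: "('g, nat) gcomplex" and ns
    using rooted_iso_trans[OF assms(1)] rooted_iso_trans[OF \<open>rooted_iso G L os' K os\<close>] by (intro iffI)
  then show ?thesis by (simp add: rooted_class_def)
qed

section \<open>Degrees, distances and roots\<close>

text \<open>An injection that carries stars onto stars. Isomorphisms are of this kind, and so are
  the inclusions of a complex as one translate; the groups on the two sides may differ.\<close>

definition locally_iso :: "('v \<Rightarrow> 'w) \<Rightarrow> ('g, 'v) gcomplex \<Rightarrow> ('h, 'w) gcomplex \<Rightarrow> bool" where
  "locally_iso \<psi> K K' \<longleftrightarrow> inj_on \<psi> (verts K) \<and>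
     (\<forall>v\<in>verts K. {\<sigma>\<in>simplices K'. \<psi> v \<in> \<sigma>} = (`) \<psi> ` {\<sigma>\<in>simplices K. v \<in> \<sigma>})"

lemma locally_iso_degree:
  assumes "degree_bounded D K" and "\<And>v'. v' \<in> verts K' \<Longrightarrow> \<exists>\<psi> v. locally_iso \<psi> K K' \<and> v \<in> verts K \<and> v' = \<psi> v"
  shows "degree_bounded D K'"
  unfolding degree_bounded_def
proof
  fix v' assume "v' \<in> verts K'"
  then obtain \<psi> v where p: "locally_iso \<psi> K K'" "v \<in> verts K" "v' = \<psi> v" using assms(2) by blast
  have card: "card (\<psi> ` \<sigma>) = card \<sigma>" if "\<sigma> \<in> simplices K" for \<sigma>
    using p(1) simplex_verts[OF that] by (intro card_image) (auto simp: locally_iso_def elim: inj_on_subset)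
  let ?S = "{\<sigma>\<in>simplices K. card \<sigma> = 2 \<and> v \<in> \<sigma>}"
  have "{\<sigma>\<in>simplices K'. card \<sigma> = 2 \<and> v' \<in> \<sigma>} = {\<sigma>\<in>{\<sigma>\<in>simplices K'. \<psi> v \<in> \<sigma>}. card \<sigma> = 2}"
    by (auto simp: p(3))
  also have "\<dots> = {\<sigma>\<in>(`) \<psi> ` {\<sigma>\<in>simplices K. v \<in> \<sigma>}. card \<sigma> = 2}" using p(1,2) by (simp add: locally_iso_def)
  also have "\<dots> = (`) \<psi> ` ?S" using card by auto
  finally have eq: "{\<sigma>\<in>simplices K'. card \<sigma> = 2 \<and> v' \<in> \<sigma>} = (`) \<psi> ` ?S" .
  have "finite ?S" "card ?S \<le> D" using assms(1) p(2) by (auto simp: degree_bounded_def)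
  then show "finite {\<sigma>\<in>simplices K'. card \<sigma> = 2 \<and> v' \<in> \<sigma>} \<and> card {\<sigma>\<in>simplices K'. card \<sigma> = 2 \<and> v' \<in> \<sigma>} \<le> D"
    unfolding eq using card_image_le[of ?S "(`) \<psi>"] by auto
qed

lemma locally_iso_adjacent:
  assumes p: "locally_iso \<psi> K K'" and u: "u \<in> verts K"
  shows "(\<psi> u, w) \<in> adjacent K' \<longleftrightarrow> (\<exists>v\<in>verts K. w = \<psi> v \<and> (u, v) \<in> adjacent K)"
proof
  assume a: "(\<psi> u, w) \<in> adjacent K'"
  then have w: "\<psi> u \<noteq> w" "{\<psi> u, w} \<in> simplices K'" by (auto simp: adjacent_def)
  then have "{\<psi> u, w} \<in> (`) \<psi> ` {\<sigma>\<in>simplices K. u \<in> \<sigma>}" using p u unfolding locally_iso_def by blast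
  then obtain \<sigma> where s: "\<sigma> \<in> simplices K" "u \<in> \<sigma>" "{\<psi> u, w} = \<psi> ` \<sigma>" by blast
  then obtain v where v: "v \<in> \<sigma>" "w = \<psi> v" by blast
  have inj: "inj_on \<psi> \<sigma>" using p simplex_verts[OF s(1)] by (auto simp: locally_iso_def elim: inj_on_subset)
  have "\<psi> ` {u, v} = \<psi> ` \<sigma>" using s(3) v(2) by simp
  then have "\<sigma> = {u, v}" using inj s(2) v(1) by (metis empty_subsetI inj_on_image_eq_iff insert_subset subset_refl)
  then show "\<exists>v\<in>verts K. w = \<psi> v \<and> (u, v) \<in> adjacent K"
    using s v w simplex_verts[OF s(1)] by (intro bexI[of _ v]) (auto simp: adjacent_def)
next
  assume "\<exists>v\<in>verts K. w = \<psi> v \<and> (u, v) \<in> adjacent K"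
  then obtain v where v: "v \<in> verts K" "w = \<psi> v" "u \<noteq> v" "{u, v} \<in> simplices K" by (auto simp: adjacent_def)
  then have "\<psi> ` {u, v} \<in> {\<sigma>\<in>simplices K'. \<psi> u \<in> \<sigma>}" using p u unfolding locally_iso_def by blast
  then show "(\<psi> u, w) \<in> adjacent K'"
    using v u p by (auto simp: adjacent_def locally_iso_def inj_on_def)
qed

lemma adjacent_verts: "(u, v) \<in> adjacent K \<Longrightarrow> u \<in> verts K \<and> v \<in> verts K"
  by (auto simp: adjacent_def verts_def)

text \<open>A walk that starts in the image never leaves it, since each step lies in the star of a
  vertex of the image.\<close>

lemma locally_iso_walk:
  assumes p: "locally_iso \<psi> K K'" and u: "u \<in> verts K"
  shows "(\<psi> u, w) \<in> adjacent K' ^^ m \<longleftrightarrow> (\<exists>v\<in>verts K. w = \<psi> v \<and> (u, v) \<in> adjacent K ^^ m)"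
proof (induction m arbitrary: w)
  case 0
  then show ?case using u by auto
next
  case (Suc m)
  have "(\<psi> u, w) \<in> adjacent K' ^^ Suc m \<longleftrightarrow> (\<exists>y. (\<psi> u, y) \<in> adjacent K' ^^ m \<and> (y, w) \<in> adjacent K')"
    by (auto simp: relcomp_unfold)
  also have "\<dots> \<longleftrightarrow> (\<exists>x\<in>verts K. (u, x) \<in> adjacent K ^^ m \<and> (\<psi> x, w) \<in> adjacent K')"
    by (auto simp: Suc.IH)
  also have "\<dots> \<longleftrightarrow> (\<exists>x\<in>verts K. (u, x) \<in> adjacent K ^^ m \<and> (\<exists>v\<in>verts K. w = \<psi> v \<and> (x, v) \<in> adjacent K))"
    using locally_iso_adjacent[OF p] by auto
  also have "\<dots> \<longleftrightarrow> (\<exists>v\<in>verts K. w = \<psi> v \<and> (u, v) \<in> adjacent K ^^ Suc m)"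
    using adjacent_verts by (fastforce simp: relcomp_unfold)
  finally show ?case .
qed

lemma locally_iso_reach:
  assumes p: "locally_iso \<psi> K K'" and "(u, v) \<in> (adjacent K)\<^sup>*" "u \<in> verts K"
  shows "(\<psi> u, \<psi> v) \<in> (adjacent K')\<^sup>*"
proof -
  obtain m where m: "(u, v) \<in> adjacent K ^^ m" using assms(2) rtrancl_power by blast
  have "v \<in> verts K" using assms(2,3) by (induction rule: rtrancl_induct) (auto dest: adjacent_verts)
  then have "(\<psi> u, \<psi> v) \<in> adjacent K' ^^ m" using locally_iso_walk[OF p assms(3)] m by blast
  then show ?thesis by (rule relpow_imp_rtrancl)
qed

lemma giso_locally_iso:
  assumes f: "giso G f K L"
  shows "locally_iso f K L"
  unfolding locally_iso_def
proof (intro conjI ballI)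
  show inj: "inj_on f (verts K)" using f by (simp add: giso_def bij_betw_def)
  fix v assume v: "v \<in> verts K"
  have "f v \<in> f ` \<sigma> \<longleftrightarrow> v \<in> \<sigma>" if "\<sigma> \<in> simplices K" for \<sigma>
    by (rule inj_on_image_mem_iff[OF inj v simplex_verts[OF that]])
  moreover have "simplices L = (`) f ` simplices K" using f by (simp add: giso_def)
  ultimately show "{\<sigma>\<in>simplices L. f v \<in> \<sigma>} = (`) f ` {\<sigma>\<in>simplices K. v \<in> \<sigma>}" by auto
qed

lemma giso_degree:
  assumes "giso G f K L" "degree_bounded D K"
  shows "degree_bounded D L"
proof (rule locally_iso_degree[OF assms(2)])
  fix w assume "w \<in> verts L"
  then obtain v where "v \<in> verts K" "w = f v" by (rule giso_preimage[OF assms(1)])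
  then show "\<exists>\<psi> v. locally_iso \<psi> K L \<and> v \<in> verts K \<and> w = \<psi> v" using giso_locally_iso[OF assms(1)] by blast
qed

lemma giso_rooted:
  assumes f: "giso G f K L" and L: "simplicial_gcomplex G L" and K: "rooted_gcomplex G K [r]"
  shows "rooted_gcomplex G L [f ` r]"
proof -
  obtain x where x: "x \<in> verts K" "r = orbit G (action K) x"
    and reach: "\<And>v. v \<in> verts K \<Longrightarrow> \<exists>u\<in>r. (u, v) \<in> (adjacent K)\<^sup>*"
    and Kc: "simplicial_gcomplex G K"
    using K by (auto simp: rooted_gcomplex_def orbits_def)
  have fx: "f x \<in> verts L" by (rule giso_verts[OF f x(1)])
  have "f ` r = orbit G (action L) (f x)"
    using f x(1) unfolding x(2) orbit_def giso_def by (auto simp: image_iff) metis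
  moreover have "r \<subseteq> verts K" using simplicial_gcomplexD(5)[OF Kc _ x(1)] by (auto simp: x(2) orbit_def)
  moreover have "\<exists>u\<in>f ` r. (u, w) \<in> (adjacent L)\<^sup>*" if w: "w \<in> verts L" for w
  proof -
    obtain v where v: "v \<in> verts K" "w = f v" by (rule giso_preimage[OF f w])
    obtain u where u: "u \<in> r" "(u, v) \<in> (adjacent K)\<^sup>*" using reach[OF v(1)] by blast
    then show ?thesis
      using locally_iso_reach[OF giso_locally_iso[OF f] u(2)] \<open>r \<subseteq> verts K\<close> v(2) by blast
  qed
  ultimately show ?thesis
    using L fx by (auto simp: rooted_gcomplex_def orbits_def)
qed

lemma rooted_root_subset:
  assumes "rooted_gcomplex G K [r]"
  shows "r \<subseteq> verts K" "r \<noteq> {}"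
proof -
  obtain x where x: "x \<in> verts K" "r = orbit G (action K) x" and K: "simplicial_gcomplex G K"
    using assms by (auto simp: rooted_gcomplex_def orbits_def)
  show "r \<subseteq> verts K" using simplicial_gcomplexD(5)[OF K _ x(1)] by (auto simp: x(2) orbit_def)
  show "r \<noteq> {}" using group_action.orbit_refl[OF simplicial_gcomplexD(2)[OF K] x(1)] x(2) by blast
qed

text \<open>Root, degree bound and class pass along isomorphisms, so any member may replace the
  complex from which the class was formed.\<close>

lemma SC_member:
  assumes c: "c \<in> SC G D 1" and KL: "(L, os) \<in> c"
  obtains r where "os = [r]" "rooted_gcomplex G L [r]" "degree_bounded D L" "c = rooted_class G L [r]"
proof -
  obtain K :: "('a, nat) gcomplex" and ks where K: "c = rooted_class G K ks" "rooted_gcomplex G K ks" "length ks = 1" "degree_bounded D K"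
    using c unfolding SC_def by blast
  then obtain k where k: "ks = [k]" by (metis One_nat_def length_0_conv length_Suc_conv)
  have L: "simplicial_gcomplex G L" "rooted_iso G K [k] L os" using KL K(1) k by (auto simp: rooted_class_iff)
  then obtain f where f: "giso G f K L" "os = [f ` k]" by (auto simp: rooted_iso_iff)
  have "rooted_gcomplex G L [f ` k]" using giso_rooted[OF f(1) L(1)] K(2) k by simp
  moreover have "degree_bounded D L" by (rule giso_degree[OF f(1) K(4)])
  moreover have "c = rooted_class G L [f ` k]"
    unfolding K(1) k using L(2) K(2) rooted_root_subset(1)[of G K k]
    by (intro rooted_class_cong) (auto simp: k f(2) rooted_gcomplex_def)
  ultimately show ?thesis using that f(2) by blast
qed

lemma SC_nonempty:
  assumes "c \<in> SC G D 1"
  obtains L os where "(L, os) \<in> c"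
proof -
  obtain K :: "('a, nat) gcomplex" and ks where K: "c = rooted_class G K ks" "rooted_gcomplex G K ks"
    using assms unfolding SC_def by blast
  have "simplicial_gcomplex G K" using K(2) by (simp add: rooted_gcomplex_def)
  then have "(copy_complex id K, map ((`) id) ks) \<in> c" unfolding K(1) by (intro copy_in_class) auto
  then show ?thesis by (rule that)
qed

lemma SC_rep:
  assumes "c \<in> SC G D 1"
  shows "(rep_complex c, [rep_root c]) \<in> c" "rooted_gcomplex G (rep_complex c) [rep_root c]"
    "degree_bounded D (rep_complex c)" "c = rooted_class G (rep_complex c) [rep_root c]"
proof -
  let ?Ko = "SOME Ko. Ko \<in> c"
  have "?Ko \<in> c" using SC_nonempty[OF assms] by (metis someI)
  then obtain r where "snd ?Ko = [r]" "rooted_gcomplex G (fst ?Ko) [r]" "degree_bounded D (fst ?Ko)"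
    "c = rooted_class G (fst ?Ko) [r]"
    using SC_member[OF assms, of "fst ?Ko" "snd ?Ko"] by auto
  with \<open>?Ko \<in> c\<close> show "(rep_complex c, [rep_root c]) \<in> c" "rooted_gcomplex G (rep_complex c) [rep_root c]"
    "degree_bounded D (rep_complex c)" "c = rooted_class G (rep_complex c) [rep_root c]"
    unfolding rep_complex_def rep_root_def by (metis list.sel(1) prod.collapse)+
qed

text \<open>The definition of \<open>rooted_iso\<close> does not by itself force roots to consist of vertices; a root
  point off the vertex set could be mapped anywhere, so it would show in a copy that omits \<open>0\<close>.\<close>

lemma root_subset_verts:
  fixes A :: "('g, 'v) gcomplex"
  assumes c: "c \<in> SC G D 1" and A: "simplicial_gcomplex G A" "rooted_class G A [b] = c"
  shows "b \<subseteq> verts A"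
proof (rule ccontr)
  assume "\<not> b \<subseteq> verts A"
  then obtain v where v: "v \<in> b" "v \<notin> verts A" by blast
  obtain K os where K: "(K, os) \<in> c" by (rule SC_nonempty[OF c])
  then have Kc: "simplicial_gcomplex G K" and "rooted_iso G A [b] K os" using A(2) by (auto simp: rooted_class_iff)
  then obtain f where f: "giso G f A K" by (auto simp: rooted_iso_iff)
  let ?L = "copy_complex Suc K"
  note L = copy_complex[OF Kc inj_on_subset[OF inj_Suc subset_UNIV]]
  let ?f = "\<lambda>w. if w \<in> verts A then Suc (f w) else 0"
  have "giso G (Suc \<circ> f) A ?L" by (rule giso_comp[OF f L(2)])
  moreover have "?f ` \<sigma> = (Suc \<circ> f) ` \<sigma>" if "\<sigma> \<in> simplices A" for \<sigma>
    using simplex_verts[OF that] by (auto intro!: image_cong)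
  ultimately have "giso G ?f A ?L"
    unfolding giso_def using simplicial_gcomplexD(5)[OF A(1)]
    by (auto cong: bij_betw_cong image_cong)
  then have "rooted_iso G A [b] ?L [?f ` b]" unfolding rooted_iso_iff by (intro exI[of _ ?f]) simp
  then have "(?L, [?f ` b]) \<in> c" using L(3) unfolding A(2)[symmetric] rooted_class_iff by blast
  then obtain r where "[?f ` b] = [r]" "rooted_gcomplex G ?L [r]" by (rule SC_member[OF c])
  then have "?f ` b \<subseteq> verts ?L" using rooted_root_subset(1) by simp
  moreover have "0 \<in> ?f ` b" using v by force
  ultimately show False by (auto simp: L(1))
qed

section \<open>Induction from the trivial subgroup\<close>

text \<open>\<open>K'\<close> is a copy of \<open>G \<times>\<^sub>1 K\<close>, the point \<open>\<lfloor>g, v\<rfloor>\<close> being \<open>\<phi> g v\<close>.\<close>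

definition induced :: "'g monoid \<Rightarrow> ('g \<Rightarrow> 'v \<Rightarrow> 'w) \<Rightarrow> ('g, 'v) gcomplex \<Rightarrow> ('g, 'w) gcomplex \<Rightarrow> bool" where
  "induced G \<phi> K K' \<longleftrightarrow>
     (\<forall>g\<in>carrier G. \<forall>h\<in>carrier G. \<forall>v\<in>verts K. \<forall>w\<in>verts K. \<phi> g v = \<phi> h w \<longrightarrow> g = h \<and> v = w) \<and>
     simplices K' = {\<phi> g ` \<sigma> | g \<sigma>. g \<in> carrier G \<and> \<sigma> \<in> simplices K} \<and>
     (\<forall>g\<in>carrier G. \<forall>h\<in>carrier G. \<forall>v\<in>verts K. action K' h (\<phi> g v) = \<phi> (h \<otimes>\<^bsub>G\<^esub> g) v)"

definition translates :: "'g monoid \<Rightarrow> ('g \<Rightarrow> 'v \<Rightarrow> 'w) \<Rightarrow> 'v set \<Rightarrow> 'w set" where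
  "translates G \<phi> V = {\<phi> g v | g v. g \<in> carrier G \<and> v \<in> V}"

lemma inducedD:
  assumes "induced G \<phi> K K'"
  shows "g \<in> carrier G \<Longrightarrow> h \<in> carrier G \<Longrightarrow> v \<in> verts K \<Longrightarrow> w \<in> verts K \<Longrightarrow> \<phi> g v = \<phi> h w \<Longrightarrow> g = h \<and> v = w"
    "simplices K' = {\<phi> g ` \<sigma> | g \<sigma>. g \<in> carrier G \<and> \<sigma> \<in> simplices K}"
    "g \<in> carrier G \<Longrightarrow> h \<in> carrier G \<Longrightarrow> v \<in> verts K \<Longrightarrow> action K' h (\<phi> g v) = \<phi> (h \<otimes>\<^bsub>G\<^esub> g) v"
proof -
  note i = assms[unfolded induced_def]
  show "g \<in> carrier G \<Longrightarrow> h \<in> carrier G \<Longrightarrow> v \<in> verts K \<Longrightarrow> w \<in> verts K \<Longrightarrow> \<phi> g v = \<phi> h w \<Longrightarrow> g = h \<and> v = w"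
    using conjunct1[OF i] by simp
  show "simplices K' = {\<phi> g ` \<sigma> | g \<sigma>. g \<in> carrier G \<and> \<sigma> \<in> simplices K}"
    using i by (elim conjE)
  show "g \<in> carrier G \<Longrightarrow> h \<in> carrier G \<Longrightarrow> v \<in> verts K \<Longrightarrow> action K' h (\<phi> g v) = \<phi> (h \<otimes>\<^bsub>G\<^esub> g) v"
    using conjunct2[OF conjunct2[OF i]] by simp
qed

lemma induced_verts:
  assumes "induced G \<phi> K K'"
  shows "verts K' = translates G \<phi> (verts K)"
  unfolding translates_def verts_def inducedD(2)[OF assms] by blast

text \<open>The isomorphism on the source side may respect any group \<open>H\<close>, as only its
  effect on vertices and simplices enters.\<close>

lemma induced_giso_left:
  assumes i: "induced G \<phi> K K'" and f: "giso H f K0 K"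
  shows "induced G (\<lambda>g v. \<phi> g (f v)) K0 K'"
proof -
  have inj: "inj_on f (verts K0)" and s: "simplices K = (`) f ` simplices K0"
    using f by (auto simp: giso_def bij_betw_def)
  have fv: "f v \<in> verts K" if "v \<in> verts K0" for v using giso_verts[OF f that] .
  show ?thesis
    unfolding induced_def
  proof (intro conjI ballI impI)
    fix g h v w assume a: "g \<in> carrier G" "h \<in> carrier G" "v \<in> verts K0" "w \<in> verts K0" "\<phi> g (f v) = \<phi> h (f w)"
    from inducedD(1)[OF i a(1,2) fv[OF a(3)] fv[OF a(4)] a(5)] have "g = h" "f v = f w" by auto
    then show "g = h" "v = w" using inj a by (auto simp: inj_on_def)
  next
    have im: "(\<lambda>v. \<phi> g (f v)) ` \<sigma> = \<phi> g ` f ` \<sigma>" for g \<sigma> by (simp add: image_image)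
    show "simplices K' = {(\<lambda>v. \<phi> g (f v)) ` \<sigma> | g \<sigma>. g \<in> carrier G \<and> \<sigma> \<in> simplices K0}"
      unfolding inducedD(2)[OF i] s im by blast
  qed (simp add: inducedD(3)[OF i] fv)
qed

lemma induced_giso_right:
  fixes G (structure)
  assumes i: "induced G \<phi> K K'" and f: "giso G f K' K1" and G: "group G"
  shows "induced G (\<lambda>g v. f (\<phi> g v)) K K1"
proof -
  interpret group G by (rule G)
  have inj: "inj_on f (verts K')" and s: "simplices K1 = (`) f ` simplices K'"
    using f by (auto simp: giso_def bij_betw_def)
  have \<phi>: "\<phi> g v \<in> verts K'" if "g \<in> carrier G" "v \<in> verts K" for g v
    using that unfolding induced_verts[OF i] translates_def by blast
  show ?thesis
    unfolding induced_def
  proof (intro conjI ballI impI)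
    fix g h v w assume a: "g \<in> carrier G" "h \<in> carrier G" "v \<in> verts K" "w \<in> verts K" "f (\<phi> g v) = f (\<phi> h w)"
    then have "\<phi> g v = \<phi> h w" using inj \<phi> by (auto simp: inj_on_def)
    from inducedD(1)[OF i a(1-4) this] show "g = h" "v = w" by auto
  next
    have im: "(\<lambda>v. f (\<phi> g v)) ` \<sigma> = f ` \<phi> g ` \<sigma>" for g \<sigma> by (simp add: image_image)
    show "simplices K1 = {(\<lambda>v. f (\<phi> g v)) ` \<sigma> | g \<sigma>. g \<in> carrier G \<and> \<sigma> \<in> simplices K}"
      unfolding inducedD(2)[OF i] s im by blast
  next
    fix g h v assume a: "g \<in> carrier G" "h \<in> carrier G" "v \<in> verts K"
    then have "action K1 h (f (\<phi> g v)) = f (action K' h (\<phi> g v))" using f \<phi> by (simp add: giso_def)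
    then show "action K1 h (f (\<phi> g v)) = f (\<phi> (h \<otimes> g) v)" using a by (simp add: inducedD(3)[OF i])
  qed
qed

text \<open>Translates by different elements are disjoint, so a simplex at \<open>\<phi> g v\<close>
  is a translate by the same \<open>g\<close>.\<close>

lemma induced_locally_iso:
  assumes i: "induced G \<phi> K K'" and g: "g \<in> carrier G"
  shows "locally_iso (\<phi> g) K K'"
  unfolding locally_iso_def
proof (intro conjI ballI)
  show inj: "inj_on (\<phi> g) (verts K)" using inducedD(1)[OF i g g] by (intro inj_onI) blast
  fix v assume v: "v \<in> verts K"
  show "{\<sigma>\<in>simplices K'. \<phi> g v \<in> \<sigma>} = (`) (\<phi> g) ` {\<sigma>\<in>simplices K. v \<in> \<sigma>}"
  proof safe
    fix \<tau> assume "\<tau> \<in> simplices K'" "\<phi> g v \<in> \<tau>"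
    then obtain h \<sigma> where h: "h \<in> carrier G" "\<sigma> \<in> simplices K" "\<tau> = \<phi> h ` \<sigma>" "\<phi> g v \<in> \<phi> h ` \<sigma>"
      unfolding inducedD(2)[OF i] by blast
    then obtain w where w: "w \<in> \<sigma>" "\<phi> g v = \<phi> h w" by blast
    then have "g = h \<and> v = w"
      using inducedD(1)[OF i g h(1) v _ w(2)] simplex_verts[OF h(2)] by blast
    then show "\<tau> \<in> (`) (\<phi> g) ` {\<sigma>\<in>simplices K. v \<in> \<sigma>}" using h w by blast
  next
    fix \<sigma> assume "\<sigma> \<in> simplices K"
    then show "\<phi> g ` \<sigma> \<in> simplices K'" unfolding inducedD(2)[OF i] using g by blast
  qed auto
qed

lemma induced_degree:
  assumes i: "induced G \<phi> K K'" and "degree_bounded D K"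
  shows "degree_bounded D K'"
proof (rule locally_iso_degree[OF assms(2)])
  fix w assume "w \<in> verts K'"
  then obtain g v where "g \<in> carrier G" "v \<in> verts K" "w = \<phi> g v"
    unfolding induced_verts[OF i] translates_def by blast
  then show "\<exists>\<psi> v. locally_iso \<psi> K K' \<and> v \<in> verts K \<and> w = \<psi> v" using induced_locally_iso[OF i] by blast
qed

text \<open>The action axioms follow from the group law. Extensionality is an extra hypothesis
  because \<open>induced\<close> fixes the action on vertices only.\<close>

lemma induced_simplicial:
  fixes G (structure)
  assumes i: "induced G \<phi> K K'" and G: "group G" and K: "simplicial_complex (simplices K)"
    and ext: "\<And>g. g \<in> carrier G \<Longrightarrow> action K' g \<in> extensional (verts K')"
  shows "simplicial_gcomplex G K'"
proof -
  interpret group G by (rule G)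
  note D = inducedD[OF i]
  have V: "\<exists>g\<in>carrier G. \<exists>v\<in>verts K. y = \<phi> g v" if "y \<in> verts K'" for y
    using that unfolding induced_verts[OF i] translates_def by blast
  show ?thesis
    unfolding simplicial_gcomplex_def
  proof (intro conjI ballI)
    show "simplicial_complex (simplices K')"
      unfolding simplicial_complex_def
    proof (intro conjI ballI allI impI)
      obtain \<sigma> where "\<sigma> \<in> simplices K" using K by (auto simp: simplicial_complex_def)
      then have "\<phi> \<one> ` \<sigma> \<in> simplices K'" unfolding D(2) by blast
      then show "simplices K' \<noteq> {}" by blast
      fix \<tau> assume "\<tau> \<in> simplices K'"
      then obtain g \<sigma> where s: "g \<in> carrier G" "\<sigma> \<in> simplices K" "\<tau> = \<phi> g ` \<sigma>" unfolding D(2) by blast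
      then show "finite \<tau>" "\<tau> \<noteq> {}" using K by (auto simp: simplicial_complex_def)
      fix \<tau>' assume "\<tau>' \<subseteq> \<tau> \<and> \<tau>' \<noteq> {}"
      then obtain \<sigma>' where t: "\<sigma>' \<subseteq> \<sigma>" "\<tau>' = \<phi> g ` \<sigma>'" "\<sigma>' \<noteq> {}" unfolding s(3) by (metis image_empty subset_imageE)
      then have "\<sigma>' \<in> simplices K" using K s(2) unfolding simplicial_complex_def by blast
      then show "\<tau>' \<in> simplices K'" unfolding D(2) t(2) using s(1) by blast
    qed
    show "group_action G (verts K') (action K')"
    proof (rule group_actionI[OF G ext])
      fix g y assume g: "g \<in> carrier G" and "y \<in> verts K'"
      then obtain h v where "h \<in> carrier G" "v \<in> verts K" "y = \<phi> h v" using V by blast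
      with g show "action K' g y \<in> verts K'"
        by (auto simp: D(3) induced_verts[OF i] translates_def)
    next
      fix y assume "y \<in> verts K'"
      then obtain h v where "h \<in> carrier G" "v \<in> verts K" "y = \<phi> h v" using V by blast
      then show "action K' \<one> y = y" by (simp add: D(3))
    next
      fix g g' y assume "g \<in> carrier G" "g' \<in> carrier G" "y \<in> verts K'"
      moreover from this obtain h v where "h \<in> carrier G" "v \<in> verts K" "y = \<phi> h v" using V by blast
      ultimately show "action K' (g \<otimes> g') y = action K' g (action K' g' y)" by (simp add: D(3) m_assoc)
    qed
    fix g \<tau> assume g: "g \<in> carrier G" and "\<tau> \<in> simplices K'"
    then obtain h \<sigma> where s: "h \<in> carrier G" "\<sigma> \<in> simplices K" "\<tau> = \<phi> h ` \<sigma>" unfolding D(2) by blast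
    have "action K' g ` \<tau> = \<phi> (g \<otimes> h) ` \<sigma>"
      unfolding s(3) image_image using simplex_verts[OF s(2)] D(3)[OF s(1) g] by (intro image_cong) auto
    then show "action K' g ` \<tau> \<in> simplices K'" unfolding D(2) using g s by blast
  qed
qed

section \<open>Balls in induced complexes\<close>

definition ball_verts :: "real \<Rightarrow> ('g, 'v) gcomplex \<Rightarrow> 'v set \<Rightarrow> 'v set" where
  "ball_verts r K V = {v\<in>verts K. \<exists>u\<in>V. \<exists>m. real m \<le> r \<and> (u, v) \<in> adjacent K ^^ m}"

lemma cball_complex_eq: "cball_complex r K V = full_subcomplex K (ball_verts r K V)"
  by (simp add: cball_complex_def ball_verts_def)

lemma full_subcomplex_verts:
  assumes "simplicial_complex (simplices K)" "V \<subseteq> verts K"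
  shows "verts (full_subcomplex K V) = V"
proof
  show "verts (full_subcomplex K V) \<subseteq> V" by (auto simp: verts_def full_subcomplex_def)
  show "V \<subseteq> verts (full_subcomplex K V)"
  proof
    fix v assume v: "v \<in> V"
    then obtain \<sigma> where "\<sigma> \<in> simplices K" "v \<in> \<sigma>" using assms(2) unfolding verts_def by blast
    have "\<forall>\<sigma>\<in>simplices K. \<forall>\<tau>. \<tau> \<subseteq> \<sigma> \<and> \<tau> \<noteq> {} \<longrightarrow> \<tau> \<in> simplices K"
      using assms(1) unfolding simplicial_complex_def by (elim conjE)
    from this[THEN bspec, OF \<open>\<sigma> \<in> simplices K\<close>, THEN spec, of "{v}"]
    have "{v} \<in> simplices K" using \<open>v \<in> \<sigma>\<close> by simp
    then have "{v} \<in> simplices (full_subcomplex K V)" using v by (simp add: full_subcomplex_def)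
    then show "v \<in> verts (full_subcomplex K V)" unfolding verts_def by blast
  qed
qed

text \<open>Walks stay in the copy in which they start, so distances from the translated set are
  computed inside one copy.\<close>

lemma ball_verts_induced:
  assumes i: "induced G \<phi> K K'" and V: "V \<subseteq> verts K"
  shows "ball_verts r K' (translates G \<phi> V) = translates G \<phi> (ball_verts r K V)"
proof -
  have walk: "(\<phi> g u, w) \<in> adjacent K' ^^ m \<longleftrightarrow> (\<exists>v\<in>verts K. w = \<phi> g v \<and> (u, v) \<in> adjacent K ^^ m)"
    if "g \<in> carrier G" "u \<in> V" for g u w m
    using locally_iso_walk[OF induced_locally_iso[OF i that(1)]] that(2) V by blast
  show ?thesis
  proof safe
    fix w assume "w \<in> ball_verts r K' (translates G \<phi> V)"
    then obtain g u m where "g \<in> carrier G" "u \<in> V" "real m \<le> r" "(\<phi> g u, w) \<in> adjacent K' ^^ m"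
      by (auto simp: ball_verts_def translates_def)
    then show "w \<in> translates G \<phi> (ball_verts r K V)"
      unfolding translates_def ball_verts_def using walk by blast
  next
    fix w assume "w \<in> translates G \<phi> (ball_verts r K V)"
    then obtain g u v m where *: "g \<in> carrier G" "u \<in> V" "v \<in> verts K" "w = \<phi> g v" "real m \<le> r" "(u, v) \<in> adjacent K ^^ m"
      by (auto simp: ball_verts_def translates_def)
    then have "(\<phi> g u, w) \<in> adjacent K' ^^ m" using walk by blast
    moreover have "w \<in> verts K'" "\<phi> g u \<in> translates G \<phi> V"
      using * by (auto simp: induced_verts[OF i] translates_def)
    ultimately show "w \<in> ball_verts r K' (translates G \<phi> V)" unfolding ball_verts_def using *(5) by blast
  qed
qed

text \<open>An isomorphism \<theta> of balls acts on all copies at once, sending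
  \<open>\<phi> g v\<close> to \<open>\<psi> g (\<theta> v)\<close>; left multiplication on the
  index commutes with this.\<close>

lemma induced_ball_iso:
  fixes G (structure) and \<phi> :: "'g \<Rightarrow> 'v \<Rightarrow> 'w"
  assumes G: "group G"
    and i: "induced G \<phi> K K'" "induced G \<psi> L L'"
    and simp: "simplicial_gcomplex H K" "simplicial_gcomplex H L" "simplicial_gcomplex G K'" "simplicial_gcomplex G L'"
    and V: "V \<subseteq> verts K" "U \<subseteq> verts L" "V \<subseteq> ball_verts r K V"
    and iso: "rooted_iso H (cball_complex r K V) [V] (cball_complex r L U) [U]"
  shows "rooted_iso G (cball_complex r K' (translates G \<phi> V)) [translates G \<phi> V]
    (cball_complex r L' (translates G \<psi> U)) [translates G \<psi> U]"
proof -
  interpret group G by (rule G)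
  let ?B = "ball_verts r K V" and ?C = "ball_verts r L U"
  have B: "?B \<subseteq> verts K" "?C \<subseteq> verts L" by (auto simp: ball_verts_def)
  note sc = simplicial_gcomplexD(1)[OF simp(1)] simplicial_gcomplexD(1)[OF simp(2)]
    simplicial_gcomplexD(1)[OF simp(3)] simplicial_gcomplexD(1)[OF simp(4)]
  obtain \<theta> where \<theta>: "giso H \<theta> (full_subcomplex K ?B) (full_subcomplex L ?C)" "\<theta> ` V = U"
    using iso by (auto simp: rooted_iso_iff cball_complex_eq)
  have bij: "bij_betw \<theta> ?B ?C"
    using \<theta>(1) by (simp add: giso_def full_subcomplex_verts sc B)
  have \<theta>s: "(`) \<theta> ` {\<sigma>\<in>simplices K. \<sigma> \<subseteq> ?B} = {\<sigma>\<in>simplices L. \<sigma> \<subseteq> ?C}"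
    using \<theta>(1) by (simp add: giso_def full_subcomplex_def)
  \<comment> \<open>Freeness makes the pair behind a vertex unique, so the choice by
    \<open>SOME\<close> is forced.\<close>
  define F where "F y = (let p = SOME p. fst p \<in> carrier G \<and> snd p \<in> verts K \<and> y = \<phi> (fst p) (snd p)
    in \<psi> (fst p) (\<theta> (snd p)))" for y
  have F: "F (\<phi> g v) = \<psi> g (\<theta> v)" if "g \<in> carrier G" "v \<in> verts K" for g v
  proof -
    let ?P = "\<lambda>p. fst p \<in> carrier G \<and> snd p \<in> verts K \<and> \<phi> g v = \<phi> (fst p) (snd p)"
    define p where "p = (SOME p. ?P p)"
    have "?P p" unfolding p_def by (rule someI[of ?P "(g, v)"]) (use that in auto)
    then have "g = fst p \<and> v = snd p"
      by (intro inducedD(1)[OF i(1) that(1) _ that(2)]) auto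
    moreover have "F (\<phi> g v) = \<psi> (fst p) (\<theta> (snd p))" by (simp add: F_def p_def Let_def)
    ultimately show ?thesis by simp
  qed
  have Ftr: "F ` translates G \<phi> W = translates G \<psi> (\<theta> ` W)" if "W \<subseteq> verts K" for W
  proof safe
    fix y assume "y \<in> translates G \<phi> W"
    then obtain g v where gv: "g \<in> carrier G" "v \<in> W" "y = \<phi> g v" by (auto simp: translates_def)
    then have "F y = \<psi> g (\<theta> v)" using F that by blast
    then show "F y \<in> translates G \<psi> (\<theta> ` W)" unfolding translates_def using gv by blast
  next
    fix y assume "y \<in> translates G \<psi> (\<theta> ` W)"
    then obtain g v where gv: "g \<in> carrier G" "v \<in> W" "y = \<psi> g (\<theta> v)" by (auto simp: translates_def)
    then have "y = F (\<phi> g v)" using F[of g v] that by auto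
    moreover have "\<phi> g v \<in> translates G \<phi> W" using gv by (auto simp: translates_def)
    ultimately show "y \<in> F ` translates G \<phi> W" by blast
  qed
  have inj: "inj_on F (translates G \<phi> ?B)"
  proof (rule inj_onI)
    fix y z assume "y \<in> translates G \<phi> ?B" "z \<in> translates G \<phi> ?B" "F y = F z"
    then obtain g v h w where a: "g \<in> carrier G" "v \<in> ?B" "y = \<phi> g v" "h \<in> carrier G" "w \<in> ?B" "z = \<phi> h w"
      "F (\<phi> g v) = F (\<phi> h w)" unfolding translates_def by blast
    moreover have "v \<in> verts K" "w \<in> verts K" using a B by auto
    then have "\<psi> g (\<theta> v) = \<psi> h (\<theta> w)" using F[of g v] F[of h w] a by simp
    moreover have "\<theta> v \<in> verts L" "\<theta> w \<in> verts L" using bij a B by (auto simp: bij_betw_def)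
    ultimately have "g = h" "\<theta> v = \<theta> w" using inducedD(1)[OF i(2) a(1) a(4)] by blast+
    then show "y = z" using bij a by (auto simp: bij_betw_def inj_on_def)
  qed
  have image_B: "F ` translates G \<phi> ?B = translates G \<psi> ?C"
    using Ftr[OF B(1)] bij by (simp add: bij_betw_def)
  \<comment> \<open>Stated for an arbitrary induced pair, since it is applied to both
    complexes.\<close>
  have sub_tr: "\<phi> g ` \<sigma> \<subseteq> translates G \<phi> W \<longleftrightarrow> \<sigma> \<subseteq> W"
    if "induced G \<phi> K K'" "g \<in> carrier G" "\<sigma> \<in> simplices K" "W \<subseteq> verts K" for \<phi> :: "'g \<Rightarrow> 'c \<Rightarrow> 'd" and K K' g \<sigma> W
  proof
    assume s: "\<phi> g ` \<sigma> \<subseteq> translates G \<phi> W"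
    show "\<sigma> \<subseteq> W"
    proof
      fix v assume v: "v \<in> \<sigma>"
      then have "\<phi> g v \<in> translates G \<phi> W" using s by blast
      then obtain h w where "h \<in> carrier G" "w \<in> W" "\<phi> g v = \<phi> h w" by (auto simp: translates_def)
      then show "v \<in> W" using inducedD(1)[OF that(1,2), of h v w] simplex_verts[OF that(3)] v that(4) by blast
    qed
  qed (use that in \<open>auto simp: translates_def\<close>)
  have simps_tr: "{\<tau>\<in>simplices K'. \<tau> \<subseteq> translates G \<phi> W} = {\<phi> g ` \<sigma> | g \<sigma>. g \<in> carrier G \<and> \<sigma> \<in> {\<sigma>\<in>simplices K. \<sigma> \<subseteq> W}}"
    if "induced G \<phi> K K'" "W \<subseteq> verts K" for \<phi> :: "'g \<Rightarrow> 'c \<Rightarrow> 'd" and K K' W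
    unfolding inducedD(2)[OF that(1)] using sub_tr[OF that(1) _ _ that(2)] by blast
  have F\<sigma>: "F ` \<phi> g ` \<sigma> = \<psi> g ` \<theta> ` \<sigma>" if "g \<in> carrier G" "\<sigma> \<in> simplices K" for g \<sigma>
    unfolding image_image using F[OF that(1)] simplex_verts[OF that(2)] by (intro image_cong) auto
  have simplices_F: "(`) F ` {\<tau>\<in>simplices K'. \<tau> \<subseteq> translates G \<phi> ?B} = {\<tau>\<in>simplices L'. \<tau> \<subseteq> translates G \<psi> ?C}"
  proof -
    have "(`) F ` {\<tau>\<in>simplices K'. \<tau> \<subseteq> translates G \<phi> ?B} =
      {\<psi> g ` \<theta> ` \<sigma> | g \<sigma>. g \<in> carrier G \<and> \<sigma> \<in> {\<sigma>\<in>simplices K. \<sigma> \<subseteq> ?B}}"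
      unfolding simps_tr[OF i(1) B(1)] using F\<sigma> by (auto simp: image_iff) metis+
    also have "\<dots> = {\<psi> g ` \<tau> | g \<tau>. g \<in> carrier G \<and> \<tau> \<in> (`) \<theta> ` {\<sigma>\<in>simplices K. \<sigma> \<subseteq> ?B}}" by blast
    also have "\<dots> = {\<tau>\<in>simplices L'. \<tau> \<subseteq> translates G \<psi> ?C}"
      unfolding \<theta>s simps_tr[OF i(2) B(2)] ..
    finally show ?thesis .
  qed
  have "giso G F (full_subcomplex K' (translates G \<phi> ?B)) (full_subcomplex L' (translates G \<psi> ?C))"
  proof -
    have tr: "translates G \<phi> ?B \<subseteq> verts K'" "translates G \<psi> ?C \<subseteq> verts L'"
      using B by (auto simp: induced_verts[OF i(1)] induced_verts[OF i(2)] translates_def)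
    have eqv: "F (action (full_subcomplex K' (translates G \<phi> ?B)) h y) =
        action (full_subcomplex L' (translates G \<psi> ?C)) h (F y)"
      if h: "h \<in> carrier G" and y: "y \<in> translates G \<phi> ?B" for h y
    proof -
      obtain g v where gv: "g \<in> carrier G" "v \<in> ?B" "y = \<phi> g v" using y by (auto simp: translates_def)
      then have v: "v \<in> verts K" "\<theta> v \<in> verts L" using B bij by (auto simp: bij_betw_def)
      have "F y \<in> translates G \<psi> ?C" using y image_B by blast
      then show ?thesis
        using y gv v h by (simp add: full_subcomplex_def inducedD(3)[OF i(1)] inducedD(3)[OF i(2)] F)
    qed
    show ?thesis
      unfolding giso_def full_subcomplex_verts[OF sc(3) tr(1)] full_subcomplex_verts[OF sc(4) tr(2)]
      using inj image_B simplices_F eqv by (auto simp: bij_betw_def full_subcomplex_def)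
  qed
  moreover have "F ` translates G \<phi> V = translates G \<psi> U" using Ftr[OF V(1)] \<theta>(2) by simp
  ultimately show ?thesis
    unfolding rooted_iso_iff cball_complex_eq ball_verts_induced[OF i(1) V(1)] ball_verts_induced[OF i(2) V(2)]
    by (intro exI[of _ F]) simp
qed

section \<open>The induction map on isomorphism classes\<close>

locale finite_group = group G for G :: "'g monoid" (structure) +
  assumes finite_carrier: "finite (carrier G)"
begin

abbreviation "TG \<equiv> trivial_subgroup G"

lemma TG_group: "group TG"
  by (rule subgroup.subgroup_is_group[OF triv_subgroup is_group])

text \<open>Under the trivial subgroup each equivalence class of pairs has a single element.\<close>

lemma ind_pt_trivial:
  assumes K: "simplicial_gcomplex TG K" and "g \<in> carrier G" "v \<in> verts K"
  shows "ind_pt G {\<one>} (action K) g v = {(g, v)}"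
proof -
  have "action K \<one> v = v"
    using group_action.id_eq_one[OF simplicial_gcomplexD(2)[OF K]] assms(3) by (metis monoid.simps(2) monoid.select_convs(2) monoid.surjective partial_object.update_convs(1) restrict_apply')
  then show ?thesis using assms(2) by (simp add: ind_pt_def)
qed

lemma ind_complex_induced:
  assumes K: "simplicial_gcomplex TG K"
  shows "induced G (\<lambda>g v. {(g, v)}) K (ind_complex G {\<one>} K)"
proof -
  note pt = ind_pt_trivial[OF K]
  have im: "ind_pt G {\<one>} (action K) g ` \<sigma> = (\<lambda>v. {(g, v)}) ` \<sigma>" if "g \<in> carrier G" "\<sigma> \<in> simplices K" for g \<sigma>
    using pt[OF that(1)] simplex_verts[OF that(2)] by (intro image_cong) auto
  show ?thesis
    unfolding induced_def
  proof (intro conjI ballI impI)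
    show "simplices (ind_complex G {\<one>} K) = {(\<lambda>v. {(g, v)}) ` \<sigma> | g \<sigma>. g \<in> carrier G \<and> \<sigma> \<in> simplices K}"
      unfolding ind_complex_def gcomplex.simps by (rule Collect_cong) (metis im)
    fix g h v assume a: "g \<in> carrier G" "h \<in> carrier G" "v \<in> verts K"
    have "{(g, v)} \<in> {ind_pt G {\<one>} (action K) g' y | g' y. g' \<in> carrier G \<and> y \<in> verts K}"
      using a pt by blast
    then show "action (ind_complex G {\<one>} K) h {(g, v)} = {(h \<otimes> g, v)}"
      by (simp add: ind_complex_def)
  qed auto
qed

lemma ind_complex_simplicial:
  assumes K: "simplicial_gcomplex TG K"
  shows "simplicial_gcomplex G (ind_complex G {\<one>} K)"
proof (rule induced_simplicial[OF ind_complex_induced[OF K] is_group simplicial_gcomplexD(1)[OF K]])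
  have "verts (ind_complex G {\<one>} K) = {ind_pt G {\<one>} (action K) g' y | g' y. g' \<in> carrier G \<and> y \<in> verts K}"
    unfolding induced_verts[OF ind_complex_induced[OF K]] translates_def
    using ind_pt_trivial[OF K] by (auto; metis)
  then show "action (ind_complex G {\<one>} K) g \<in> extensional (verts (ind_complex G {\<one>} K))" for g
    by (simp add: ind_complex_def)
qed

lemma TG_root:
  assumes "rooted_gcomplex TG K [r]"
  obtains x where "x \<in> verts K" "r = {x}"
proof -
  obtain x where x: "x \<in> verts K" "r = orbit TG (action K) x" and K: "simplicial_gcomplex TG K"
    using assms by (auto simp: rooted_gcomplex_def orbits_def)
  have "orbit TG (action K) x = {action K \<one> x}" by (auto simp: orbit_def)
  then have "r = {x}"
    using group_action.orbit_refl[OF simplicial_gcomplexD(2)[OF K] x(1)] x(2) by simp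
  then show ?thesis using that x(1) by blast
qed

text \<open>The root is one vertex, so its translates form one orbit, and a vertex of the g-th copy
  is reached from the root of the same copy.\<close>

lemma induced_rooted:
  assumes i: "induced G \<phi> K K'" and K': "simplicial_gcomplex G K'" and K: "rooted_gcomplex TG K [r]"
  shows "rooted_gcomplex G K' [translates G \<phi> r]"
proof -
  obtain x where x: "x \<in> verts K" "r = {x}" by (rule TG_root[OF K])
  have "translates G \<phi> r = orbit G (action K') (\<phi> \<one> x)"
    unfolding translates_def x(2) orbit_def using inducedD(3)[OF i one_closed _ x(1)] by (auto; metis r_one)
  moreover have "\<phi> \<one> x \<in> verts K'" using x(1) by (auto simp: induced_verts[OF i] translates_def)
  moreover have "\<exists>u\<in>translates G \<phi> r. (u, w) \<in> (adjacent K')\<^sup>*" if w: "w \<in> verts K'" for w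
  proof -
    obtain g v where gv: "g \<in> carrier G" "v \<in> verts K" "w = \<phi> g v"
      using w by (auto simp: induced_verts[OF i] translates_def)
    have "(x, v) \<in> (adjacent K)\<^sup>*" using K gv(2) x(2) by (auto simp: rooted_gcomplex_def)
    then have "(\<phi> g x, w) \<in> (adjacent K')\<^sup>*"
      using locally_iso_reach[OF induced_locally_iso[OF i gv(1)]] x(1) gv(3) by blast
    then show ?thesis using gv(1) x(2) by (auto simp: translates_def)
  qed
  ultimately show ?thesis using K' by (auto simp: rooted_gcomplex_def orbits_def)
qed

lemma ind_class_eq:
  assumes c: "c \<in> SC TG D 1"
  shows "ind_class G {\<one>} c = rooted_class G (ind_complex G {\<one>} (rep_complex c))
    [translates G (\<lambda>g v. {(g, v)}) (rep_root c)]"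
proof -
  note r = SC_rep[OF c]
  have K: "simplicial_gcomplex TG (rep_complex c)" using r(2) by (simp add: rooted_gcomplex_def)
  have "{ind_pt G {\<one>} (action (rep_complex c)) g x | g x. g \<in> carrier G \<and> x \<in> rep_root c} =
      translates G (\<lambda>g v. {(g, v)}) (rep_root c)"
    unfolding translates_def using ind_pt_trivial[OF K] rooted_root_subset(1)[OF r(2)]
    by (auto simp: subset_iff; metis)
  then show ?thesis by (simp add: ind_class_def)
qed

text \<open>The vertices of the induced complex are sets of pairs. They are countably many, so there
  is a copy on \<open>nat\<close>, as membership in \<open>SC\<close> demands.\<close>

lemma ind_class_SC:
  assumes c: "c \<in> SC TG D 1"
  shows "ind_class G {\<one>} c \<in> SC G D 1"
proof -
  note r = SC_rep[OF c]
  let ?K = "rep_complex c"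
  let ?I = "ind_complex G {\<one>} ?K" and ?t = "translates G (\<lambda>g v. {(g, v)}) (rep_root c)"
  have K: "simplicial_gcomplex TG ?K" using r(2) by (simp add: rooted_gcomplex_def)
  note i = ind_complex_induced[OF K] and I = ind_complex_simplicial[OF K]
  have "verts ?I = (\<lambda>(g, v). {(g, v)}) ` (carrier G \<times> verts ?K)"
    unfolding induced_verts[OF i] translates_def by auto
  then have "countable (verts ?I)" using finite_carrier by (simp add: countable_finite)
  then have inj: "inj_on (to_nat_on (verts ?I)) (verts ?I)" by (rule inj_on_to_nat_on)
  let ?e = "to_nat_on (verts ?I)"
  note copy = copy_complex[OF I inj]
  have root: "rooted_gcomplex G ?I [?t]" by (rule induced_rooted[OF i I r(2)])
  have "rooted_gcomplex G (copy_complex ?e ?I) [?e ` ?t]" by (rule giso_rooted[OF copy(2,3) root])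
  moreover have "degree_bounded D (copy_complex ?e ?I)"
    by (rule giso_degree[OF copy(2) induced_degree[OF i r(3)]])
  moreover have "ind_class G {\<one>} c = rooted_class G (copy_complex ?e ?I) [?e ` ?t]"
    unfolding ind_class_eq[OF c]
  proof (rule rooted_class_cong[OF _ I])
    show "rooted_iso G ?I [?t] (copy_complex ?e ?I) [?e ` ?t]"
      unfolding rooted_iso_iff using copy(2) by (intro exI[of _ ?e]) simp
    show "s \<subseteq> verts ?I" if "s \<in> set [?t]" for s using rooted_root_subset(1)[OF root] that by simp
  qed
  ultimately show ?thesis unfolding SC_def by (intro CollectI exI[of _ "copy_complex ?e ?I"] exI[of _ "[?e ` ?t]"]) simp
qed

text \<open>Complexes representing a class and its induced class stand in the relation
  \<open>induced\<close>, however they were chosen. This connects the two independent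
  realizations.\<close>

lemma ind_class_induced:
  assumes c: "c \<in> SC TG D 1"
    and A: "simplicial_gcomplex TG A" "rooted_class TG A [a] = c"
    and B: "simplicial_gcomplex G B" "rooted_class G B [b] = ind_class G {\<one>} c"
  obtains \<phi> where "induced G \<phi> A B" "b = translates G \<phi> a"
proof -
  note r = SC_rep[OF c]
  let ?K = "rep_complex c"
  let ?I = "ind_complex G {\<one>} ?K" and ?t = "translates G (\<lambda>g v. {(g, v)}) (rep_root c)"
  have K: "simplicial_gcomplex TG ?K" using r(2) by (simp add: rooted_gcomplex_def)
  note i = ind_complex_induced[OF K] and ic = ind_class_SC[OF c]
  obtain N ns where N: "(N, ns) \<in> ind_class G {\<one>} c" by (rule SC_nonempty[OF ic])
  obtain h where h: "giso G h ?I N" "ns = [h ` ?t]"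
    using N unfolding ind_class_eq[OF c] by (auto simp: rooted_class_iff rooted_iso_iff)
  obtain k where k: "giso G k B N" "[k ` b] = ns"
    using N unfolding B(2)[symmetric] by (auto simp: rooted_class_iff rooted_iso_iff)
  obtain f where f: "giso TG f A ?K" "f ` a = rep_root c"
    using r(1) unfolding A(2)[symmetric] by (auto simp: rooted_class_iff rooted_iso_iff)
  have b: "b \<subseteq> verts B" by (rule root_subset_verts[OF ic B])
  have inj: "inj_on k (verts B)" using k(1) by (simp add: giso_def bij_betw_def)
  \<comment> \<open>A vertex of \<open>A\<close> goes to the chosen representative, is paired with
    \<open>g\<close>, passes to the common copy \<open>N\<close> and from there back to
    \<open>B\<close>.\<close>
  let ?\<phi> = "\<lambda>g v. inv_into (verts B) k (h {(g, f v)})"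
  have ind: "induced G ?\<phi> A B"
    using induced_giso_right[OF induced_giso_right[OF induced_giso_left[OF i f(1)] h(1) is_group] giso_inv[OF k(1) B(1)] is_group] .
  have "b = inv_into (verts B) k ` k ` b" using inv_into_image_cancel[OF inj b] by simp
  also have "k ` b = h ` ?t" using k(2) h(2) by simp
  also have "?t = translates G (\<lambda>g v. {(g, f v)}) a"
    unfolding f(2)[symmetric] by (auto simp: translates_def)
  finally have "b = translates G ?\<phi> a" by (auto simp: translates_def)
  with ind show ?thesis by (rule that)
qed

text \<open>Isomorphic balls induce isomorphic balls of the same radius, so the infimum on the left
  is over a larger set; induction is 1-Lipschitz.\<close>

lemma ind_class_dist:
  assumes c: "c \<in> SC TG D 1" "c' \<in> SC TG D 1"
  shows "SC_dist G (ind_class G {\<one>} c) (ind_class G {\<one>} c') \<le> SC_dist TG c c'"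
  unfolding SC_dist_def
proof (rule INF_superset_mono)
  let ?S = "\<lambda>H c c'. {r::real. r > 0 \<and> (\<exists>(K, os)\<in>c. \<exists>(L, os')\<in>c'.
     rooted_iso H (cball_complex r K (\<Union> (set os))) os (cball_complex r L (\<Union> (set os'))) os')}"
  show "?S TG c c' \<subseteq> ?S G (ind_class G {\<one>} c) (ind_class G {\<one>} c')"
  proof
    fix r assume "r \<in> ?S TG c c'"
    then obtain K os L os' where r: "r > 0" and KL: "(K, os) \<in> c" "(L, os') \<in> c'"
      and iso: "rooted_iso TG (cball_complex r K (\<Union> (set os))) os (cball_complex r L (\<Union> (set os'))) os'" by blast
    obtain V where V: "os = [V]" "rooted_gcomplex TG K [V]" "c = rooted_class TG K [V]" by (rule SC_member[OF c(1) KL(1)])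
    obtain U where U: "os' = [U]" "rooted_gcomplex TG L [U]" "c' = rooted_class TG L [U]" by (rule SC_member[OF c(2) KL(2)])
    obtain K' ks where K': "(K', ks) \<in> ind_class G {\<one>} c" by (rule SC_nonempty[OF ind_class_SC[OF c(1)]])
    obtain L' ls where L': "(L', ls) \<in> ind_class G {\<one>} c'" by (rule SC_nonempty[OF ind_class_SC[OF c(2)]])
    obtain v where v: "ks = [v]" "rooted_gcomplex G K' [v]" "ind_class G {\<one>} c = rooted_class G K' [v]"
      by (rule SC_member[OF ind_class_SC[OF c(1)] K'])
    obtain u where u: "ls = [u]" "rooted_gcomplex G L' [u]" "ind_class G {\<one>} c' = rooted_class G L' [u]"
      by (rule SC_member[OF ind_class_SC[OF c(2)] L'])
    have s: "simplicial_gcomplex TG K" "simplicial_gcomplex TG L" "simplicial_gcomplex G K'" "simplicial_gcomplex G L'"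
      using V(2) U(2) v(2) u(2) by (auto simp: rooted_gcomplex_def)
    obtain \<phi> where \<phi>: "induced G \<phi> K K'" "v = translates G \<phi> V"
      by (rule ind_class_induced[OF c(1) s(1) V(3)[symmetric] s(3) v(3)[symmetric]])
    obtain \<psi> where \<psi>: "induced G \<psi> L L'" "u = translates G \<psi> U"
      by (rule ind_class_induced[OF c(2) s(2) U(3)[symmetric] s(4) u(3)[symmetric]])
    have sub: "V \<subseteq> verts K" "U \<subseteq> verts L" using rooted_root_subset V(2) U(2) by blast+
    have Vb: "V \<subseteq> ball_verts r K V"
    proof
      fix x assume x: "x \<in> V"
      then have "(x, x) \<in> adjacent K ^^ 0" "real 0 \<le> r" "x \<in> verts K" using r sub by auto
      with x show "x \<in> ball_verts r K V" unfolding ball_verts_def by blast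
    qed
    have "rooted_iso G (cball_complex r K' v) [v] (cball_complex r L' u) [u]"
      unfolding \<phi>(2) \<psi>(2)
      by (rule induced_ball_iso[OF is_group \<phi>(1) \<psi>(1) s sub Vb]) (use iso V(1) U(1) in simp)
    then have "\<exists>(L, os')\<in>ind_class G {\<one>} c'.
        rooted_iso G (cball_complex r K' (\<Union> (set ks))) ks (cball_complex r L (\<Union> (set os'))) os'"
      using L' v(1) u(1) by (intro bexI[of _ "(L', ls)"]) auto
    then show "r \<in> ?S G (ind_class G {\<one>} c) (ind_class G {\<one>} c')"
      using r K' by blast
  qed
qed auto

lemma SC_borel_space: "space (SC_borel H D k) = SC H D k"
  unfolding SC_borel_def by (rule space_measure_of) (auto simp: openin_SC_top)

lemma open_in_SC_borel: "openin (SC_top H D k) U \<Longrightarrow> U \<in> sets (SC_borel H D k)"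
  unfolding SC_borel_def by (subst sets_measure_of) (auto simp: openin_SC_top)

text \<open>By the Lipschitz estimate preimages of open sets are open, and open sets generate the
  Borel sets.\<close>

lemma ind_class_measurable: "ind_class G {\<one>} \<in> measurable (SC_borel TG D 1) (SC_borel G D 1)"
proof -
  have "ind_class G {\<one>} \<in> measurable (SC_borel TG D 1) (sigma (SC G D 1) {U. openin (SC_top G D 1) U})"
  proof (rule measurable_measure_of)
    fix U assume "U \<in> {U. openin (SC_top G D 1) U}"
    then have U: "U \<subseteq> SC G D 1" "\<And>c. c \<in> U \<Longrightarrow> \<exists>e>0. \<forall>c'\<in>SC G D 1. SC_dist G c c' < e \<longrightarrow> c' \<in> U"
      by (auto simp: openin_SC_top)
    let ?V = "ind_class G {\<one>} -` U \<inter> SC TG D 1"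
    have "openin (SC_top TG D 1) ?V"
      unfolding openin_SC_top
    proof (intro conjI ballI)
      fix c assume c: "c \<in> ?V"
      then obtain e where e: "e > 0" "\<forall>c'\<in>SC G D 1. SC_dist G (ind_class G {\<one>} c) c' < e \<longrightarrow> c' \<in> U"
        using U(2) by blast
      have "c' \<in> ?V" if "c' \<in> SC TG D 1" "SC_dist TG c c' < e" for c'
        using ind_class_dist[of c D c'] ind_class_SC[OF that(1)] that c e(2) by (auto intro: le_less_trans)
      then show "\<exists>e>0. \<forall>c'\<in>SC TG D 1. SC_dist TG c c' < e \<longrightarrow> c' \<in> ?V" using e(1) by blast
    qed auto
    then show "ind_class G {\<one>} -` U \<inter> space (SC_borel TG D 1) \<in> sets (SC_borel TG D 1)"
      unfolding SC_borel_space by (rule open_in_SC_borel)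
  qed (use ind_class_SC in \<open>auto simp: openin_SC_top SC_borel_space simp del: One_nat_def\<close>)
  then show ?thesis by (simp add: SC_borel_def)
qed

end

section \<open>Finiteness of the set of orbit types\<close>

context finite_group
begin

definition shift :: "'g \<Rightarrow> 'g set \<Rightarrow> 'g set" where
  "shift g A = (\<lambda>a. g \<otimes> a) ` A"

text \<open>The coset space G/H, realised on subsets of \<open>G\<close> because this is the type of
  the test objects in \<open>orbit_representatives\<close>.\<close>

definition coset_gset :: "'g set \<Rightarrow> ('g, 'g set) gset" where
  "coset_gset H = ((\<lambda>g. shift g H) ` carrier G, \<lambda>g. restrict (shift g) ((\<lambda>g. shift g H) ` carrier G))"

lemma shift_shift:
  assumes "A \<subseteq> carrier G" "g \<in> carrier G" "h \<in> carrier G"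
  shows "shift g (shift h A) = shift (g \<otimes> h) A"
proof -
  have "g \<otimes> (h \<otimes> a) = g \<otimes> h \<otimes> a" if "a \<in> A" for a using assms that by (simp add: m_assoc subset_iff)
  then show ?thesis by (simp add: shift_def image_image)
qed

text \<open>The isomorphism sends \<open>y\<close> to the set of all \<open>g\<close> that carry
  \<open>x\<close> to \<open>y\<close>, which is a left coset of the stabilizer.\<close>

lemma coset_gset_iso:
  assumes X: "transitive_gset G X" and x: "x \<in> fst X"
  shows "transitive_gset G (coset_gset (stabilizer G (snd X) x))"
    "gset_iso G X (coset_gset (stabilizer G (snd X) x))"
proof -
  interpret X: transitive_action G "fst X" "snd X" using X by (simp add: transitive_gset_def)
  define H where "H = stabilizer G (snd X) x"
  have H: "H \<subseteq> carrier G" by (auto simp: H_def stabilizer_def)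
  let ?Y = "coset_gset H"
  have act: "snd ?Y g (shift h H) = shift (g \<otimes> h) H" if "g \<in> carrier G" "h \<in> carrier G" for g h
    using that H by (simp add: coset_gset_def shift_shift)
  have Y: "\<exists>h\<in>carrier G. A = shift h H" if "A \<in> fst ?Y" for A using that by (auto simp: coset_gset_def)
  have in_Y: "shift h H \<in> fst ?Y" if "h \<in> carrier G" for h using that by (simp add: coset_gset_def)
  have ga: "group_action G (fst ?Y) (snd ?Y)"
  proof (rule group_actionI[OF is_group])
    show "snd ?Y g \<in> extensional (fst ?Y)" for g by (simp add: coset_gset_def)
  next
    fix g A assume "g \<in> carrier G" "A \<in> fst ?Y"
    then show "snd ?Y g A \<in> fst ?Y" using Y[of A] act in_Y by auto
  next
    fix A assume "A \<in> fst ?Y"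
    then show "snd ?Y \<one> A = A" using Y[of A] act by auto
  next
    fix g h A assume "g \<in> carrier G" "h \<in> carrier G" "A \<in> fst ?Y"
    then show "snd ?Y (g \<otimes> h) A = snd ?Y g (snd ?Y h A)" using Y[of A] act by (auto simp: m_assoc)
  qed
  have "transitive_action G (fst ?Y) (snd ?Y)"
  proof (rule transitive_action.intro[OF ga], unfold_locales)
    fix A B assume "A \<in> fst ?Y" "B \<in> fst ?Y"
    then obtain h k where hk: "h \<in> carrier G" "A = shift h H" "k \<in> carrier G" "B = shift k H" using Y by metis
    have "k \<otimes> inv h \<otimes> h = k" using hk by (simp add: m_assoc)
    then show "\<exists>g\<in>carrier G. snd ?Y g A = B"
      using hk act[of "k \<otimes> inv h" h] by (intro bexI[of _ "k \<otimes> inv h"]) auto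
  qed
  moreover have "fst ?Y \<noteq> {}" by (auto simp: coset_gset_def)
  ultimately show "transitive_gset G (coset_gset (stabilizer G (snd X) x))"
    by (simp add: transitive_gset_def H_def)
  define f where "f y = {g \<in> carrier G. snd X g x = y}" for y
  have f: "f (snd X k x) = shift k H" if k: "k \<in> carrier G" for k
  proof safe
    fix g assume "g \<in> f (snd X k x)"
    then have g: "g \<in> carrier G" "snd X g x = snd X k x" by (auto simp: f_def)
    have "snd X (inv k \<otimes> g) x = snd X (inv k) (snd X k x)"
      using X.composition_rule[OF x, of "inv k" g] g k by simp
    also have "\<dots> = x" by (rule X.orbit_sym_aux[OF k x refl])
    finally have "inv k \<otimes> g \<in> H" using g k by (simp add: H_def stabilizer_def)
    moreover have "g = k \<otimes> (inv k \<otimes> g)" using g k by (simp flip: m_assoc)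
    ultimately show "g \<in> shift k H" unfolding shift_def by blast
  next
    fix g assume "g \<in> shift k H"
    then obtain h where h: "h \<in> carrier G" "snd X h x = x" "g = k \<otimes> h" by (auto simp: shift_def H_def stabilizer_def)
    then show "g \<in> f (snd X k x)" using k X.composition_rule[OF x k h(1)] by (simp add: f_def)
  qed
  have orb: "\<exists>k\<in>carrier G. y = snd X k x" if "y \<in> fst X" for y using X.unique_orbit[OF x that] by blast
  have inj: "inj_on f (fst X)"
  proof (rule inj_onI)
    fix y z assume yz: "y \<in> fst X" "z \<in> fst X" "f y = f z"
    then obtain k where "k \<in> f y" using orb by (auto simp: f_def)
    then show "y = z" using yz(3) by (auto simp: f_def)
  qed
  have "f ` fst X = fst ?Y"
  proof safe
    fix y assume "y \<in> fst X"
    then show "f y \<in> fst ?Y" using orb[of y] f in_Y by auto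
  next
    fix A assume "A \<in> fst ?Y"
    then obtain h where h: "h \<in> carrier G" "A = shift h H" using Y by blast
    then show "A \<in> f ` fst X" using f[OF h(1)] X.element_image[OF h(1) x refl] by blast
  qed
  moreover have "f (snd X g y) = snd ?Y g (f y)" if g: "g \<in> carrier G" and y: "y \<in> fst X" for g y
  proof -
    obtain k where k: "k \<in> carrier G" "y = snd X k x" using orb[OF y] by blast
    have "snd X g y = snd X (g \<otimes> k) x" using X.composition_rule[OF x g k(1)] k(2) by simp
    then show ?thesis using f[of "g \<otimes> k"] f[OF k(1)] act[OF g k(1)] g k by simp
  qed
  ultimately show "gset_iso G X (coset_gset (stabilizer G (snd X) x))"
    unfolding gset_iso_def H_def[symmetric] using inj by (auto simp: bij_betw_def)
qed

text \<open>The stabilizer of a point determines a transitive set up to isomorphism, and each type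
  has one representative. Choosing stabilizers thus embeds \<open>Orb\<close> into the subsets of
  \<open>G\<close>.\<close>

lemma finite_representatives:
  assumes "orbit_representatives G Orb"
  shows "finite Orb"
proof -
  let ?H = "\<lambda>X. stabilizer G (snd X) (SOME x. x \<in> fst X)"
  have X: "transitive_gset G X" "(SOME x. x \<in> fst X) \<in> fst X" if "X \<in> Orb" for X
    using assms that by (auto simp: orbit_representatives_def transitive_gset_def some_in_eq)
  have "inj_on ?H Orb"
  proof (rule inj_onI)
    fix X X' assume XX: "X \<in> Orb" "X' \<in> Orb" "?H X = ?H X'"
    note i = coset_gset_iso[OF X[OF XX(1)]] coset_gset_iso(2)[OF X[OF XX(2)]]
    have "\<exists>!Z. Z \<in> Orb \<and> gset_iso G Z (coset_gset (?H X))"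
      using i(1) spec[OF conjunct2[OF assms[unfolded orbit_representatives_def]], of "coset_gset (?H X)"]
      by (rule rev_mp)
    then show "X = X'" using XX(1,2) i(2) i(3)[folded XX(3)] by (elim ex1E) blast
  qed
  moreover have "?H ` Orb \<subseteq> Pow (carrier G)" unfolding stabilizer_def by blast
  moreover have "finite (Pow (carrier G))" using finite_carrier by simp
  ultimately show ?thesis by (rule inj_on_finite)
qed

end

section \<open>The realization map\<close>

lemma SC_top_space: "topspace (SC_top G D k) = SC G D k"
proof
  show "topspace (SC_top G D k) \<subseteq> SC G D k"
    using openin_topspace[of "SC_top G D k"] by (simp only: openin_SC_top)
  have "openin (SC_top G D k) (SC G D k)"
    unfolding openin_SC_top by (auto intro: exI[of _ 1])
  then show "SC G D k \<subseteq> topspace (SC_top G D k)" by (rule openin_subset)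
qed

locale realized = orbit_system G Orb for G :: "'g monoid" (structure) and Orb :: "('g, 'x) gset set" +
  fixes D :: nat and \<Psi> :: "('g, 'x) realization"
  assumes representatives: "orbit_representatives G Orb"
    and realization: "realization_map G D Orb \<Psi>"
begin

lemma finite_Orb: "finite Orb"
proof -
  interpret finite_group G by unfold_locales (rule finite_carrier)
  show ?thesis by (rule finite_representatives[OF representatives])
qed

lemma Sub: "c \<in> SC G D 1 \<Longrightarrow> \<Psi> c \<in> Sub G D Orb"
  using realization by (simp add: realization_map_def)

lemma orbit_complex_fibre:
  assumes "c \<in> SC G D 1"
  shows "orbit_complex G Orb (\<Psi> c)"
proof
  show "simplicial_complex (\<Psi> c)" "\<Union> (\<Psi> c) \<subseteq> NG Orb" using Sub[OF assms] by (auto simp: Sub_def Delta_def)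
  show "NG_act g ` s \<in> \<Psi> c" if "g \<in> carrier G" "s \<in> \<Psi> c" for g s
    using Sub[OF assms] that by (auto simp: Sub_def)
qed

lemma sub_gcomplex_simps: "simplices (sub_gcomplex S) = S" "verts (sub_gcomplex S) = \<Union>S"
  by (simp_all add: sub_gcomplex_def)

lemma sub_gcomplex_simplicial:
  assumes "c \<in> SC G D 1"
  shows "simplicial_gcomplex G (sub_gcomplex (\<Psi> c))"
proof -
  interpret O: orbit_complex G Orb "\<Psi> c" by (rule orbit_complex_fibre[OF assms])
  have NG: "v \<in> NG Orb" if "v \<in> \<Union>(\<Psi> c)" for v using that O.vertices by blast
  have act: "NG_act g v \<in> \<Union>(\<Psi> c)" if "g \<in> carrier G" "v \<in> \<Union>(\<Psi> c)" for g v
    using that O.invariant by blast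
  have "group_action G (\<Union>(\<Psi> c)) (action (sub_gcomplex (\<Psi> c)))"
    by (rule group_actionI[OF is_group])
      (simp_all add: sub_gcomplex_def NG_act_one[OF NG] NG_act_mult[OF NG] act del: Union_iff)
  moreover have "action (sub_gcomplex (\<Psi> c)) g ` \<sigma> \<in> \<Psi> c" if "g \<in> carrier G" "\<sigma> \<in> \<Psi> c" for g \<sigma>
  proof -
    have "action (sub_gcomplex (\<Psi> c)) g ` \<sigma> = NG_act g ` \<sigma>"
      using that by (intro image_cong) (auto simp: sub_gcomplex_def)
    then show ?thesis using O.invariant that by simp
  qed
  ultimately show ?thesis
    unfolding simplicial_gcomplex_def sub_gcomplex_simps using O.complex by blast
qed

text \<open>A single vertex of type \<open>X'\<close> at level 0 brings its whole orbit along by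
  invariance, and \<open>Sub\<close> admits only one such orbit.\<close>

lemma root_type:
  assumes c: "c \<in> SC G D 1"
  obtains X where "X \<in> Orb" "base_orbit X \<subseteq> \<Union>(\<Psi> c)" "rooted_class G (sub_gcomplex (\<Psi> c)) [base_orbit X] = c"
    "\<And>X' x'. X' \<in> Orb \<Longrightarrow> x' \<in> fst X' \<Longrightarrow> (0, X', x') \<in> \<Union>(\<Psi> c) \<Longrightarrow> X' = X"
proof -
  obtain K ks where K: "(K, ks) \<in> c" by (rule SC_nonempty[OF c])
  obtain r where "ks = [r]" by (rule SC_member[OF c K])
  then obtain X where X: "X \<in> Orb" "rooted_class G (sub_gcomplex (\<Psi> c)) [base_orbit X] = c"
    using realization K c unfolding realization_map_def by blast
  have sub: "base_orbit X \<subseteq> \<Union>(\<Psi> c)"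
    using root_subset_verts[OF c sub_gcomplex_simplicial[OF c] X(2)] by (simp add: sub_gcomplex_simps)
  have "X' = X" if X': "X' \<in> Orb" "x' \<in> fst X'" "(0, X', x') \<in> \<Union>(\<Psi> c)" for X' x'
  proof -
    interpret O: orbit_complex G Orb "\<Psi> c" by (rule orbit_complex_fibre[OF c])
    interpret X': transitive_action G "fst X'" "snd X'" using transitive[OF X'(1)] by (simp add: transitive_gset_def)
    have "base_orbit X' \<subseteq> \<Union>(\<Psi> c)"
    proof
      fix w assume "w \<in> base_orbit X'"
      then obtain y where y: "y \<in> fst X'" "w = (0, X', y)" by (auto simp: base_orbit_def)
      obtain g where g: "g \<in> carrier G" "snd X' g x' = y" using X'.unique_orbit[OF X'(2) y(1)] by blast
      obtain s where s: "s \<in> \<Psi> c" "(0, X', x') \<in> s" using X'(3) by blast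
      have "w = NG_act g (0, X', x')" using y g X'(2) by (simp add: NG_act_def)
      then have "w \<in> NG_act g ` s" using s(2) by blast
      then show "w \<in> \<Union>(\<Psi> c)" using O.invariant[OF g(1) s(1)] by blast
    qed
    moreover have "\<exists>!X. X \<in> Orb \<and> base_orbit X \<subseteq> \<Union>(\<Psi> c)" using Sub[OF c] by (simp add: Sub_def)
    ultimately show ?thesis using X(1) X'(1) sub by blast
  qed
  then show ?thesis using that X sub by blast
qed

text \<open>\<open>Sub\<close> limits the size of simplices and not the degrees; the degree bound is
  carried over from a member of the class.\<close>

lemma bounded_fibre:
  assumes c: "c \<in> SC G D 1"
  shows "bounded_orbit_complex G Orb (\<Psi> c) D"
proof -
  obtain X where X: "rooted_class G (sub_gcomplex (\<Psi> c)) [base_orbit X] = c" by (rule root_type[OF c])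
  obtain K ks where K: "(K, ks) \<in> c" by (rule SC_nonempty[OF c])
  have deg: "degree_bounded D K" by (rule SC_member[OF c K])
  obtain f where "giso G f (sub_gcomplex (\<Psi> c)) K"
    using K X by (metis rooted_class_iff rooted_iso_iff)
  from giso_degree[OF giso_inv[OF this sub_gcomplex_simplicial[OF c]] deg]
  have "degree_bounded D (sub_gcomplex (\<Psi> c))" .
  then have "bounded_complex (\<Psi> c) D"
    unfolding bounded_complex_def degree_bounded_def sub_gcomplex_simps
    using orbit_complex.complex[OF orbit_complex_fibre[OF c]] by blast
  then show ?thesis
    using orbit_complex_fibre[OF c] by (simp add: bounded_orbit_complex_def)
qed

text \<open>Membership of \<open>s\<close> is one coordinate of the continuous realization map with
  values in a discrete space, so the event is even open.\<close>

lemma simplex_event: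
  assumes s: "s \<in> Delta D Orb"
  shows "{c \<in> SC G D 1. s \<in> \<Psi> c} \<in> sets (SC_borel G D 1)"
proof -
  have "continuous_map (SC_top G D 1) (discrete_topology (UNIV :: bool set))
      ((\<lambda>f. f s) \<circ> (\<lambda>c. \<lambda>s\<in>Delta D Orb. s \<in> \<Psi> c))"
    by (rule continuous_map_compose[OF conjunct1[OF conjunct2[OF realization[unfolded realization_map_def]]]
          continuous_map_product_projection[OF s]])
  from openin_continuous_map_preimage[OF this, of "{True}"]
  have "openin (SC_top G D 1) {c \<in> SC G D 1. s \<in> \<Psi> c}" using s by (simp add: SC_top_space)
  then show ?thesis
    unfolding SC_borel_def by (subst sets_measure_of) (auto simp: openin_SC_top)
qed

lemma chain_field_space:
  assumes "prob_space \<mu>" "sets \<mu> = sets (SC_borel G D 1)"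
  shows "chain_field_space G Orb \<mu> D \<Psi>"
proof -
  interpret prob_space \<mu> by fact
  have "space (SC_borel G D 1) = SC G D 1"
    unfolding SC_borel_def by (rule space_measure_of) (auto simp: openin_SC_top)
  then have space: "space \<mu> = SC G D 1" using sets_eq_imp_space_eq[OF assms(2)] by simp
  show ?thesis
  proof (rule chain_field_space.intro[OF orbit_system_axioms prob_space_axioms chain_field_space_axioms.intro])
    show "finite Orb" by (rule finite_Orb)
  next
    fix c assume "c \<in> space \<mu>"
    then have c: "c \<in> SC G D 1" by (simp add: space)
    show "bounded_orbit_complex G Orb (\<Psi> c) D" by (rule bounded_fibre[OF c])
    show "\<Psi> c \<subseteq> Delta D Orb" using Sub[OF c] by (simp add: Sub_def)
  next
    show "{c \<in> space \<mu>. s \<in> \<Psi> c} \<in> sets \<mu>" if "s \<in> Delta D Orb" for s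
      using simplex_event[OF that] by (simp add: space assms(2))
  qed
qed

end

section \<open>Comparison of the traces\<close>

lemma (in bounded_complex) laplacian_harmonic:
  "f \<in> l2_chains L n \<Longrightarrow> laplacian L n f = (\<lambda>_. 0) \<longleftrightarrow> f \<in> harmonic L n"
  by (simp add: laplacian_eq_0_iff harmonic_def)

text \<open>The identity fixes lists over \<open>NG Orb\<close>, and at lists off the complex both
  chains vanish.\<close>

lemma (in finite_group) iso_harmonic_trivial:
  assumes "orbit_complex TG Orb M"
  shows "iso_harmonic TG (\<lambda>_. 1) M n = harmonic M n"
proof -
  interpret O: orbit_complex TG Orb M by fact
  have "isoproj TG (\<lambda>_. 1) f = f" if f: "f \<in> harmonic M n" for f
  proof
    fix xs
    have iso: "isoproj TG (\<lambda>_. 1) f xs = f (map (NG_act \<one>) xs)"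
      using O.inv_one by (simp add: isoproj_def chain_act_def)
    show "isoproj TG (\<lambda>_. 1) f xs = f xs"
    proof (cases "xs \<in> ordered_simplices M")
      case True
      then have "map (NG_act \<one>) xs = xs"
        using O.ordered_vertices[OF True] O.NG_act_one by (auto intro!: map_idI)
      then show ?thesis by (simp add: iso)
    next
      case False
      then show ?thesis
        using O.harmonic_supported[OF f] O.harmonic_supported[OF O.isoproj_harmonic[OF f]]
        unfolding chain_supported_def by metis
    qed
  qed
  then show ?thesis by (auto simp: iso_harmonic_def)
qed

context chain_field_space
begin

lemma l2_homology_eq: "l2_homology D Orb \<Psi> n \<mu> = {F \<in> chain_fields. AE c in \<mu>. F c \<in> harmonic (\<Psi> c) n}"
proof -
  have "(AE c in \<mu>. laplacian (\<Psi> c) n (F c) = (\<lambda>_. 0)) \<longleftrightarrow> (AE c in \<mu>. F c \<in> harmonic (\<Psi> c) n)"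
    if F: "F \<in> chain_fields" for F
  proof (rule AE_cong)
    fix c assume c: "c \<in> space \<mu>"
    interpret bounded_orbit_complex G Orb "\<Psi> c" D by (rule fibre[OF c])
    show "laplacian (\<Psi> c) n (F c) = (\<lambda>_. 0) \<longleftrightarrow> F c \<in> harmonic (\<Psi> c) n"
      by (rule laplacian_harmonic[OF fields_chains[OF F c]])
  qed
  then show ?thesis unfolding l2_homology_def by (intro Collect_cong conj_cong refl)
qed

text \<open>The image of an idempotent is its set of fixed points, here almost everywhere;
  conversely, a fixed field is its own preimage.\<close>

lemma isotypic_component_eq:
  assumes \<kappa>: "isotypic_proj G \<rho> = (isoproj G \<kappa> :: ('g, 'x) chain \<Rightarrow> _)"
    and conv: "\<And>k. k \<in> carrier G \<Longrightarrow> (\<Sum>g\<in>carrier G. \<kappa> g * \<kappa> (inv g \<otimes> k)) = \<kappa> k"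
  shows "isotypic_component G D Orb \<Psi> n \<mu> \<rho> (l2_homology D Orb \<Psi> n \<mu>) =
    {F \<in> chain_fields. AE c in \<mu>. F c \<in> fibre_space c}"
proof safe
  fix F assume "F \<in> isotypic_component G D Orb \<Psi> n \<mu> \<rho> (l2_homology D Orb \<Psi> n \<mu>)"
  then obtain F' where F: "F \<in> chain_fields" and F': "F' \<in> l2_homology D Orb \<Psi> n \<mu>"
    and eq: "AE c in \<mu>. F c = isoproj G \<kappa> (F' c)"
    unfolding isotypic_component_def \<kappa> by (elim CollectE conjE bexE) (rule that)
  show "F \<in> chain_fields" by (rule F)
  have "AE c in \<mu>. F' c \<in> harmonic (\<Psi> c) n" using F' by (simp add: l2_homology_eq)
  with eq AE_space show "AE c in \<mu>. F c \<in> fibre_space c"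
  proof eventually_elim
    case (elim c)
    interpret bounded_orbit_complex G Orb "\<Psi> c" D by (rule fibre[OF elim(2)])
    show ?case
      using elim isoproj_harmonic[OF elim(3)] isoproj_idem[OF conv elim(3)] by (simp add: iso_harmonic_def)
  qed
next
  fix F assume F: "F \<in> chain_fields" "AE c in \<mu>. F c \<in> fibre_space c"
  have "F \<in> l2_homology D Orb \<Psi> n \<mu>"
    unfolding l2_homology_eq using F by (auto simp: iso_harmonic_def)
  moreover have "AE c in \<mu>. F c = isotypic_proj G \<rho> (F c)"
    using F(2) by eventually_elim (simp add: iso_harmonic_def \<kappa>)
  ultimately show "F \<in> isotypic_component G D Orb \<Psi> n \<mu> \<rho> (l2_homology D Orb \<Psi> n \<mu>)"
    unfolding isotypic_component_def using F(1) by blast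
qed

text \<open>Existence comes from the explicit \<open>fibre_proj\<close> and not from an abstract
  projection theorem.\<close>

lemma projection_exists:
  assumes c: "c \<in> space \<mu>" and xs: "xs \<in> ordered_simplices (\<Psi> c)" "length xs = n + 1"
  shows "\<exists>a\<in>fibre_space c. \<forall>f\<in>fibre_space c. ip (\<lambda>i. oriented_simplex xs i - a i) f = 0"
proof -
  have "xs \<in> Delta_lists" using xs Delta[OF c] by (auto simp: Delta_lists_def ordered_simplices_def)
  note p = fibre_proj_props[OF Delta_lists_NG[OF this] c]
  have "xi \<Psi> xs c = oriented_simplex xs" using xs by (simp add: xi_def ordered_simplices_def)
  with p show ?thesis by metis
qed

end

text \<open>The difference of the two sides is alternating, so evaluation relates its products with
  the two orientations by the sign; hence it is orthogonal to itself.\<close>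

lemma oriented_simplex_permute:
  assumes p: "p permutes {..<length xs}"
  shows "oriented_simplex (permute_list p xs) = (\<lambda>z. sgn_of p * oriented_simplex xs z)"
proof -
  let ?d = "\<lambda>z. oriented_simplex (permute_list p xs) z - sgn_of p * oriented_simplex xs z"
  have e: "ell2 (oriented_simplex zs)" for zs :: "'a list" by (intro ell2_fsupp oriented_simplex_fsupp)
  have d: "ell2 ?d" by (intro ell2_diff ell2_scale e)
  have alt: "alternating ?d"
    using oriented_simplex_alternating[of "permute_list p xs"] oriented_simplex_alternating[of xs]
    by (simp add: alternating_def right_diff_distrib mult.left_commute)
  have "ip ?d (oriented_simplex (permute_list p xs)) = sgn_of p * ip ?d (oriented_simplex xs)"
    by (simp add: ip_oriented_simplex[OF alt] alternatingD[OF alt p])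
  then have "ip ?d ?d = 0"
    by (simp add: ip_diff_right ip_scale_right e d ell2_scale)
  then have "?d = (\<lambda>_. 0)" using nsq_eq_0[OF d] by (simp add: ip_self[OF d])
  then show ?thesis by (auto simp: fun_eq_iff)
qed

text \<open>Reordering multiplies the projected simplex by a sign, and evaluation at the new
  ordering contributes the same sign again.\<close>

lemma harmonic_diag_orientation:
  assumes a: "a \<in> harmonic L n" "\<And>f. f \<in> harmonic L n \<Longrightarrow> ip (\<lambda>i. oriented_simplex xs i - a i) f = 0"
    and xs: "distinct xs" "distinct ys" "set xs = set ys"
  shows "harmonic_diag (harmonic L n) ys = harmonic_diag (harmonic L n) xs"
proof -
  have "mset ys = mset xs" using xs by (simp add: set_eq_iff_mset_eq_distinct)
  then obtain p where p: "p permutes {..<length xs}" "permute_list p xs = ys" by (rule mset_eq_permutation)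
  let ?b = "\<lambda>i. sgn_of p * a i"
  have b: "?b \<in> harmonic L n"
    using harmonic_sum[of "{()}" "\<lambda>_. a" L n "\<lambda>_. sgn_of p"] a(1) by simp
  have os: "(\<lambda>i. oriented_simplex ys i - ?b i) = (\<lambda>i. sgn_of p * (oriented_simplex xs i - a i))"
    unfolding p(2)[symmetric] oriented_simplex_permute[OF p(1)] by (simp add: right_diff_distrib)
  have "harmonic_diag (harmonic L n) ys = Re (?b ys)"
    by (rule harmonic_diag_eq[OF harmonic_diff harmonic_ell2 b]) (simp_all add: os ip_scale_left a(2))
  also have "?b ys = a xs"
    using a(1) p unfolding harmonic_def
    by (auto simp: l2_chains_iff alternatingD sgn_of_square(1) simp flip: p(2))
  also have "Re (a xs) = harmonic_diag (harmonic L n) xs"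
    by (rule harmonic_diag_eq[OF harmonic_diff harmonic_ell2 a, symmetric])
  finally show ?thesis .
qed

text \<open>The simplices at \<open>\<phi> g v\<close> are the translates of those at
  \<open>v\<close>, and each diagonal entry acquires the factor \<open>k\<close>, the value of
  \<kappa> at the identity.\<close>

lemma (in free_translates) star_sum_translate:
  assumes conv: "\<And>k. k \<in> carrier G \<Longrightarrow> (\<Sum>g\<in>carrier G. \<kappa> g * \<kappa> (inv g \<otimes> k)) = \<kappa> k"
    and sym: "\<And>g. g \<in> carrier G \<Longrightarrow> \<kappa> (inv g) = cnj (\<kappa> g)"
    and one: "\<kappa> \<one> = of_real k"
    and ex: "\<And>xs. xs \<in> ordered_simplices L \<Longrightarrow> length xs = n + 1 \<Longrightarrow>
      \<exists>a\<in>harmonic L n. \<forall>f\<in>harmonic L n. ip (\<lambda>i. oriented_simplex xs i - a i) f = 0"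
    and g: "g \<in> carrier G" and v: "v \<in> \<Union>L"
  shows "(\<Sum>s | s \<in> M \<and> card s = n + 1 \<and> \<phi> g v \<in> s. harmonic_diag (iso_harmonic G \<kappa> M n) (orient s)) =
    k * (\<Sum>s | s \<in> L \<and> card s = n + 1 \<and> v \<in> s. harmonic_diag (harmonic L n) (orient s))"
proof -
  interpret E: component_embedding L M "\<phi> g" by (rule component_embedding_translate[OF g])
  have fin: "finite s" if "s \<in> L" for s using complex_L that by (simp add: simplicial_complex_def)
  have orient: "distinct (orient s)" "set (orient s) = s" if "finite s" for s :: "'c set"
    using someI_ex[OF finite_distinct_list[OF that]] by (auto simp: orient_def conj_commute)
  have inj: "inj_on (\<phi> g) s" if "s \<subseteq> \<Union>L" for s by (rule inj_on_subset[OF E.inj that])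
  have card: "card (\<phi> g ` s) = card s" if "s \<in> L" for s using that by (intro card_image inj) auto
  have bij: "bij_betw ((`) (\<phi> g)) {s. s \<in> L \<and> card s = n + 1 \<and> v \<in> s} {s. s \<in> M \<and> card s = n + 1 \<and> \<phi> g v \<in> s}"
    unfolding bij_betw_def
  proof
    show "inj_on ((`) (\<phi> g)) {s. s \<in> L \<and> card s = n + 1 \<and> v \<in> s}"
      by (rule inj_on_inverseI[of _ "\<lambda>s. inv_into (\<Union>L) (\<phi> g) ` s"]) (simp add: E.inv_image)
    show "(`) (\<phi> g) ` {s. s \<in> L \<and> card s = n + 1 \<and> v \<in> s} = {s. s \<in> M \<and> card s = n + 1 \<and> \<phi> g v \<in> s}"
    proof safe
      fix t assume t: "t \<in> M" "card t = n + 1" "\<phi> g v \<in> t"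
      then obtain s where s: "s \<in> L" "t = \<phi> g ` s" using E.preimage[OF t(1)] v by blast
      then obtain w where "w \<in> s" "\<phi> g v = \<phi> g w" using t(3) by blast
      then have "v \<in> s" using free[OF g g v, of w] s(1) by blast
      then show "t \<in> (`) (\<phi> g) ` {s. s \<in> L \<and> card s = n + 1 \<and> v \<in> s}" using s t card by auto
    qed (auto simp: E.simplex_image card)
  qed
  have "harmonic_diag (iso_harmonic G \<kappa> M n) (orient (\<phi> g ` s)) = k * harmonic_diag (harmonic L n) (orient s)"
    if s: "s \<in> L" "card s = n + 1" for s
  proof -
    have "finite (\<phi> g ` s)" using fin[OF s(1)] by simp
    then have zs: "distinct (orient (\<phi> g ` s))" "set (orient (\<phi> g ` s)) = \<phi> g ` s"
      using someI_ex[OF finite_distinct_list] by (auto simp: orient_def conj_commute)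
    have "orient (\<phi> g ` s) \<in> ordered_simplices M" using zs E.simplex_image[OF s(1)] by (simp add: ordered_simplices_def)
    moreover have "s \<noteq> {}" using s(2) by auto
    then have "set (orient (\<phi> g ` s)) \<inter> \<phi> g ` \<Union>L \<noteq> {}" using s(1) unfolding zs(2) by blast
    \<comment> \<open>The order chosen on the translated simplex need not be the translate of the
      order chosen on \<open>s\<close>. It is pulled back to \<open>xs\<close>, and
      \<open>harmonic_diag_orientation\<close> compares this with \<open>orient s\<close> at the
      end.\<close>
    ultimately obtain xs where xs: "xs \<in> ordered_simplices L" "set xs \<subseteq> \<Union>L" "orient (\<phi> g ` s) = map (\<phi> g) xs"
      by (rule E.ordered_preimage)
    have "\<phi> g ` set xs = \<phi> g ` s" using zs(2) xs(3) by simp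
    then have set: "set xs = s" using xs(2) s(1) inj_on_image_eq_iff[OF E.inj xs(2), of s] by blast
    have dist: "distinct xs" using xs(1) by (simp add: ordered_simplices_def)
    then have len: "length xs = n + 1" using set s(2) distinct_card by fastforce
    obtain a where a: "a \<in> harmonic L n" "\<And>f. f \<in> harmonic L n \<Longrightarrow> ip (\<lambda>i. oriented_simplex xs i - a i) f = 0"
      using ex[OF xs(1) len] by blast
    obtain q where q: "q \<in> iso_harmonic G \<kappa> M n"
      "\<And>f. f \<in> iso_harmonic G \<kappa> M n \<Longrightarrow> ip (\<lambda>zs. oriented_simplex (map (\<phi> g) xs) zs - q zs) f = 0"
      "q (map (\<phi> g) xs) = \<kappa> \<one> * a xs"
      by (rule projection_translate[OF conv sym g xs(1) len a]; (assumption | (rule that; assumption)))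
    have "harmonic_diag (iso_harmonic G \<kappa> M n) (map (\<phi> g) xs) = Re (q (map (\<phi> g) xs))"
      by (rule harmonic_diag_eq[OF iso_harmonic_diff iso_harmonic_ell2 q(1,2)])
    also have "\<dots> = k * Re (a xs)" by (simp add: q(3) one)
    also have "Re (a xs) = harmonic_diag (harmonic L n) xs"
      by (rule harmonic_diag_eq[OF harmonic_diff harmonic_ell2 a, symmetric])
    also have "\<dots> = harmonic_diag (harmonic L n) (orient s)"
      using orient[OF fin[OF s(1)]] dist set by (intro harmonic_diag_orientation[OF a, symmetric]) auto
    finally show ?thesis by (simp add: xs(3))
  qed
  then have "(\<Sum>s | s \<in> L \<and> card s = n + 1 \<and> v \<in> s. harmonic_diag (iso_harmonic G \<kappa> M n) (orient (\<phi> g ` s))) =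
      k * (\<Sum>s | s \<in> L \<and> card s = n + 1 \<and> v \<in> s. harmonic_diag (harmonic L n) (orient s))"
    unfolding sum_distrib_left by (intro sum.cong refl) auto
  then show ?thesis by (subst sum.reindex_bij_betw[OF bij, symmetric])
qed

text \<open>Level 0 of a fibre meets only the root type, and all root vertices contribute the same
  \<open>S\<close>; dividing by the size of the orbit removes that size from the result.\<close>

lemma (in realized) trace_density_root:
  assumes c: "c \<in> SC G D 1" and \<mu>: "prob_space \<mu>" "sets \<mu> = sets (SC_borel G D 1)"
    and X: "X \<in> Orb" "\<And>X' x'. X' \<in> Orb \<Longrightarrow> x' \<in> fst X' \<Longrightarrow> (0, X', x') \<in> \<Union>(\<Psi> c) \<Longrightarrow> X' = X"
    and S: "\<And>w. w \<in> base_orbit X \<Longrightarrow> chain_field_space.star_sum G n \<Psi> \<kappa> w c = S"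
  shows "chain_field_space.trace_density G Orb n \<Psi> \<kappa> c = S / (n + 1)"
proof -
  interpret C: chain_field_space G Orb \<mu> D n \<Psi> \<kappa> by (rule chain_field_space[OF \<mu>])
  have zero: "C.star_sum (0, X', x') c = 0" if "X' \<in> Orb" "x' \<in> fst X'" "X' \<noteq> X" for X' x'
  proof -
    have "{s. s \<in> \<Psi> c \<and> card s = n + 1 \<and> (0, X', x') \<in> s} = {}" using X(2)[OF that(1,2)] that(3) by blast
    then show ?thesis unfolding C.star_sum_def by (simp only: sum.empty)
  qed
  have "fst X \<noteq> {}" using transitive[OF X(1)] by (simp add: transitive_gset_def)
  then have card: "card (fst X) \<noteq> 0" using finite_orbit[OF X(1)] by simp
  have "C.trace_density c = (\<Sum>x\<in>fst X. C.star_sum (0, X, x) c / (card (fst X) * (n + 1)))"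
    unfolding C.trace_density_def using finite_Orb X(1) zero
    by (subst sum.remove[of Orb X]) (auto intro!: sum.neutral)
  also have "\<dots> = (\<Sum>x\<in>fst X. S / (card (fst X) * (n + 1)))"
    using S by (intro sum.cong refl) (auto simp: base_orbit_def)
  also have "\<dots> = S / (n + 1)" using card by (simp del: mult_Suc_right)
  finally show ?thesis .
qed

theorem theorem1p2:
  fixes G :: "'g monoid" and D n :: nat
    and \<mu> :: "'g rclass measure"
    and \<rho> :: "'g \<Rightarrow> complex^'d^'d"
    and Orb\<^sub>1 :: "('g, 'y) gset set" and \<Psi>\<^sub>1 :: "('g, 'y) realization"
    and Orb\<^sub>G :: "('g, 'x) gset set" and \<Psi>\<^sub>G :: "('g, 'x) realization"
  assumes "group G" and "finite (carrier G)" and "D > 0"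
    and "orbit_representatives (trivial_subgroup G) Orb\<^sub>1"
    and "realization_map (trivial_subgroup G) D Orb\<^sub>1 \<Psi>\<^sub>1"
    and "orbit_representatives G Orb\<^sub>G"
    and "realization_map G D Orb\<^sub>G \<Psi>\<^sub>G"
    and "random_rooted_gcomplex (trivial_subgroup G) D \<mu>"
    and "sofic (trivial_subgroup G) D \<mu>"
    and "irreducible_representation G \<rho>"
  shows "l2_multiplicity G D Orb\<^sub>G \<Psi>\<^sub>G n \<rho> (ind_measure G {\<one>\<^bsub>G\<^esub>} D \<mu>) =
    of_nat CARD('d) / of_nat (card (carrier G)) * l2_betti D Orb\<^sub>1 \<Psi>\<^sub>1 n \<mu>"
proof -
  interpret finite_group G
    using assms(1,2) by (simp add: finite_group_def finite_group_axioms_def)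
  interpret TG: group TG by (rule TG_group)
  interpret R1: realized TG Orb\<^sub>1 D \<Psi>\<^sub>1
    by unfold_locales (use assms(4,5) in \<open>auto simp: orbit_representatives_def\<close>)
  interpret RG: realized G Orb\<^sub>G D \<Psi>\<^sub>G
    by unfold_locales (use assms(2,6,7) in \<open>auto simp: orbit_representatives_def\<close>)
  let ?\<nu> = "ind_measure G {\<one>\<^bsub>G\<^esub>} D \<mu>"
  define \<kappa> where "\<kappa> = (\<lambda>g. rep_character \<rho> \<one>\<^bsub>G\<^esub> / of_nat (card (carrier G)) * cnj (rep_character \<rho> g))"
  have coeff: "k \<in> carrier G \<Longrightarrow> (\<Sum>g\<in>carrier G. \<kappa> g * \<kappa> (inv\<^bsub>G\<^esub> g \<otimes>\<^bsub>G\<^esub> k)) = \<kappa> k"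
    "g \<in> carrier G \<Longrightarrow> \<kappa> (inv\<^bsub>G\<^esub> g) = cnj (\<kappa> g)"
    "\<kappa> \<one>\<^bsub>G\<^esub> = of_nat CARD('d) * of_nat CARD('d) / of_nat (card (carrier G))" for g k
    unfolding \<kappa>_def using isotypic_coefficients[OF assms(1,2,10)] by simp_all
  \<comment> \<open>The value of \<kappa> at the identity as a real number, because trace densities
    are real.\<close>
  define k :: real where "k = of_nat CARD('d) * of_nat CARD('d) / of_nat (card (carrier G))"
  have one: "\<kappa> \<one>\<^bsub>G\<^esub> = of_real k" using coeff(3) by (simp add: k_def)
  have \<mu>: "prob_space \<mu>" "sets \<mu> = sets (SC_borel TG D 1)"
    using assms(8) by (auto simp: random_rooted_gcomplex_def)
  have ind: "ind_class G {\<one>\<^bsub>G\<^esub>} \<in> measurable \<mu> (SC_borel G D 1)"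
    using ind_class_measurable \<mu>(2) by (simp cong: measurable_cong_sets)
  have \<nu>: "prob_space ?\<nu>" "sets ?\<nu> = sets (SC_borel G D 1)"
    unfolding ind_measure_def using prob_space.prob_space_distr[OF \<mu>(1) ind] by auto
  have space: "space \<mu> = SC TG D 1"
    using sets_eq_imp_space_eq[OF \<mu>(2)] by (simp only: SC_borel_space)
  interpret C1: chain_field_space TG Orb\<^sub>1 \<mu> D n \<Psi>\<^sub>1 "\<lambda>_. 1" by (rule R1.chain_field_space[OF \<mu>])
  interpret CG: chain_field_space G Orb\<^sub>G ?\<nu> D n \<Psi>\<^sub>G \<kappa> by (rule RG.chain_field_space[OF \<nu>])
  have density: "CG.trace_density (ind_class G {\<one>\<^bsub>G\<^esub>} c) = k * C1.trace_density c" if "c \<in> space \<mu>" for c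
  proof -
    have c: "c \<in> SC TG D 1" using that by (simp add: space)
    let ?c = "ind_class G {\<one>\<^bsub>G\<^esub>} c"
    have c': "?c \<in> SC G D 1" by (rule ind_class_SC[OF c])
    obtain X1 where X1: "X1 \<in> Orb\<^sub>1" "base_orbit X1 \<subseteq> \<Union>(\<Psi>\<^sub>1 c)"
      "rooted_class TG (sub_gcomplex (\<Psi>\<^sub>1 c)) [base_orbit X1] = c"
      "\<And>X' x'. X' \<in> Orb\<^sub>1 \<Longrightarrow> x' \<in> fst X' \<Longrightarrow> (0, X', x') \<in> \<Union>(\<Psi>\<^sub>1 c) \<Longrightarrow> X' = X1"
      by (rule R1.root_type[OF c]) (rule that)
    obtain XG where XG: "XG \<in> Orb\<^sub>G" "base_orbit XG \<subseteq> \<Union>(\<Psi>\<^sub>G ?c)"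
      "rooted_class G (sub_gcomplex (\<Psi>\<^sub>G ?c)) [base_orbit XG] = ?c"
      "\<And>X' x'. X' \<in> Orb\<^sub>G \<Longrightarrow> x' \<in> fst X' \<Longrightarrow> (0, X', x') \<in> \<Union>(\<Psi>\<^sub>G ?c) \<Longrightarrow> X' = XG"
      by (rule RG.root_type[OF c']) (rule that)
    \<comment> \<open>The two realizations are related through the classes alone, whatever vertices
      they use.\<close>
    obtain \<phi> where \<phi>: "induced G \<phi> (sub_gcomplex (\<Psi>\<^sub>1 c)) (sub_gcomplex (\<Psi>\<^sub>G ?c))"
      "base_orbit XG = translates G \<phi> (base_orbit X1)"
      by (rule ind_class_induced[OF c R1.sub_gcomplex_simplicial[OF c] X1(3)
            RG.sub_gcomplex_simplicial[OF c'] XG(3)])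
    interpret O1: bounded_orbit_complex TG Orb\<^sub>1 "\<Psi>\<^sub>1 c" D by (rule R1.bounded_fibre[OF c])
    interpret OG: bounded_orbit_complex G Orb\<^sub>G "\<Psi>\<^sub>G ?c" D by (rule RG.bounded_fibre[OF c'])
    interpret F: free_translates G Orb\<^sub>G "\<Psi>\<^sub>G ?c" "\<Psi>\<^sub>1 c" \<phi>
    proof
      show "simplicial_complex (\<Psi>\<^sub>1 c)" by (rule O1.complex)
      show "\<Psi>\<^sub>G ?c = {\<phi> g ` \<sigma> | g \<sigma>. g \<in> carrier G \<and> \<sigma> \<in> \<Psi>\<^sub>1 c}"
        using inducedD(2)[OF \<phi>(1)] by (simp add: R1.sub_gcomplex_simps RG.sub_gcomplex_simps)
      show "g = h \<and> v = w" if "g \<in> carrier G" "h \<in> carrier G" "v \<in> \<Union>(\<Psi>\<^sub>1 c)" "w \<in> \<Union>(\<Psi>\<^sub>1 c)" "\<phi> g v = \<phi> h w" for g h v w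
        using inducedD(1)[OF \<phi>(1) that(1,2) _ _ that(5)] that(3,4) by (simp add: R1.sub_gcomplex_simps)
      show "NG_act h (\<phi> g v) = \<phi> (h \<otimes>\<^bsub>G\<^esub> g) v" if "g \<in> carrier G" "h \<in> carrier G" "v \<in> \<Union>(\<Psi>\<^sub>1 c)" for g h v
      proof -
        have "\<phi> g v \<in> \<Union>(\<Psi>\<^sub>G ?c)"
          using induced_verts[OF \<phi>(1)] that unfolding translates_def R1.sub_gcomplex_simps RG.sub_gcomplex_simps by blast
        then have "action (sub_gcomplex (\<Psi>\<^sub>G ?c)) h (\<phi> g v) = NG_act h (\<phi> g v)" by (simp add: sub_gcomplex_def)
        then show ?thesis using inducedD(3)[OF \<phi>(1) that(1,2)] that(3) by (simp add: R1.sub_gcomplex_simps)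
      qed
    qed
    have fib: "C1.fibre_space c = harmonic (\<Psi>\<^sub>1 c) n"
      by (rule iso_harmonic_trivial[OF R1.orbit_complex_fibre[OF c]])
    have star: "CG.star_sum (\<phi> g v) ?c = k * C1.star_sum v c" if "g \<in> carrier G" "v \<in> \<Union>(\<Psi>\<^sub>1 c)" for g v
      unfolding CG.star_sum_def C1.star_sum_def fib
      using C1.projection_exists[OF \<open>c \<in> space \<mu>\<close>, unfolded fib]
      by (intro F.star_sum_translate[OF coeff(1,2) one _ that]) auto
    \<comment> \<open>A transitive set of the trivial group is a single point.\<close>
    obtain x1 where x1: "fst X1 = {x1}"
    proof -
      interpret T: transitive_action TG "fst X1" "snd X1"
        using R1.transitive[OF X1(1)] by (simp add: transitive_gset_def)
      obtain x1 where x1: "x1 \<in> fst X1" using R1.transitive[OF X1(1)] by (auto simp: transitive_gset_def)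
      have "y = x1" if y: "y \<in> fst X1" for y
        using T.unique_orbit[OF x1 y] T.id_eq_one x1 by (auto dest: fun_cong[of _ _ x1])
      with x1 have "fst X1 = {x1}" by blast
      then show ?thesis by (rule that)
    qed
    let ?v = "(0, X1, x1)"
    have base: "base_orbit X1 = {?v}" by (simp add: base_orbit_def x1)
    have "C1.trace_density c = C1.star_sum ?v c / (n + 1)"
      by (rule R1.trace_density_root[OF c \<mu> X1(1,4)]) (simp_all add: base)
    moreover have "CG.trace_density ?c = k * C1.star_sum ?v c / (n + 1)"
    proof (rule RG.trace_density_root[OF c' \<nu> XG(1,4)])
      \<comment> \<open>Every root vertex of the induced complex is a translate of the single root,
        so all of them have the same star sum.\<close>
      fix w assume "w \<in> base_orbit XG"
      then obtain g where "g \<in> carrier G" "w = \<phi> g ?v" unfolding \<phi>(2) base by (auto simp: translates_def)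
      then show "CG.star_sum w ?c = k * C1.star_sum ?v c" using star X1(2) base by auto
    qed
    ultimately show ?thesis by simp
  qed
  have betti: "l2_betti D Orb\<^sub>1 \<Psi>\<^sub>1 n \<mu> = of_real (\<integral>c. C1.trace_density c \<partial>\<mu>)"
    unfolding l2_betti_def
  proof (rule C1.vN_dim_eq)
    have "(AE c in \<mu>. F c \<in> harmonic (\<Psi>\<^sub>1 c) n) \<longleftrightarrow> (AE c in \<mu>. F c \<in> C1.fibre_space c)" for F
      using iso_harmonic_trivial[OF R1.orbit_complex_fibre] by (intro AE_cong) (simp add: space)
    then show "l2_homology D Orb\<^sub>1 \<Psi>\<^sub>1 n \<mu> = {F \<in> C1.chain_fields. AE c in \<mu>. F c \<in> C1.fibre_space c}"
      by (simp add: C1.l2_homology_eq)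
  qed
  have "vN_dim D Orb\<^sub>G \<Psi>\<^sub>G n ?\<nu> (isotypic_component G D Orb\<^sub>G \<Psi>\<^sub>G n ?\<nu> \<rho> (l2_homology D Orb\<^sub>G \<Psi>\<^sub>G n ?\<nu>)) =
      of_real (\<integral>c. CG.trace_density c \<partial>?\<nu>)"
    by (intro CG.vN_dim_eq CG.isotypic_component_eq coeff(1)) (simp_all only: isotypic_proj_isoproj \<kappa>_def)
  also have "(\<integral>c. CG.trace_density c \<partial>?\<nu>) = (\<integral>c. CG.trace_density (ind_class G {\<one>\<^bsub>G\<^esub>} c) \<partial>\<mu>)"
    unfolding ind_measure_def
    using CG.trace_density_measurable \<nu>(2) by (intro integral_distr[OF ind]) (simp cong: measurable_cong_sets)
  also have "\<dots> = (\<integral>c. k * C1.trace_density c \<partial>\<mu>)"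
    by (rule Bochner_Integration.integral_cong[OF refl density])
  also have "\<dots> = k * (\<integral>c. C1.trace_density c \<partial>\<mu>)" by simp
  finally have dim: "vN_dim D Orb\<^sub>G \<Psi>\<^sub>G n ?\<nu> (isotypic_component G D Orb\<^sub>G \<Psi>\<^sub>G n ?\<nu> \<rho> (l2_homology D Orb\<^sub>G \<Psi>\<^sub>G n ?\<nu>)) =
      of_real k * l2_betti D Orb\<^sub>1 \<Psi>\<^sub>1 n \<mu>" by (simp add: betti)
  \<comment> \<open>One of the two factors dim in \<open>k\<close> cancels against the division by
    the character at the identity.\<close>
  have "rep_character \<rho> \<one>\<^bsub>G\<^esub> = of_nat CARD('d)"
    using assms(10) by (intro character_one) (simp add: irreducible_representation_def)
  then show ?thesis unfolding l2_multiplicity_def dim by (simp add: k_def)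
qed

end
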